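(* Let $\overline{\mathbf{s}}$ be the seed obtained from a seed $\mathbf{s}$ by folding along the action of a finite group $\Pi$. Then the scattering diagram $\mathfrak{D}_{\overline{\mathbf{s}}}$ can be obtained from $\mathfrak{D}_{\mathbf{s}}$ via a quotient construction: the quotient scattering diagram $\overline{\mathfrak{D}_{\mathbf{s}}}$ is equivalent to $\mathfrak{D}_{\overline{\mathbf{s}}}$.
   Context: General scattering diagrams. Let $L$ be a lattice of finite rank with basis $(b_j)_{j\in J}$, $L^*$ its dual, $\{\cdot,\cdot\}$ a skew-symmetric bilinear form on $L$, $L^+$ the set of nonzero nonnegative integer combinations of the $b_j$, and $d:L\to\mathbb{Z}$ the sum of coefficients. Let $\mathfrak{h}=\bigoplus_{n\in L^+}\mathfrak{h}_n$ be an $L^+$-graded Lie algebra over $\mathbb{C}$ with $[\mathfrak{h}_{n},\mathfrak{h}_{n'}]=0$ whenever $\{n,n'\}=0$. Put $\mathfrak{h}^{>k}=\bigoplus_{d(n)>k}\mathfrak{h}_n$, $\mathfrak{h}^{\le k}=\mathfrak{h}/\mathfrak{h}^{>k}$, $H^{\le k}=\exp(\mathfrak{h}^{\le k})$ (Baker--Campbell--Hausdorff product), $H=\varprojlim H^{\le k}$. For $n_0\in L^+$ primitive, $H_{n_0}^\parallel\subset H$ is the (abelian) subgroup of the completion of $\bigoplus_{k\ge1}\mathfrak{h}_{kn_0}$. A wall is a pair $(\mathfrak{d},g_{\mathfrak{d}})$ with $\mathfrak{d}\subset n_0^\perp\subset L^*_{\mathbb{R}}$ a convex rational polyhedral cone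 of dimension $\mathrm{rank}\,L-1$ and $g_{\mathfrak{d}}\in H^\parallel_{n_0}$, for some primitive $n_0\in L^+$; it is incoming if $\{n_0,\cdot\}\in\mathfrak{d}$. A scattering diagram is a collection of walls such that for each $k$ only finitely many $g_{\mathfrak{d}}$ have nontrivial image in $H^{\le k}$. A path is generic if it is a smooth immersion $\gamma:[0,1]\to L^*_{\mathbb{R}}$ with end points outside the nontrivial walls, avoiding boundaries of walls and codimension-two intersections of walls, and crossing walls transversally. The path-ordered product $\mathfrak{p}_\gamma\in H$ is, modulo each order, $g_{t_s}^{\varepsilon_s}\cdots g_{t_1}^{\varepsilon_1}$, where $t_1<\dots<t_s$ are the crossing times, $g_{t_i}$ is the product of the elements of the walls containing $\gamma(t_i)$ (lying in $n_i^\perp$), and $\varepsilon_i=1$ if $\langle n_i,\gamma(t)\rangle$ is decreasing at $t_i$ and $-1$ otherwise. The diagram is consistent if $\mathfrak{p}_\gamma$ depends only on the end points of $\gamma$. A point $x\in L^*_{\mathbb{R}}$ is general if it lies in at most one hyperplane $n_0^\perp$, $0\neq n_0\in L$ (up to scaling of $n_0$); $g_x(\mathfrak{D})=\prod_{\mathfrak{d}\ni x}g_{\mathfrak{d}}$; two diagrams are equivalent if $g_x$ agrees for all general $x$. A consistent diagram is determined up to equivalence by its incoming walls, and any collection of incoming walls of the form $(n_0^\perp,g_{n_0})$ arises. The seed $\mathbf{s}$. $N$ is a lattice with skew-symmetric form $\{\cdot,\cdot\}:N\times N\to\mathbb{Z}$, $I=\{1,\dots,r\}$, $\mathbf{s}=(e_i)_{i\in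 I}$ a basis of $N$ (simply laced, no frozen indices), $M=\mathrm{Hom}(N,\mathbb{Z})$. $\mathfrak{g}=\bigoplus_{n\in N^+}\mathbb{C}z^n$ with $[z^n,z^{n'}]=-\{n,n'\}z^{n+n'}$, with group $G$. $\mathfrak{D}_{\mathbf{s}}$ is the consistent scattering diagram in $M_{\mathbb{R}}$ for $\mathfrak{g}$ with incoming walls $(e_i^\perp,\exp(-\mathrm{Li}_2(-z^{e_i})))$, $i\in I$, where $\mathrm{Li}_2(x)=\sum_{k\ge1}x^k/k^2$. Folding. A finite group $\Pi$ acts on $I$ with $\{e_{\pi_1\cdot i},e_{\pi_2\cdot j}\}=\{e_i,e_j\}$ for all $i,j\in I$, $\pi_1,\pi_2\in\Pi$. $\overline{I}$ is the set of orbits $\Pi i$; $\overline{N}$ is the lattice with basis $(e_{\Pi i})_{\Pi i\in\overline{I}}$, form $\{e_{\Pi i},e_{\Pi j}\}=\{e_i,e_j\}$, dual $\overline{M}$; $q:N\to\overline{N}$, $e_i\mapsto e_{\Pi i}$, with dual embedding $q^*:\overline{M}_{\mathbb{R}}\hookrightarrow M_{\mathbb{R}}$; $d_{\Pi i}=|\Pi i|$; $\overline{\mathbf{s}}=(e_{\Pi i})$. $\overline{\mathfrak{g}}=\bigoplus_{\overline{n}\in\overline{N}^+}\mathbb{C}z^{\overline{n}}$ with $[z^{\overline{n}},z^{\overline{n}'}]=-\{\overline{n},\overline{n}'\}z^{\overline{n}+\overline{n}'}$, group $\overline{G}$. $\mathfrak{D}_{\overline{\mathbf{s}}}$ is the consistent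 scattering diagram in $\overline{M}_{\mathbb{R}}$ for $\overline{\mathfrak{g}}$ with incoming walls $(e_{\Pi i}^\perp,\exp(-d_{\Pi i}\mathrm{Li}_2(-z^{e_{\Pi i}})))$. The Lie algebra map $z^n\mapsto z^{q(n)}$ induces $\tilde q:G\to\overline{G}$. Quotient construction. Choose $\mathfrak{D}_{\mathbf{s}}$ in its equivalence class so that whenever $x\in\overline{M}_{\mathbb{R}}$ is general and $q^*(x)$ lies in the support of a wall $\mathfrak{d}$, $q^*(x)$ is in the (relative) interior of $\mathfrak{d}$ (such a representative exists). $\overline{\mathfrak{D}_{\mathbf{s}}}$ is the scattering diagram in $\overline{M}_{\mathbb{R}}$ consisting, modulo each order, of the walls $\big((q^* )^{-1}(\mathfrak{d}\cap q^*(\overline{M}_{\mathbb{R}})),\tilde q(g_{\mathfrak{d}})\big)$ for all nontrivial walls $(\mathfrak{d},g_{\mathfrak{d}})$ of $\mathfrak{D}_{\mathbf{s}}$ such that $\mathfrak{d}\cap q^*(\overline{M}_{\mathbb{R}})$ has codimension 1 in $q^*(\overline{M}_{\mathbb{R}})$. *)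

theory Defs
  imports "HOL-Analysis.Analysis" "HOL-Algebra.Group_Action" "HOL-Algebra.FiniteProduct"
begin

section \<open>Lattices with a basis\<close>

text \<open>
  A lattice $L$ with a basis $(b_j)_{j \in J}$ is \<open>int ^ 'n\<close> with \<open>'n\<close> the index set $J$ and
  \<open>axis j 1\<close> the basis vector $b_j$; then $L^*_{\bf R}$ is \<open>real ^ 'n\<close>, in the coordinates of the
  dual basis.  A bilinear form on $L$ is given by its values \<open>b i j\<close> on pairs of basis vectors.
\<close>

definition skew_matrix :: "('n::finite \<Rightarrow> 'n \<Rightarrow> int) \<Rightarrow> bool" where
  "skew_matrix b \<longleftrightarrow> (\<forall>i j. b i j = - b j i)"

definition form :: "('n::finite \<Rightarrow> 'n \<Rightarrow> int) \<Rightarrow> int ^ 'n \<Rightarrow> int ^ 'n \<Rightarrow> int" where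
  "form b n n' = (\<Sum>i\<in>UNIV. \<Sum>j\<in>UNIV. n $ i * n' $ j * b i j)"

definition pairing :: "int ^ 'n::finite \<Rightarrow> real ^ 'n \<Rightarrow> real" where
  "pairing n x = (\<Sum>i\<in>UNIV. real_of_int (n $ i) * x $ i)"

definition perp :: "int ^ 'n::finite \<Rightarrow> (real ^ 'n) set" where
  "perp n = {x. pairing n x = 0}"

definition form_dual :: "('n::finite \<Rightarrow> 'n \<Rightarrow> int) \<Rightarrow> int ^ 'n \<Rightarrow> real ^ 'n" where
  \<comment> \<open>the element $\{n, \cdot\}$ of $L^*$\<close>
  "form_dual b n = (\<chi> j. real_of_int (form b n (axis j 1)))"

definition lat_pos :: "(int ^ 'n::finite) set" where
  "lat_pos = {n. n \<noteq> 0 \<and> (\<forall>i. 0 \<le> n $ i)}"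

definition deg :: "int ^ 'n::finite \<Rightarrow> int" where
  "deg n = (\<Sum>i\<in>UNIV. n $ i)"

definition primitive_vec :: "int ^ 'n::finite \<Rightarrow> bool" where
  "primitive_vec n \<longleftrightarrow> Gcd (range (\<lambda>i. n $ i)) = 1"


section \<open>The graded Lie algebra and its pro-unipotent group\<close>

text \<open>
  A function \<open>f\<close> supported on \<open>lat_pos\<close> stands for the formal sum $\sum_n f(n) z^n$, an element of
  the completion of $\bigoplus_{n \in L^+} {\bf C} z^n$.
\<close>

type_synonym 'n series = "int ^ 'n \<Rightarrow> complex"

definition lie_carrier :: "'n::finite series set" where
  "lie_carrier = {f. \<forall>n. n \<notin> lat_pos \<longrightarrow> f n = 0}"

definition lie_bracket :: "('n::finite \<Rightarrow> 'n \<Rightarrow> int) \<Rightarrow> 'n series \<Rightarrow> 'n series \<Rightarrow> 'n series" where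
  \<comment> \<open>$[z^a, z^{a'}] = -\{a, a'\} z^{a+a'}$, extended bilinearly and continuously\<close>
  "lie_bracket b f g = (\<lambda>n. \<Sum>a\<in>{a. a \<in> lat_pos \<and> n - a \<in> lat_pos}.
     - of_int (form b a (n - a)) * f a * g (n - a))"

text \<open>The right-nested commutator $[x_1, [x_2, \ldots, [x_{l-1}, x_l] \ldots ]]$.\<close>

fun lie_word :: "('n::finite \<Rightarrow> 'n \<Rightarrow> int) \<Rightarrow> 'n series list \<Rightarrow> 'n series" where
  "lie_word b [] = (\<lambda>n. 0)"
| "lie_word b [x] = x"
| "lie_word b (x # y # xs) = lie_bracket b x (lie_word b (y # xs))"

text \<open>
  The Baker--Campbell--Hausdorff product in Dynkin's form
  \[ \sum_{m \ge 1} \frac{(-1)^{m-1}}{m} \sum_{r_i + s_i > 0}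
     \frac{[x^{r_1} y^{s_1} \cdots x^{r_m} y^{s_m}]}{\sum_i (r_i + s_i) \, \prod_i r_i! \, s_i!} . \]
  A commutator of more than \<open>deg n\<close> elements has no component in degree \<open>n\<close>, so each coefficient
  is a finite sum.
\<close>

definition bch :: "('n::finite \<Rightarrow> 'n \<Rightarrow> int) \<Rightarrow> 'n series \<Rightarrow> 'n series \<Rightarrow> 'n series" where
  "bch b x y = (\<lambda>n. \<Sum>ps\<in>{ps :: (nat \<times> nat) list. ps \<noteq> [] \<and> (0, 0) \<notin> set ps \<and>
                               int (\<Sum>(r, s)\<leftarrow>ps. r + s) \<le> deg n}.
     (- 1) ^ (length ps - 1) / of_nat (length ps)
     / (of_nat (\<Sum>(r, s)\<leftarrow>ps. r + s) * (\<Prod>(r, s)\<leftarrow>ps. fact r * fact s))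
     * lie_word b (concat (map (\<lambda>(r, s). replicate r x @ replicate s y) ps)) n)"

text \<open>
  The group $H = \varprojlim H^{\le k}$.  The group element $\exp(f)$ is represented by \<open>f\<close> itself.
\<close>

definition scat_group :: "('n::finite \<Rightarrow> 'n \<Rightarrow> int) \<Rightarrow> 'n series monoid" where
  "scat_group b = \<lparr>carrier = lie_carrier, mult = bch b, one = (\<lambda>n. 0)\<rparr>"

text \<open>The abelian group $H_{n_0}^\parallel$.\<close>

definition par_group :: "('n::finite \<Rightarrow> 'n \<Rightarrow> int) \<Rightarrow> int ^ 'n \<Rightarrow> 'n series monoid" where
  "par_group b n0 = (scat_group b)
     \<lparr>carrier := {f \<in> lie_carrier. \<forall>n. f n \<noteq> 0 \<longrightarrow> (\<exists>k::nat. 1 \<le> k \<and> n = of_nat k *s n0)}\<rparr>"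

definition nontriv_upto :: "nat \<Rightarrow> 'n::finite series \<Rightarrow> bool" where
  \<comment> \<open>nontrivial image in $H^{\le k}$\<close>
  "nontriv_upto k f \<longleftrightarrow> (\<exists>n. deg n \<le> int k \<and> f n \<noteq> 0)"

definition nontriv :: "'n::finite series \<Rightarrow> bool" where
  "nontriv f \<longleftrightarrow> f \<noteq> (\<lambda>n. 0)"

definition dilog :: "'n::finite \<Rightarrow> 'n series" where
  \<comment> \<open>$\mathrm{Li}_2(-z^{e_i}) = \sum_{k \ge 1} (-z^{e_i})^k / k^2$\<close>
  "dilog i = (\<lambda>n. \<Sum>k\<in>{k::nat. 1 \<le> k \<and> n = of_nat k *s axis i 1}. (- 1) ^ k / of_nat k ^ 2)"


section \<open>Scattering diagrams\<close>

text \<open>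
  A diagram is an indexed family of walls, since the same pair of a support and a group element
  may occur several times and then contributes several factors.
\<close>

record ('w, 'n) diagram =
  walls :: "'w set"
  supp :: "'w \<Rightarrow> (real ^ 'n) set"
  elt :: "'w \<Rightarrow> 'n series"

definition rational_polyhedral_cone :: "(real ^ 'n::finite) set \<Rightarrow> bool" where
  "rational_polyhedral_cone C \<longleftrightarrow>
     (\<exists>F :: (int ^ 'n) set. finite F \<and> C = {x. \<forall>n\<in>F. 0 \<le> pairing n x})"

definition is_wall :: "('n::finite \<Rightarrow> 'n \<Rightarrow> int) \<Rightarrow> (real ^ 'n) set \<Rightarrow> 'n series \<Rightarrow> bool" where
  "is_wall b C g \<longleftrightarrow> (\<exists>n0. n0 \<in> lat_pos \<and> primitive_vec n0 \<and> C \<subseteq> perp n0 \<and>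
     rational_polyhedral_cone C \<and> aff_dim C = int CARD('n) - 1 \<and> g \<in> carrier (par_group b n0))"

definition wall_normal :: "(real ^ 'n::finite) set \<Rightarrow> int ^ 'n" where
  \<comment> \<open>unique because the support of a wall spans a hyperplane\<close>
  "wall_normal C = (THE n0. n0 \<in> lat_pos \<and> primitive_vec n0 \<and> C \<subseteq> perp n0)"

definition scattering_diagram :: "('n::finite \<Rightarrow> 'n \<Rightarrow> int) \<Rightarrow> ('w, 'n) diagram \<Rightarrow> bool" where
  "scattering_diagram b D \<longleftrightarrow>
     (\<forall>w\<in>walls D. is_wall b (supp D w) (elt D w)) \<and>
     (\<forall>k. finite {w \<in> walls D. nontriv_upto k (elt D w)})"

definition incoming_walls :: "('n::finite \<Rightarrow> 'n \<Rightarrow> int) \<Rightarrow> ('w, 'n) diagram \<Rightarrow> 'w set" where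
  "incoming_walls b D = {w \<in> walls D. form_dual b (wall_normal (supp D w)) \<in> supp D w}"

definition nontriv_walls :: "('w, 'n::finite) diagram \<Rightarrow> 'w set" where
  "nontriv_walls D = {w \<in> walls D. nontriv (elt D w)}"

definition walls_at :: "('w, 'n::finite) diagram \<Rightarrow> nat \<Rightarrow> real ^ 'n \<Rightarrow> 'w set" where
  "walls_at D k x = {w \<in> walls D. x \<in> supp D w \<and> nontriv_upto k (elt D w)}"

text \<open>
  When all walls of \<open>walls_at D k x\<close> lie in one hyperplane (\<open>x\<close> general, or a crossing point of a
  generic path), \<open>normal_at D k x\<close> is its primitive normal vector in $L^+$ and \<open>local_elt b D k x\<close>
  represents, modulo order \<open>k\<close>, the product of the elements of the walls containing \<open>x\<close>.  If
  there are no such walls, \<open>normal_at\<close> is irrelevant and the product is the empty one.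
\<close>

definition normal_at :: "('w, 'n::finite) diagram \<Rightarrow> nat \<Rightarrow> real ^ 'n \<Rightarrow> int ^ 'n" where
  "normal_at D k x = (THE n0. n0 \<in> lat_pos \<and> primitive_vec n0 \<and>
     (\<forall>w\<in>walls_at D k x. supp D w \<subseteq> perp n0))"

definition local_elt ::
  "('n::finite \<Rightarrow> 'n \<Rightarrow> int) \<Rightarrow> ('w, 'n) diagram \<Rightarrow> nat \<Rightarrow> real ^ 'n \<Rightarrow> 'n series" where
  "local_elt b D k x = finprod (par_group b (normal_at D k x)) (elt D) (walls_at D k x)"


subsection \<open>Equivalence\<close>

definition general_point :: "real ^ 'n::finite \<Rightarrow> bool" where
  "general_point x \<longleftrightarrow>
     (\<forall>n n'. n \<noteq> 0 \<and> n' \<noteq> 0 \<and> x \<in> perp n \<and> x \<in> perp n' \<longrightarrow> perp n = perp n')"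

definition elt_at :: "('n::finite \<Rightarrow> 'n \<Rightarrow> int) \<Rightarrow> ('w, 'n) diagram \<Rightarrow> real ^ 'n \<Rightarrow> 'n series" where
  \<comment> \<open>$g_x(D)$; its coefficient at \<open>n\<close> is read off modulo order \<open>deg n\<close>\<close>
  "elt_at b D x = (\<lambda>n. local_elt b D (nat (deg n)) x n)"

definition equivalent_diagrams ::
  "('n::finite \<Rightarrow> 'n \<Rightarrow> int) \<Rightarrow> ('v, 'n) diagram \<Rightarrow> ('w, 'n) diagram \<Rightarrow> bool" where
  "equivalent_diagrams b D D' \<longleftrightarrow> (\<forall>x. general_point x \<longrightarrow> elt_at b D x = elt_at b D' x)"


subsection \<open>Consistency\<close>

definition smooth_immersion :: "(real \<Rightarrow> real ^ 'n::finite) \<Rightarrow> bool" where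
  \<comment> \<open>\<open>c k\<close> is the \<open>k\<close>-th derivative on the unit interval, one-sided at its end points\<close>
  "smooth_immersion \<gamma> \<longleftrightarrow> (\<exists>c :: nat \<Rightarrow> real \<Rightarrow> real ^ 'n.
     (\<forall>t\<in>{0..1}. c 0 t = \<gamma> t) \<and>
     (\<forall>k. \<forall>t\<in>{0..1}. (c k has_vector_derivative c (Suc k) t) (at t within {0..1})) \<and>
     (\<forall>t\<in>{0..1}. c 1 t \<noteq> 0))"

definition velocity :: "(real \<Rightarrow> real ^ 'n::finite) \<Rightarrow> real \<Rightarrow> real ^ 'n" where
  "velocity \<gamma> t = vector_derivative \<gamma> (at t within {0..1})"

definition generic_path :: "('w, 'n::finite) diagram \<Rightarrow> (real \<Rightarrow> real ^ 'n) \<Rightarrow> bool" where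
  "generic_path D \<gamma> \<longleftrightarrow> smooth_immersion \<gamma> \<and>
     (\<forall>w\<in>nontriv_walls D. \<gamma> 0 \<notin> supp D w \<and> \<gamma> 1 \<notin> supp D w) \<and>
     (\<forall>w\<in>nontriv_walls D. \<forall>t\<in>{0..1}. \<gamma> t \<notin> rel_frontier (supp D w)) \<and>
     (\<forall>v\<in>nontriv_walls D. \<forall>w\<in>nontriv_walls D.
        aff_dim (supp D v \<inter> supp D w) = int CARD('n) - 2 \<longrightarrow>
        (\<forall>t\<in>{0..1}. \<gamma> t \<notin> supp D v \<inter> supp D w)) \<and>
     (\<forall>w\<in>nontriv_walls D. \<forall>t\<in>{0..1}. \<gamma> t \<in> supp D w \<longrightarrow>
        pairing (wall_normal (supp D w)) (velocity \<gamma> t) \<noteq> 0)"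

definition crossing_times ::
  "('w, 'n::finite) diagram \<Rightarrow> nat \<Rightarrow> (real \<Rightarrow> real ^ 'n) \<Rightarrow> real set" where
  "crossing_times D k \<gamma> = {t \<in> {0..1}. walls_at D k (\<gamma> t) \<noteq> {}}"

definition crossing_sign ::
  "('w, 'n::finite) diagram \<Rightarrow> nat \<Rightarrow> (real \<Rightarrow> real ^ 'n) \<Rightarrow> real \<Rightarrow> int" where
  "crossing_sign D k \<gamma> t = (if pairing (normal_at D k (\<gamma> t)) (velocity \<gamma> t) < 0 then 1 else - 1)"

definition path_product_upto ::
  "('n::finite \<Rightarrow> 'n \<Rightarrow> int) \<Rightarrow> ('w, 'n) diagram \<Rightarrow> nat \<Rightarrow> (real \<Rightarrow> real ^ 'n) \<Rightarrow> 'n series" where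
  \<comment> \<open>later crossings multiply on the left\<close>
  "path_product_upto b D k \<gamma> =
     fold (\<lambda>t p. (local_elt b D k (\<gamma> t) [^]\<^bsub>scat_group b\<^esub> crossing_sign D k \<gamma> t) \<otimes>\<^bsub>scat_group b\<^esub> p)
       (sorted_list_of_set (crossing_times D k \<gamma>)) \<one>\<^bsub>scat_group b\<^esub>"

definition path_product ::
  "('n::finite \<Rightarrow> 'n \<Rightarrow> int) \<Rightarrow> ('w, 'n) diagram \<Rightarrow> (real \<Rightarrow> real ^ 'n) \<Rightarrow> 'n series" where
  "path_product b D \<gamma> = (\<lambda>n. path_product_upto b D (nat (deg n)) \<gamma> n)"

definition consistent :: "('n::finite \<Rightarrow> 'n \<Rightarrow> int) \<Rightarrow> ('w, 'n) diagram \<Rightarrow> bool" where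
  "consistent b D \<longleftrightarrow> (\<forall>\<gamma> \<delta>. generic_path D \<gamma> \<and> generic_path D \<delta> \<and> \<gamma> 0 = \<delta> 0 \<and> \<gamma> 1 = \<delta> 1 \<longrightarrow>
     path_product b D \<gamma> = path_product b D \<delta>)"


subsection \<open>The diagram of a seed\<close>

text \<open>
  \<open>D\<close> is consistent and its incoming walls are exactly
  $(e_i^\perp, \exp(- c_i \, \mathrm{Li}_2(-z^{e_i})))$, one for each \<open>i\<close>.
\<close>

definition seed_diagram ::
  "('n::finite \<Rightarrow> 'n \<Rightarrow> int) \<Rightarrow> ('n \<Rightarrow> nat) \<Rightarrow> ('w, 'n) diagram \<Rightarrow> bool" where
  "seed_diagram b c D \<longleftrightarrow> scattering_diagram b D \<and> consistent b D \<and>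
     (\<exists>\<sigma>. bij_betw \<sigma> UNIV (incoming_walls b D) \<and>
       (\<forall>i. supp D (\<sigma> i) = perp (axis i 1) \<and>
            elt D (\<sigma> i) = (\<lambda>n. - (of_nat (c i) * dilog i n))))"


section \<open>Folding\<close>

text \<open>
  The orbits are labelled by a finite type \<open>'j\<close> through \<open>orb :: 'j \<Rightarrow> 'i set\<close>, so that
  $\overline N$ is \<open>int ^ 'j\<close>.
\<close>

definition fold_map :: "('j::finite \<Rightarrow> 'i::finite set) \<Rightarrow> int ^ 'i \<Rightarrow> int ^ 'j" where
  \<comment> \<open>$q : N \to \overline N$, $e_i \mapsto e_{\Pi i}$\<close>
  "fold_map orb n = (\<chi> j. \<Sum>i\<in>orb j. n $ i)"

definition fold_dual :: "('j::finite \<Rightarrow> 'i::finite set) \<Rightarrow> real ^ 'j \<Rightarrow> real ^ 'i" where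
  \<comment> \<open>$q^*$, i.e. $\langle e_i, q^*(x) \rangle = \langle q(e_i), x \rangle$\<close>
  "fold_dual orb x = (\<chi> i. pairing (fold_map orb (axis i 1)) x)"

definition fold_group :: "('j::finite \<Rightarrow> 'i::finite set) \<Rightarrow> 'i series \<Rightarrow> 'j series" where
  \<comment> \<open>induced by $z^n \mapsto z^{q(n)}$\<close>
  "fold_group orb f = (\<lambda>m. \<Sum>n\<in>{n. n \<in> lat_pos \<and> fold_map orb n = m}. f n)"

definition fold_adapted :: "('j::finite \<Rightarrow> 'i::finite set) \<Rightarrow> ('w, 'i) diagram \<Rightarrow> bool" where
  "fold_adapted orb D \<longleftrightarrow> (\<forall>x. general_point x \<longrightarrow>
     (\<forall>w\<in>walls D. fold_dual orb x \<in> supp D w \<longrightarrow> fold_dual orb x \<in> rel_interior (supp D w)))"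

definition quotient_diagram ::
  "('j::finite \<Rightarrow> 'i::finite set) \<Rightarrow> ('w, 'i) diagram \<Rightarrow> ('w, 'j) diagram" where
  "quotient_diagram orb D =
     \<lparr>walls = {w \<in> nontriv_walls D.
        aff_dim (supp D w \<inter> range (fold_dual orb)) = aff_dim (range (fold_dual orb)) - 1},
      supp = (\<lambda>w. fold_dual orb -` (supp D w \<inter> range (fold_dual orb))),
      elt = (\<lambda>w. fold_group orb (elt D w))\<rparr>"

end

theory Submission
  imports Defs "HOL-Computational_Algebra.Formal_Power_Series"
begin

text \<open>
  Elements attached to parallel walls commute, so local elements are sums of wall elements, and the
  quotient diagram $Q$ and $E$ are compared through the sums $g_x(Q)_m$ and $g_x(E)_m$ of the
  $z^m$-components over the walls at a general point $x$, by induction on the degree of $m$.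
  If $Q$ and $E$ agree in all smaller degrees, then along any path the degree $m$ components of the
  path-ordered products differ by the sum of $\pm (g_x(Q) - g_x(E))_m$ over the crossings $x$ of
  $m^\perp$.  For general $x, y \in m^\perp$ the path $x + (2t-1)u$ and the parabola
  $x + (2t-1)u + 4t(1-t)(y-x)$ have common end points and cross $m^\perp$ only at $x$ and at $y$,
  respectively; hence $(g_x(Q) - g_x(E))_m$ does not depend on $x \in m^\perp$.  Near $\{m, \cdot\}$
  only incoming walls contribute, and there both sums are known.

  The path-ordered product of $Q$ along such a path is the image of the one of $D$ along a small
  generic perturbation of its image under $q^*$: a crossing of several walls of $D$ whose normals
  become parallel under $q$ splits into successive crossings of the same walls.  Merging these again
  requires $x \cdot (y \cdot p) = (x + y) \cdot p$ for commuting $x$ and $y$, that is, associativity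
  of the Baker--Campbell--Hausdorff product.  It is obtained by representing the Lie algebra
  faithfully in the incidence algebra of the ordered set $L$ and proving
  $\exp (\mathrm{bch}(x, y)) = \exp x \exp y$ there, from Dynkin's differential equation for
  $\log (e^{tx} e^{ty})$.
\<close>

section \<open>The Baker--Campbell--Hausdorff formula in Dynkin form\<close>

unbundle no vec_syntax
unbundle fps_syntax

text \<open>Consistency of D speaks only about paths generic for D, whereas q*(x) is rarely general:
  if an orbit contains i and i', then q*(x) lies on the hyperplane normal to e_i - e_i', and walls
  of D with different normals may meet there in codimension two. Adaptedness only says that q*(x) is
  interior to each wall through it, and this is what survives a perturbation. Moreover D is known
  only up to equivalence with a seed diagram, so its incoming walls are not directly accessible; its
  sums near {n, .} have to be read off at general points and carried to q*(x) by local constancy.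
  Genericity always comes from measure: the lattice is countable, so almost every direction u gives
  a path that is generic for all rational hyperplanes at once, whatever the diagram. In the
  Baker--Campbell--Hausdorff part a formal variable t counts letters. It makes every series a formal
  one, and the grading of the lattice later allows setting t = 1.\<close>

definition fps_scale :: "real \<Rightarrow> 'r::real_algebra_1 fps \<Rightarrow> 'r fps" where
  "fps_scale c Y = Abs_fps (\<lambda>n. c *\<^sub>R (Y $ n))"

lemma fps_scale_nth [simp]: "fps_scale c Y $ n = c *\<^sub>R (Y $ n)"
  by (simp add: fps_scale_def)

lemma fps_scale_mult_left [simp]: "fps_scale c Y * V = fps_scale c (Y * V)"
  by (rule fps_ext) (simp add: fps_mult_nth scaleR_sum_right)

lemma fps_scale_mult_right [simp]: "Y * fps_scale c V = fps_scale c (Y * V)"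
  by (rule fps_ext) (simp add: fps_mult_nth scaleR_sum_right)

lemma fps_scale_of_nat: "of_nat k * Y = fps_scale (of_nat k) Y"
  by (rule fps_ext) (simp add: fps_of_nat[symmetric] scaleR_conv_of_real)

section \<open>Evaluation of real power series in order-raising operators\<close>

definition order_raising :: "('r::real_algebra_1 fps \<Rightarrow> 'r fps) \<Rightarrow> bool" where
  "order_raising T \<longleftrightarrow> (\<forall>Y Y'. T (Y + Y') = T Y + T Y') \<and>
     (\<forall>c Y. T (fps_scale c Y) = fps_scale c (T Y)) \<and>
     (\<forall>Y n. (\<forall>i<n. Y $ i = 0) \<longrightarrow> (\<forall>i<Suc n. T Y $ i = 0))"

lemma order_raising_add: "order_raising T \<Longrightarrow> T (Y + Y') = T Y + T Y'"
  by (simp add: order_raising_def)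

lemma order_raising_scale: "order_raising T \<Longrightarrow> T (fps_scale c Y) = fps_scale c (T Y)"
  by (simp add: order_raising_def)

lemma order_raising_0: "order_raising T \<Longrightarrow> T 0 = 0"
  using order_raising_add[of T 0 0] by simp

lemma order_raising_sum: "order_raising T \<Longrightarrow> T (\<Sum>a\<in>A. f a) = (\<Sum>a\<in>A. T (f a))"
  by (induction A rule: infinite_finite_induct) (auto simp: order_raising_0 order_raising_add)

lemma order_raising_nth:
  "order_raising T \<Longrightarrow> (\<And>i. i < n \<Longrightarrow> Y $ i = 0) \<Longrightarrow> i \<le> n \<Longrightarrow> T Y $ i = 0"
  unfolding order_raising_def using less_Suc_eq_le by blast

lemma order_raising_funpow_nth:
  assumes "order_raising T" "\<And>i. i < n \<Longrightarrow> Y $ i = 0" "i < n + k"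
  shows "(T ^^ k) Y $ i = 0"
  using assms(3)
proof (induction k arbitrary: i)
  case (Suc k)
  show ?case
    using order_raising_nth[OF assms(1), of "n + k" "(T ^^ k) Y" i] Suc by simp
qed (use assms in auto)

lemma order_raising_funpow_less: "order_raising T \<Longrightarrow> i < k \<Longrightarrow> (T ^^ k) Y $ i = 0"
  using order_raising_funpow_nth[of T 0 Y i k] by simp

lemma order_raising_funpow_add: "order_raising T \<Longrightarrow> (T ^^ k) (Y + Y') = (T ^^ k) Y + (T ^^ k) Y'"
  by (induction k) (auto simp: order_raising_add)

lemma order_raising_funpow_scale: "order_raising T \<Longrightarrow> (T ^^ k) (fps_scale c Y) = fps_scale c ((T ^^ k) Y)"
  by (induction k) (auto simp: order_raising_scale)

lemma order_raising_funpow_sum: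
  "order_raising T \<Longrightarrow> (T ^^ k) (\<Sum>a\<in>A. f a) = (\<Sum>a\<in>A. (T ^^ k) (f a))"
  by (induction k) (auto simp: order_raising_sum)

lemma order_raising_funpow_cong:
  assumes "order_raising T" "\<And>i. i \<le> n \<Longrightarrow> Y $ i = Y' $ i"
  shows "(T ^^ k) Y $ n = (T ^^ k) Y' $ n"
proof -
  have "(T ^^ k) (Y - Y') $ n = 0"
    using order_raising_funpow_nth[OF assms(1), of "Suc n" "Y - Y'" n k] assms(2) by simp
  moreover have "(T ^^ k) (Y - Y') + (T ^^ k) Y' = (T ^^ k) Y"
    by (simp flip: order_raising_funpow_add[OF assms(1)])
  ultimately show ?thesis
    by (metis add_0 fps_add_nth)
qed

text \<open>The operator f(T). For order-raising T, \<open>(T ^^ k) Y\<close> has no coefficient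
  below k, so cutting the sum at k = n loses nothing and no convergence question arises. The
  operators in use are left multiplication by Z and ad Z, for Z without constant term, and series in
  them.\<close>

definition fps_eval :: "('r::real_algebra_1 fps \<Rightarrow> 'r fps) \<Rightarrow> real fps \<Rightarrow> 'r fps \<Rightarrow> 'r fps" where
  "fps_eval T f Y = Abs_fps (\<lambda>n. \<Sum>k\<le>n. (f $ k) *\<^sub>R ((T ^^ k) Y $ n))"

lemma fps_eval_nth:
  assumes "order_raising T" "n \<le> N"
  shows "fps_eval T f Y $ n = (\<Sum>k\<le>N. (f $ k) *\<^sub>R ((T ^^ k) Y $ n))"
  unfolding fps_eval_def fps_nth_Abs_fps using assms
  by (intro sum.mono_neutral_left) (auto simp: not_le order_raising_funpow_less)

lemma fps_eval_nth_sum: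
  assumes "order_raising T" "n \<le> N"
  shows "fps_eval T f Y $ n = (\<Sum>k\<le>N. fps_scale (f $ k) ((T ^^ k) Y)) $ n"
  unfolding fps_eval_nth[OF assms] by (simp add: fps_sum_nth)

lemma fps_eval_mult:
  assumes "order_raising T"
  shows "fps_eval T (f * g) Y = fps_eval T f (fps_eval T g Y)"
proof (rule fps_ext)
  fix n
  have "fps_eval T f (fps_eval T g Y) $ n =
      (\<Sum>k\<le>n. (f $ k) *\<^sub>R ((T ^^ k) (\<Sum>j\<le>n. fps_scale (g $ j) ((T ^^ j) Y)) $ n))"
    unfolding fps_eval_nth[OF assms order_refl, of f]
    by (intro sum.cong refl arg_cong2[where f = scaleR]
          order_raising_funpow_cong[OF assms] fps_eval_nth_sum[OF assms])
  also have "\<dots> = (\<Sum>k\<le>n. \<Sum>j\<le>n. (f $ k * g $ j) *\<^sub>R ((T ^^ (k + j)) Y $ n))"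
    by (simp add: order_raising_funpow_sum[OF assms] order_raising_funpow_scale[OF assms]
        fps_sum_nth funpow_add scaleR_sum_right)
  \<comment> \<open>Pairs outside the triangle vanish, since \<open>T ^^ (k + j)\<close> starts in
    order k + j > n.\<close>
  also have "\<dots> = (\<Sum>(k, j)\<in>{(k, j). k + j \<le> n}. (f $ k * g $ j) *\<^sub>R ((T ^^ (k + j)) Y $ n))"
    unfolding sum.cartesian_product
    by (rule sum.mono_neutral_right)
       (auto, metis not_le order_raising_funpow_less[OF assms])
  also have "\<dots> = (\<Sum>m\<le>n. \<Sum>i\<le>m. (f $ i * g $ (m - i)) *\<^sub>R ((T ^^ m) Y $ n))"
    by (subst sum.triangle_reindex_eq) simp
  also have "\<dots> = fps_eval T (f * g) Y $ n"
    by (simp add: fps_eval_def fps_mult_nth scaleR_sum_left atLeast0AtMost)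
  finally show "fps_eval T (f * g) Y $ n = fps_eval T f (fps_eval T g Y) $ n" ..
qed

lemma fps_eval_1 [simp]: "fps_eval T 1 Y = Y"
  by (rule fps_ext) (simp add: fps_eval_def if_distrib[of "\<lambda>c. c *\<^sub>R _"] sum.delta cong: if_cong)

lemma fps_eval_X: 
  assumes "order_raising T" shows "fps_eval T fps_X Y = T Y"
proof (rule fps_ext)
  fix n
  have "fps_eval T fps_X Y $ n = (\<Sum>k\<le>Suc n. (if k = 1 then T Y $ n else 0))"
    unfolding fps_eval_nth[OF assms le_SucI[OF order_refl]]
    by (intro sum.cong) (auto simp: fps_X_def)
  then show "fps_eval T fps_X Y $ n = T Y $ n"
    by (simp add: sum.delta)
qed

lemma fps_eval_add_left: "fps_eval T (f + g) Y = fps_eval T f Y + fps_eval T g Y"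
  by (rule fps_ext) (simp add: fps_eval_def scaleR_left_distrib sum.distrib)

lemma fps_eval_diff_left: "fps_eval T (f - g) Y = fps_eval T f Y - fps_eval T g Y"
  by (rule fps_ext) (simp add: fps_eval_def scaleR_left_diff_distrib sum_subtractf)

lemma fps_eval_power:
  assumes "order_raising T"
  shows "(fps_eval T g ^^ k) Y = fps_eval T (g ^ k) Y"
  by (induction k) (auto simp: fps_eval_mult[OF assms])

text \<open>Rewrites a series in e^{ad Z} - 1 as a series in ad Z, and yields exp(log P) = P from
  the identity of scalar power series.\<close>

lemma fps_eval_compose:
  assumes "order_raising T" "g $ 0 = 0"
  shows "fps_eval T (f oo g) Y = fps_eval (fps_eval T g) f Y"
proof (rule fps_ext)
  fix n
  have "fps_eval (fps_eval T g) f Y $ n = (\<Sum>k\<le>n. (f $ k) *\<^sub>R (fps_eval T (g ^ k) Y $ n))"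
    by (simp add: fps_eval_def[of "fps_eval T g"] fps_eval_power[OF assms(1)])
  also have "\<dots> = (\<Sum>k\<le>n. \<Sum>j\<le>n. (f $ k * (g ^ k) $ j) *\<^sub>R ((T ^^ j) Y $ n))"
    by (simp add: fps_eval_def scaleR_sum_right)
  also have "\<dots> = (\<Sum>j\<le>n. \<Sum>k\<le>n. (f $ k * (g ^ k) $ j) *\<^sub>R ((T ^^ j) Y $ n))"
    by (rule sum.swap)
  also have "\<dots> = (\<Sum>j\<le>n. ((f oo g) $ j) *\<^sub>R ((T ^^ j) Y $ n))"
  proof (rule sum.cong[OF refl])
    fix j assume "j \<in> {..n}"
    then have "(\<Sum>k\<le>n. f $ k * (g ^ k) $ j) = (\<Sum>k\<le>j. f $ k * (g ^ k) $ j)"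
      by (intro sum.mono_neutral_right) (auto simp: startsby_zero_power_prefix[OF assms(2)])
    then show "(\<Sum>k\<le>n. (f $ k * (g ^ k) $ j) *\<^sub>R ((T ^^ j) Y $ n)) = ((f oo g) $ j) *\<^sub>R ((T ^^ j) Y $ n)"
      by (simp add: fps_compose_nth atLeast0AtMost flip: scaleR_sum_left)
  qed
  finally show "fps_eval T (f oo g) Y $ n = fps_eval (fps_eval T g) f Y $ n"
    by (simp add: fps_eval_def)
qed

lemma order_raising_mult:
  assumes "Z $ 0 = 0" shows "order_raising ((*) Z)"
  unfolding order_raising_def
proof (intro conjI allI impI)
  fix Y :: "'a fps" and n i assume Y: "\<forall>i<n. Y $ i = 0" and i: "i < Suc n"
  have "Z $ j * Y $ (i - j) = 0" if "j \<le> i" for j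
    using assms Y i that by (cases j) auto
  then show "(Z * Y) $ i = 0" by (simp add: fps_mult_nth)
next
  fix c :: real and Y show "Z * fps_scale c Y = fps_scale c (Z * Y)"
    by simp
qed (simp_all add: algebra_simps)

text \<open>Left multiplications commute with right multiplications, so f evaluated at left
  multiplication by Z is again a left multiplication, namely by the element f(Z).\<close>

lemma fps_eval_mult_right: "fps_eval ((*) Z) f Y = fps_eval ((*) Z) f 1 * Y" if "Z $ 0 = 0"
proof (rule fps_ext)
  fix n
  have Zk: "((*) Z ^^ k) Y = ((*) Z ^^ k) 1 * Y" for k Y
    by (induction k) (auto simp: mult.assoc)
  have "fps_eval ((*) Z) f Y $ n = (\<Sum>k\<le>n. fps_scale (f $ k) (((*) Z ^^ k) 1) * Y) $ n"
    unfolding fps_eval_nth_sum[OF order_raising_mult[OF that] order_refl]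
    by (simp add: Zk[of _ Y])
  also have "\<dots> = (fps_eval ((*) Z) f 1 * Y) $ n"
    unfolding sum_distrib_right[symmetric] fps_mult_nth
    by (intro sum.cong arg_cong2[where f = "(*)"])
       (auto intro!: fps_eval_nth_sum[OF order_raising_mult[OF that], symmetric])
  finally show "fps_eval ((*) Z) f Y $ n = (fps_eval ((*) Z) f 1 * Y) $ n" .
qed

section \<open>The adjoint action and the derivative of the exponential\<close>

definition fps_ad :: "'r::real_algebra_1 fps \<Rightarrow> 'r fps \<Rightarrow> 'r fps" where
  "fps_ad Z Y = Z * Y - Y * Z"

lemma order_raising_ad:
  assumes "Z $ 0 = 0" shows "order_raising (fps_ad Z)"
  unfolding order_raising_def
proof (intro conjI allI impI)
  fix Y :: "'a fps" and n i assume Y: "\<forall>i<n. Y $ i = 0" and i: "i < Suc n"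
  have "Z $ j * Y $ (i - j) = 0" if "j \<le> i" for j
    using assms Y i that by (cases j) auto
  moreover have "Y $ j * Z $ (i - j) = 0" if "j \<le> i" for j
    using assms Y i that by (cases "j = i") auto
  ultimately show "fps_ad Z Y $ i = 0" by (simp add: fps_ad_def fps_mult_nth)
next
  fix c :: real and Y show "fps_ad Z (fps_scale c Y) = fps_scale c (fps_ad Z Y)"
    by (rule fps_ext) (simp add: fps_ad_def scaleR_diff_right)
qed (simp_all add: fps_ad_def algebra_simps)

text \<open>Left multiplication by Z is ad Z plus right multiplication by Z, and these two commute;
  this is the binomial theorem for their sum, with Pascal's rule as inductive step.\<close>

lemma power_mult_ad:
  "Z ^ k * Y = (\<Sum>c\<le>k. of_nat (k choose c) * ((fps_ad Z ^^ c) Y * Z ^ (k - c)))"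
proof (induction k)
  case (Suc k)
  define A where "A c = (fps_ad Z ^^ c) Y" for c
  have Z: "Z * A c = A (Suc c) + A c * Z" for c
    by (simp add: A_def fps_ad_def)
  have "Z ^ Suc k * Y = Z * (\<Sum>c\<le>k. of_nat (k choose c) * (A c * Z ^ (k - c)))"
    by (simp add: Suc A_def mult.assoc)
  also have "\<dots> = (\<Sum>c\<le>k. of_nat (k choose c) * (Z * A c * Z ^ (k - c)))"
    unfolding sum_distrib_left by (intro sum.cong refl) (metis mult.assoc mult_of_nat_commute)
  also have "\<dots> = (\<Sum>c\<le>k. of_nat (k choose c) * (A (Suc c) * Z ^ (k - c)))
      + (\<Sum>c\<le>k. of_nat (k choose c) * (A c * Z ^ (Suc k - c)))"
    by (simp add: Z sum.distrib[symmetric] algebra_simps Suc_diff_le flip: power_Suc)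
  also have "(\<Sum>c\<le>k. of_nat (k choose c) * (A c * Z ^ (Suc k - c))) =
      (\<Sum>c\<le>Suc k. of_nat (k choose c) * (A c * Z ^ (Suc k - c)))"
    by (simp add: binomial_eq_0)
  also have "\<dots> = A 0 * Z ^ Suc k + (\<Sum>c\<le>k. of_nat (k choose Suc c) * (A (Suc c) * Z ^ (k - c)))"
    by (subst sum.atMost_Suc_shift) simp
  also have "(\<Sum>c\<le>k. of_nat (k choose c) * (A (Suc c) * Z ^ (k - c))) + \<dots> =
      A 0 * Z ^ Suc k + (\<Sum>c\<le>k. of_nat (Suc k choose Suc c) * (A (Suc c) * Z ^ (k - c)))"
    by (simp add: algebra_simps sum.distrib)
  also have "\<dots> = (\<Sum>c\<le>Suc k. of_nat (Suc k choose c) * (A c * Z ^ (Suc k - c)))"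
    by (subst sum.atMost_Suc_shift) simp
  finally show ?case by (simp only: A_def)
qed simp

text \<open>In the Leibniz sum of the terms Z^j Z' Z^(k-j) all factors Z are moved to the right of
  Z'; the binomials (j choose c) then add up to (k+1 choose c+1). The induction does this one factor
  at a time.\<close>

lemma fps_deriv_power_ad:
  "fps_deriv (Z ^ Suc k) =
    (\<Sum>c\<le>k. of_nat (Suc k choose Suc c) * ((fps_ad Z ^^ c) (fps_deriv Z) * Z ^ (k - c)))"
proof (induction k)
  case (Suc k)
  define A where "A c = (fps_ad Z ^^ c) (fps_deriv Z)" for c
  have Z: "Z * A c = A (Suc c) + A c * Z" for c
    by (simp add: A_def fps_ad_def)
  have "fps_deriv (Z ^ Suc (Suc k)) = Z * fps_deriv (Z ^ Suc k) + fps_deriv Z * Z ^ Suc k"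
    by (subst power_Suc) (rule fps_deriv_mult)
  also have "\<dots> = Z * (\<Sum>c\<le>k. of_nat (Suc k choose Suc c) * (A c * Z ^ (k - c))) + A 0 * Z ^ Suc k"
    by (simp only: Suc A_def funpow_0)
  also have "Z * (\<Sum>c\<le>k. of_nat (Suc k choose Suc c) * (A c * Z ^ (k - c))) =
      (\<Sum>c\<le>k. of_nat (Suc k choose Suc c) * (Z * A c * Z ^ (k - c)))"
    unfolding sum_distrib_left
    by (intro sum.cong refl) (metis mult.assoc mult_of_nat_commute)
  also have "\<dots> = (\<Sum>c\<le>k. of_nat (Suc k choose Suc c) * (A (Suc c) * Z ^ (k - c)))
      + (\<Sum>c\<le>k. of_nat (Suc k choose Suc c) * (A c * Z ^ (Suc k - c)))"
    unfolding Z sum.distrib[symmetric]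
    by (intro sum.cong refl) (simp add: distrib_left distrib_right mult.assoc Suc_diff_le del: binomial_Suc_Suc)
  also have "(\<Sum>c\<le>k. of_nat (Suc k choose Suc c) * (A c * Z ^ (Suc k - c))) =
      (\<Sum>c\<le>Suc k. of_nat (Suc k choose Suc c) * (A c * Z ^ (Suc k - c)))"
    by (simp add: binomial_eq_0)
  also have "(\<Sum>c\<le>k. of_nat (Suc k choose Suc c) * (A (Suc c) * Z ^ (k - c))) + \<dots> + A 0 * Z ^ Suc k =
      (\<Sum>c\<le>Suc k. of_nat (Suc k choose c) * (A c * Z ^ (Suc k - c))) + 
      (\<Sum>c\<le>Suc k. of_nat (Suc k choose Suc c) * (A c * Z ^ (Suc k - c)))"
    unfolding sum.atMost_Suc_shift[of "\<lambda>c. of_nat (Suc k choose c) * (A c * Z ^ (Suc k - c))"]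
    by (simp add: algebra_simps del: binomial_Suc_Suc power_Suc sum.atMost_Suc)
  also have "\<dots> = (\<Sum>c\<le>Suc k. of_nat (Suc (Suc k) choose Suc c) * (A c * Z ^ (Suc k - c)))"
    unfolding sum.distrib[symmetric] binomial_Suc_Suc[of "Suc k"]
    by (simp only: of_nat_add distrib_right)
  finally show ?case by (simp only: A_def)
qed simp

lemma power_eq_funpow_mult: "((*) Z ^^ k) (1 :: 'r::real_algebra_1 fps) = Z ^ k"
  by (induction k) auto

text \<open>Sorts the product by the total number m of factors T and Z. The expansions of Z^m Y and
  of the derivative of a power of Z have the same shape, which permits comparison term by
  term.\<close>

lemma fps_eval_times_eval_nth:
  assumes "order_raising T" "Z $ 0 = 0"
  shows "(fps_eval T f Y * fps_eval ((*) Z) g 1) $ n =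
    (\<Sum>m\<le>n. \<Sum>c\<le>m. (f $ c * g $ (m - c)) *\<^sub>R (((T ^^ c) Y * Z ^ (m - c)) $ n))"
proof -
  have "(fps_eval T f Y * fps_eval ((*) Z) g 1) $ n =
      ((\<Sum>c\<le>n. fps_scale (f $ c) ((T ^^ c) Y)) * (\<Sum>d\<le>n. fps_scale (g $ d) (((*) Z ^^ d) 1))) $ n"
    unfolding fps_mult_nth[of "fps_eval _ _ _"] fps_mult_nth[of "sum _ _"]
    by (intro sum.cong arg_cong2[where f = "(*)"] refl fps_eval_nth_sum assms order_raising_mult) auto
  also have "\<dots> = (\<Sum>c\<le>n. \<Sum>d\<le>n. (f $ c * g $ d) *\<^sub>R (((T ^^ c) Y * Z ^ d) $ n))"
    unfolding sum_product fps_sum_nth power_eq_funpow_mult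
    by (intro sum.cong refl)
       (simp add: mult.commute)
  also have "\<dots> = (\<Sum>(c, d)\<in>{(c, d). c + d \<le> n}. (f $ c * g $ d) *\<^sub>R (((T ^^ c) Y * Z ^ d) $ n))"
    unfolding sum.cartesian_product
  proof (rule sum.mono_neutral_right)
    have "((T ^^ c) Y * Z ^ d) $ n = 0" if "c + d > n" for c d
      unfolding fps_mult_nth
    proof (rule sum.neutral, rule ballI)
      fix i assume "i \<in> {0..n}"
      then have "i < c \<or> n - i < d" using that by auto
      then show "(T ^^ c) Y $ i * (Z ^ d) $ (n - i) = 0"
        using order_raising_funpow_less[OF assms(1)] startsby_zero_power_prefix[OF assms(2)]
        by (metis mult_zero_left mult_zero_right)
    qed
    then show "\<forall>i\<in>{..n} \<times> {..n} - {(c, d). c + d \<le> n}.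
       (case i of (c, d) \<Rightarrow> (f $ c * g $ d) *\<^sub>R (((T ^^ c) Y * Z ^ d) $ n)) = 0"
      using not_le by fastforce
  qed auto
  also have "\<dots> = (\<Sum>m\<le>n. \<Sum>c\<le>m. (f $ c * g $ (m - c)) *\<^sub>R (((T ^^ c) Y * Z ^ (m - c)) $ n))"
    by (rule sum.triangle_reindex_eq)
  finally show ?thesis .
qed

definition fps_Exp :: "'r::real_algebra_1 fps \<Rightarrow> 'r fps" where
  "fps_Exp Z = fps_eval ((*) Z) (fps_exp 1) 1"

lemma fps_Exp_nth:
  assumes "Z $ 0 = 0" "n \<le> N"
  shows "fps_Exp Z $ n = (\<Sum>k\<le>N. (1 / fact k) *\<^sub>R (Z ^ k $ n))"
  unfolding fps_Exp_def using fps_eval_nth[OF order_raising_mult[OF assms(1)] assms(2)]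
  by (simp add: power_eq_funpow_mult)

text \<open>Dividing \<open>power_mult_ad\<close> by k! splits the binomial coefficient into 1/c!
  and 1/(k-c)!, the coefficients of e^{ad Z} and of e^Z.\<close>

lemma fps_Exp_mult_ad:
  assumes "Z $ 0 = 0"
  shows "fps_Exp Z * Y = fps_eval (fps_ad Z) (fps_exp 1) Y * fps_Exp Z"
proof (rule fps_ext)
  fix n
  have "(fps_Exp Z * Y) $ n = (\<Sum>m\<le>n. (1 / fact m) *\<^sub>R ((Z ^ m * Y) $ n))"
    unfolding fps_mult_nth[of "fps_Exp _"] fps_mult_nth[of "_ ^ _"]
    using fps_Exp_nth[OF assms, of _ n]
    by (simp add: sum_distrib_right scaleR_sum_right sum.swap[of _ "{0..n}"])
  also have "\<dots> = (\<Sum>m\<le>n. \<Sum>c\<le>m. (fps_exp 1 $ c * fps_exp 1 $ (m - c)) *\<^sub>R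
      (((fps_ad Z ^^ c) Y * Z ^ (m - c)) $ n))"
    unfolding power_mult_ad fps_sum_nth scaleR_sum_right
    by (intro sum.cong refl)
       (simp add: binomial_fact fps_scale_of_nat)
  also have "\<dots> = (fps_eval (fps_ad Z) (fps_exp 1) Y * fps_Exp Z) $ n"
    unfolding fps_Exp_def fps_eval_times_eval_nth[OF order_raising_ad[OF assms] assms] ..
  finally show "(fps_Exp Z * Y) $ n = (fps_eval (fps_ad Z) (fps_exp 1) Y * fps_Exp Z) $ n" .
qed

text \<open>The series (e^X - 1)/X.\<close>

definition fps_exp_quot :: "real fps" where
  "fps_exp_quot = Abs_fps (\<lambda>n. 1 / fact (Suc n))"

lemma fps_X_exp_quot: "fps_X * fps_exp_quot = fps_exp 1 - 1"
  by (rule fps_ext) (auto simp: fps_exp_quot_def gr0_conv_Suc)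

text \<open>The classical formula for the differential of the exponential map. Dividing (m+1 choose
  c+1) by (m+1)! leaves 1/(c+1)! times 1/(m-c)!, and the shift from c! to (c+1)! is what replaces
  e^{ad Z} by (e^{ad Z} - 1)/ad Z.\<close>

lemma fps_deriv_Exp:
  assumes "Z $ 0 = 0"
  shows "fps_deriv (fps_Exp Z) = fps_eval (fps_ad Z) fps_exp_quot (fps_deriv Z) * fps_Exp Z"
proof (rule fps_ext)
  fix n
  have "fps_deriv (fps_Exp Z) $ n = (\<Sum>m\<le>Suc n. (1 / fact m) *\<^sub>R (fps_deriv (Z ^ m) $ n))"
    unfolding fps_deriv_nth Suc_eq_plus1[symmetric] fps_Exp_nth[OF assms order_refl]
    by (simp only: sum_distrib_left mult_scaleR_right)
  also have "\<dots> = (\<Sum>m\<le>n. (1 / fact (Suc m)) *\<^sub>R (fps_deriv (Z ^ Suc m) $ n))"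
    by (subst sum.atMost_Suc_shift) simp
  also have "\<dots> = (\<Sum>m\<le>n. \<Sum>c\<le>m. (fps_exp_quot $ c * fps_exp 1 $ (m - c)) *\<^sub>R
      (((fps_ad Z ^^ c) (fps_deriv Z) * Z ^ (m - c)) $ n))"
    unfolding fps_deriv_power_ad fps_sum_nth scaleR_sum_right
  proof (intro sum.cong refl)
    fix m c :: nat assume "c \<in> {..m}"
    then have "real (Suc m choose Suc c) / fact (Suc m) = 1 / (fact (Suc c) * fact (m - c))"
      by (subst binomial_fact) (auto simp del: fact_Suc)
    then have *: "inverse (fact (Suc m)) * real (Suc m choose Suc c) = fps_exp_quot $ c * fps_exp 1 $ (m - c)"
      using \<open>c \<in> {..m}\<close> by (simp add: fps_exp_quot_def field_simps del: fact_Suc binomial_Suc_Suc)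
    have "(1 / fact (Suc m)) *\<^sub>R ((of_nat (Suc m choose Suc c) *
          ((fps_ad Z ^^ c) (fps_deriv Z) * Z ^ (m - c))) $ n) = (inverse (fact (Suc m)) * real (Suc m choose Suc c)) *\<^sub>R
         (((fps_ad Z ^^ c) (fps_deriv Z) * Z ^ (m - c)) $ n)"
      by (simp add: fps_scale_of_nat inverse_eq_divide del: fact_Suc binomial_Suc_Suc)
    then show "(1 / fact (Suc m)) *\<^sub>R ((of_nat (Suc m choose Suc c) *
          ((fps_ad Z ^^ c) (fps_deriv Z) * Z ^ (m - c))) $ n) = (fps_exp_quot $ c * fps_exp 1 $ (m - c)) *\<^sub>R
         (((fps_ad Z ^^ c) (fps_deriv Z) * Z ^ (m - c)) $ n)"
      unfolding * .
  qed
  also have "\<dots> = (fps_eval (fps_ad Z) fps_exp_quot (fps_deriv Z) * fps_Exp Z) $ n"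
    unfolding fps_Exp_def fps_eval_times_eval_nth[OF order_raising_ad[OF assms] assms] ..
  finally show "fps_deriv (fps_Exp Z) $ n =
    (fps_eval (fps_ad Z) fps_exp_quot (fps_deriv Z) * fps_Exp Z) $ n" .
qed

lemma fps_Exp_inverse:
  assumes "Z $ 0 = 0"
  obtains Q where "fps_Exp Z * Q = 1"
proof
  have "fps_eval ((*) Z) (fps_exp 1 * fps_exp (-1)) 1 = 1"
    by (simp flip: fps_exp_add_mult)
  then show "fps_Exp Z * fps_eval ((*) Z) (fps_exp (-1)) 1 = 1"
    unfolding fps_eval_mult[OF order_raising_mult[OF assms]] fps_Exp_def
    using fps_eval_mult_right[OF assms] by metis
qed

lemma fps_Log_exists:
  fixes P :: "'r::real_algebra_1 fps"
  assumes "P $ 0 = 1"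
  obtains Z where "Z $ 0 = 0" "fps_Exp Z = P"
proof
  define Z where "Z = fps_eval ((*) (P - 1)) (fps_ln 1) 1"
  have u: "(P - 1) $ 0 = 0" using assms by simp
  show "Z $ 0 = 0" by (simp add: Z_def fps_eval_def)
  \<comment> \<open>Left multiplication by Z = log(1 + u), with u = P - 1, is the series log(1 + X)
    evaluated at left multiplication by u. Hence exp Z is the composed series exp(log(1 + X)) = 1 +
    X at u.\<close>
  have Z: "(*) Z = fps_eval ((*) (P - 1)) (fps_ln 1)"
    unfolding Z_def by (rule ext) (rule fps_eval_mult_right[OF u, symmetric])
  have "fps_exp 1 oo fps_ln 1 = (1 + fps_X :: real fps)"
    using fps_inv_fps_exp_compose(2)[of "1::real"]
    by (simp add: fps_ln_fps_exp_inv[symmetric] fps_compose_sub_distrib algebra_simps)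
  then show "fps_Exp Z = P"
    unfolding fps_Exp_def Z fps_eval_compose[OF order_raising_mult[OF u] fps_ln_0, symmetric]
    by (simp add: fps_eval_add_left fps_eval_X[OF order_raising_mult[OF u]])
qed

section \<open>Nested commutators and the terms of Dynkin's series\<close>

definition ring_ad :: "'r::ring \<Rightarrow> 'r \<Rightarrow> 'r" where
  "ring_ad a w = a * w - w * a"

fun comm_word :: "'r::ring list \<Rightarrow> 'r" where
  "comm_word [] = 0"
| "comm_word [a] = a"
| "comm_word (a # b # ws) = ring_ad a (comm_word (b # ws))"

definition dynkin_word :: "'a \<Rightarrow> 'a \<Rightarrow> (nat \<times> nat) list \<Rightarrow> 'a list" where
  "dynkin_word x y ps = concat (map (\<lambda>(r, s). replicate r x @ replicate s y) ps)"

definition dynkin_size :: "(nat \<times> nat) list \<Rightarrow> nat" where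
  "dynkin_size ps = (\<Sum>(r, s)\<leftarrow>ps. r + s)"

definition dynkin_fact :: "(nat \<times> nat) list \<Rightarrow> real" where
  "dynkin_fact ps = (\<Prod>(r, s)\<leftarrow>ps. fact r * fact s)"

definition dynkin_coeff :: "(nat \<times> nat) list \<Rightarrow> real" where
  "dynkin_coeff ps = (- 1) ^ (length ps - 1) / of_nat (length ps) / (of_nat (dynkin_size ps) * dynkin_fact ps)"

definition dynkin_lists :: "nat \<Rightarrow> nat \<Rightarrow> (nat \<times> nat) list set" where
  "dynkin_lists m n = {ps. length ps = m \<and> (0, 0) \<notin> set ps \<and> dynkin_size ps = n}"

text \<open>The part of Dynkin's series that is homogeneous of degree n in the two letters.\<close>

definition dynkin_sum :: "'r::real_algebra_1 \<Rightarrow> 'r \<Rightarrow> nat \<Rightarrow> 'r" where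
  "dynkin_sum x y n = (\<Sum>ps\<in>{ps. ps \<noteq> [] \<and> (0, 0) \<notin> set ps \<and> dynkin_size ps = n}.
     dynkin_coeff ps *\<^sub>R comm_word (dynkin_word x y ps))"

lemma dynkin_size_simps [simp]: "dynkin_size [] = 0" "dynkin_size ((r, s) # ps) = r + s + dynkin_size ps"
  by (simp_all add: dynkin_size_def)

lemma dynkin_fact_simps [simp]: "dynkin_fact [] = 1" "dynkin_fact ((r, s) # ps) = fact r * fact s * dynkin_fact ps"
  by (simp_all add: dynkin_fact_def)

lemma dynkin_word_simps [simp]: "dynkin_word x y [] = []"
  "dynkin_word x y ((r, s) # ps) = replicate r x @ replicate s y @ dynkin_word x y ps"
  by (simp_all add: dynkin_word_def)

lemma length_dynkin_word: "length (dynkin_word x y ps) = dynkin_size ps"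
  by (induction ps) auto

lemma length_le_dynkin_size: "(0, 0) \<notin> set ps \<Longrightarrow> length ps \<le> dynkin_size ps"
  by (induction ps) auto

lemma dynkin_size_ge: "(r, s) \<in> set ps \<Longrightarrow> r + s \<le> dynkin_size ps"
  by (induction ps) auto

lemma finite_dynkin_lists_le: "finite {ps. (0, 0) \<notin> set ps \<and> dynkin_size ps \<le> n}"
proof (rule finite_subset)
  show "{ps. (0, 0) \<notin> set ps \<and> dynkin_size ps \<le> n} \<subseteq> {ps. set ps \<subseteq> {..n} \<times> {..n} \<and> length ps \<le> n}"
    using length_le_dynkin_size dynkin_size_ge by fastforce
  show "finite {ps. set ps \<subseteq> {..n} \<times> {..n} \<and> length ps \<le> n}"
    by (rule finite_lists_length_le) auto
qed

lemma finite_dynkin_lists: "finite (dynkin_lists m n)"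
  by (rule finite_subset[OF _ finite_dynkin_lists_le[of n]]) (auto simp: dynkin_lists_def)

text \<open>Splits off the first block (r, s): in the recursion below every application of the
  operator T puts one block in front.\<close>

lemma sum_dynkin_lists_Suc:
  "(\<Sum>ps\<in>dynkin_lists (Suc m) n. F ps) =
     (\<Sum>(r, s)\<in>{(r, s). r + s \<le> n \<and> (r, s) \<noteq> (0, 0)}. \<Sum>ps\<in>dynkin_lists m (n - (r + s)). F ((r, s) # ps))"
proof -
  let ?A = "{(r, s). r + s \<le> n \<and> (r, s) \<noteq> (0, 0)}"
  have "finite ?A"
    by (rule finite_subset[of _ "{..n} \<times> {..n}"]) auto
  then have "(\<Sum>rs\<in>?A. \<Sum>ps\<in>dynkin_lists m (n - (fst rs + snd rs)). F (rs # ps)) =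
      (\<Sum>(rs, ps)\<in>Sigma ?A (\<lambda>rs. dynkin_lists m (n - (fst rs + snd rs))). F (rs # ps))"
    by (subst sum.Sigma) (auto simp: finite_dynkin_lists)
  also have "\<dots> = (\<Sum>ps\<in>dynkin_lists (Suc m) n. F ps)"
    by (rule sum.reindex_bij_witness[of _ "\<lambda>ps. (hd ps, tl ps)" "\<lambda>(rs, ps). rs # ps"])
       (auto simp: dynkin_lists_def length_Suc_conv)
  finally show ?thesis by (simp add: case_prod_beta)
qed

lemma comm_word_Cons: "ws \<noteq> [] \<Longrightarrow> comm_word (a # ws) = ring_ad a (comm_word ws)"
  by (cases ws) auto

lemma comm_word_replicate_append:
  "ws \<noteq> [] \<Longrightarrow> comm_word (replicate r x @ ws) = (ring_ad x ^^ r) (comm_word ws)"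
  by (induction r) (auto simp: comm_word_Cons)

lemma ring_ad_0 [simp]: "ring_ad a 0 = 0"
  and ring_ad_self [simp]: "ring_ad a a = 0"
  by (simp_all add: ring_ad_def)

lemma ring_ad_add: "ring_ad a (v + w) = ring_ad a v + ring_ad a w"
  by (simp add: ring_ad_def algebra_simps)

lemma ring_ad_scaleR: "ring_ad a (c *\<^sub>R w) = c *\<^sub>R ring_ad (a :: 'r::real_algebra) w"
  by (simp add: ring_ad_def scaleR_diff_right)

lemma ring_ad_funpow_0 [simp]: "(ring_ad a ^^ r) 0 = 0"
  by (induction r) auto

lemma ring_ad_funpow_add: "(ring_ad a ^^ r) (v + w) = (ring_ad a ^^ r) v + (ring_ad a ^^ r) w"
  by (induction r) (auto simp: ring_ad_add)

lemma ring_ad_funpow_scaleR: "(ring_ad a ^^ r) (c *\<^sub>R w) = c *\<^sub>R (ring_ad (a :: 'r::real_algebra) ^^ r) w"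
  by (induction r) (auto simp: ring_ad_scaleR)

lemma ring_ad_funpow_sum: "(ring_ad a ^^ r) (\<Sum>i\<in>I. f i) = (\<Sum>i\<in>I. (ring_ad a ^^ r) (f i))"
  by (induction I rule: infinite_finite_induct) (auto simp: ring_ad_funpow_add)

text \<open>The innermost bracket is [x, x] = 0.\<close>

lemma comm_word_replicate:
  assumes "r \<ge> 2" shows "comm_word (replicate r x) = 0"
proof -
  obtain k where r: "r = Suc k + 1" using assms by (intro that[of "r - 2"]) simp
  have "comm_word (replicate r x) = (ring_ad x ^^ Suc k) (comm_word [x])"
    unfolding r replicate_add by (subst comm_word_replicate_append) simp_all
  also have "\<dots> = 0"
    unfolding funpow_Suc_right comp_apply comm_word.simps ring_ad_self by (rule ring_ad_funpow_0)
  finally show ?thesis .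
qed

text \<open>The element t x. The variable t counts letters: the coefficient of t^n in log(e^{tx}
  e^{ty}) is its part of degree n in x and y.\<close>

abbreviation fps_tvar :: "'r::real_algebra_1 \<Rightarrow> 'r fps" where
  "fps_tvar x \<equiv> fps_const x * fps_X"

lemma fps_tvar_0 [simp]: "fps_tvar x $ 0 = 0"
  by simp

lemma fps_ad_tvar_nth: "fps_ad (fps_tvar x) Y $ n = (if n = 0 then 0 else ring_ad x (Y $ (n - 1)))"
proof -
  have "fps_tvar x * Y = fps_const x * (fps_X * Y)" by (simp add: mult.assoc)
  moreover have "Y * fps_tvar x = (Y * fps_const x) * fps_X" by (simp add: mult.assoc)
  ultimately show ?thesis by (simp add: fps_ad_def ring_ad_def)
qed

lemma fps_ad_tvar_funpow_nth:
  "(fps_ad (fps_tvar x) ^^ r) Y $ n = (if r \<le> n then (ring_ad x ^^ r) (Y $ (n - r)) else 0)"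
  by (induction r arbitrary: n) (auto simp: fps_ad_tvar_nth)

lemma fps_eval_ad_tvar_nth:
  "fps_eval (fps_ad (fps_tvar x)) (fps_exp 1) Y $ n = (\<Sum>r\<le>n. (1 / fact r) *\<^sub>R (ring_ad x ^^ r) (Y $ (n - r)))"
  by (simp add: fps_eval_def fps_ad_tvar_funpow_nth)

lemma fps_Exp_tvar_nth: "fps_Exp (fps_tvar x) $ n = (1 / fact n) *\<^sub>R x ^ n"
proof -
  have "fps_tvar x ^ k = fps_const (x ^ k) * fps_X ^ k" for k
  proof (induction k)
    case (Suc k)
    have "fps_tvar x ^ Suc k = fps_const x * (fps_X * fps_const (x ^ k)) * fps_X ^ k"
      by (simp add: Suc mult.assoc)
    also have "fps_X * fps_const (x ^ k) = fps_const (x ^ k) * fps_X"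
      by (rule fps_ext) simp
    finally show ?case by (simp add: mult.assoc flip: fps_const_mult)
  qed simp
  then show ?thesis
    by (subst fps_Exp_nth[OF fps_tvar_0 order_refl])
       (simp add: fps_X_power_nth if_distrib if_distribR sum.delta cong: if_cong)
qed

lemma fps_deriv_Exp_tvar: "fps_deriv (fps_Exp (fps_tvar x)) = fps_const x * fps_Exp (fps_tvar x)"
proof (rule fps_ext)
  fix n
  have "of_nat (n + 1) * ((1 / fact (n + 1)) *\<^sub>R x ^ (n + 1)) = 
      (real (n + 1) * (1 / fact (n + 1))) *\<^sub>R x ^ (n + 1)"
    by (metis of_real_of_nat_eq scaleR_conv_of_real scaleR_scaleR)
  also have "real (n + 1) * (1 / fact (n + 1)) = 1 / fact n"
    by (simp add: divide_simps del: of_nat_Suc)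
  finally show "fps_deriv (fps_Exp (fps_tvar x)) $ n = (fps_const x * fps_Exp (fps_tvar x)) $ n"
    by (simp add: fps_Exp_tvar_nth del: of_nat_Suc fact_Suc)
qed

section \<open>Dynkin's differential equation and its solution\<close>

definition fps_ln_quot :: "real fps" where
  "fps_ln_quot = Abs_fps (\<lambda>n. (- 1) ^ n / of_nat (Suc n))"

lemma fps_X_ln_quot: "fps_X * fps_ln_quot = fps_ln 1"
  by (rule fps_ext) (auto simp: fps_ln_quot_def fps_ln_nth gr0_conv_Suc)

text \<open>For L(X) = log(1 + X)/X one has L(e^X - 1) = X/(e^X - 1), the reciprocal of
  \<open>fps_exp_quot\<close>. Multiplying by X and cancelling it replaces the division.\<close>

lemma fps_ln_quot_exp_quot: "(fps_ln_quot oo (fps_exp 1 - 1)) * fps_exp_quot = 1"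
proof -
  have "fps_ln 1 oo (fps_exp 1 - 1) = (fps_X :: real fps)"
    using fps_inv_fps_exp_compose(1)[of "1::real"] by (simp add: fps_ln_fps_exp_inv)
  then have "(fps_exp 1 - 1) * (fps_ln_quot oo (fps_exp 1 - 1)) = fps_X"
    by (simp flip: fps_X_ln_quot add: fps_compose_mult_distrib)
  then have "fps_X * ((fps_ln_quot oo (fps_exp 1 - 1)) * fps_exp_quot) = fps_X * 1"
    by (simp flip: fps_X_exp_quot add: mult_ac)
  then show ?thesis
    using mult_left_cancel[OF fps_X_neq_zero] by blast
qed

text \<open>
  With $Z = \log (e^{tx} e^{ty})$ one has $e^{\mathrm{ad} Z} = e^{t \, \mathrm{ad} x} e^{t \, \mathrm{ad} y} = 1 + T$ and
  $\frac{e^{\mathrm{ad} Z} - 1}{\mathrm{ad} Z} Z' = v$, hence $Z' = \frac{\log (1 + T)}{T} v$.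
\<close>

lemma dynkin_ode:
  fixes x y :: "'r::real_algebra_1"
  defines "T \<equiv> \<lambda>Y. fps_eval (fps_ad (fps_tvar x)) (fps_exp 1) (fps_eval (fps_ad (fps_tvar y)) (fps_exp 1) Y) - Y"
  defines "v \<equiv> fps_const x + fps_eval (fps_ad (fps_tvar x)) (fps_exp 1) (fps_const y)"
  obtains Z where "Z $ 0 = 0" "fps_Exp Z = fps_Exp (fps_tvar x) * fps_Exp (fps_tvar y)"
    "fps_deriv Z = fps_eval T fps_ln_quot v"
proof -
  let ?E = "\<lambda>x. fps_Exp (fps_tvar x)"
  define P where "P = ?E x * ?E y"
  have "P $ 0 = 1" by (simp add: P_def fps_Exp_tvar_nth)
  then obtain Z where Z: "Z $ 0 = 0" "fps_Exp Z = P" by (rule fps_Log_exists)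
  obtain Q where Q: "P * Q = 1" using fps_Exp_inverse[OF Z(1)] Z(2) by metis
  \<comment> \<open>The conjugation formulas give identities only after right multiplication by P =
    e^Z, which the right inverse Q removes.\<close>
  have cancel: "U = V" if "U * P = V * P" for U V
    using arg_cong[OF that, of "\<lambda>W. W * Q"] by (simp add: mult.assoc Q)
  have "fps_eval (fps_ad Z) (fps_exp 1) Y =
      fps_eval (fps_ad (fps_tvar x)) (fps_exp 1) (fps_eval (fps_ad (fps_tvar y)) (fps_exp 1) Y)" for Y
  proof (rule cancel)
    have "?E x * (?E y * Y) = fps_eval (fps_ad (fps_tvar x)) (fps_exp 1)
        (fps_eval (fps_ad (fps_tvar y)) (fps_exp 1) Y) * ?E x * ?E y"
      unfolding fps_Exp_mult_ad[OF fps_tvar_0, of y Y] mult.assoc[symmetric]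
      by (simp only: fps_Exp_mult_ad[OF fps_tvar_0])
    then show "fps_eval (fps_ad Z) (fps_exp 1) Y * P = fps_eval (fps_ad (fps_tvar x)) (fps_exp 1)
        (fps_eval (fps_ad (fps_tvar y)) (fps_exp 1) Y) * P"
      using fps_Exp_mult_ad[OF Z(1), of Y] by (simp add: Z(2) P_def mult.assoc)
  qed
  then have T: "T = fps_eval (fps_ad Z) (fps_exp 1 - 1)"
    by (simp add: T_def fun_eq_iff fps_eval_diff_left)
  \<comment> \<open>P' is x e^{tx} e^{ty} + e^{tx} y e^{ty}; moving e^{tx} past y in the second term
    produces v.\<close>
  have "fps_deriv P = v * P"
  proof -
    have "?E x * (fps_const y * ?E y) = fps_eval (fps_ad (fps_tvar x)) (fps_exp 1) (fps_const y) * P"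
      unfolding P_def mult.assoc[symmetric] by (simp only: fps_Exp_mult_ad[OF fps_tvar_0])
    then show ?thesis
      unfolding v_def distrib_right
      by (simp only: P_def fps_deriv_mult fps_deriv_Exp_tvar mult.assoc add.commute)
  qed
  then have "v = fps_eval (fps_ad Z) fps_exp_quot (fps_deriv Z)"
    using fps_deriv_Exp[OF Z(1)] unfolding Z(2) by (metis cancel)
  moreover have "fps_eval T fps_ln_quot Y = fps_eval (fps_ad Z) (fps_ln_quot oo (fps_exp 1 - 1)) Y" for Y
    unfolding T by (rule fps_eval_compose[symmetric]) (simp_all add: order_raising_ad[OF Z(1)])
  ultimately have "fps_eval T fps_ln_quot v =
      fps_eval (fps_ad Z) ((fps_ln_quot oo (fps_exp 1 - 1)) * fps_exp_quot) (fps_deriv Z)"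
    by (simp only: fps_eval_mult[OF order_raising_ad[OF Z(1)]])
  then have "fps_deriv Z = fps_eval T fps_ln_quot v"
    by (simp only: fps_ln_quot_exp_quot fps_eval_1)
  with Z that show thesis unfolding P_def by blast
qed

text \<open>Subtracting Y cancels exactly the term r = s = 0. This is the origin of the condition r
  + s > 0 on the blocks of Dynkin's formula.\<close>

lemma dynkin_step_nth:
  "(fps_eval (fps_ad (fps_tvar x)) (fps_exp 1) (fps_eval (fps_ad (fps_tvar y)) (fps_exp 1) Y) - Y) $ n =
    (\<Sum>(r, s)\<in>{(r, s). r + s \<le> n \<and> (r, s) \<noteq> (0, 0)}.
      (1 / (fact r * fact s)) *\<^sub>R (ring_ad x ^^ r) ((ring_ad y ^^ s) (Y $ (n - (r + s)))))"
proof -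
  let ?g = "\<lambda>(r, s). (1 / (fact r * fact s)) *\<^sub>R (ring_ad x ^^ r) ((ring_ad y ^^ s) (Y $ (n - (r + s))))"
  have fin: "finite {(r, s). r + s \<le> n}"
    by (rule finite_subset[of _ "{..n} \<times> {..n}"]) auto
  have "fps_eval (fps_ad (fps_tvar x)) (fps_exp 1) (fps_eval (fps_ad (fps_tvar y)) (fps_exp 1) Y) $ n =
      (\<Sum>r\<le>n. \<Sum>s\<le>n - r. ?g (r, s))"
    by (simp add: fps_eval_ad_tvar_nth ring_ad_funpow_sum ring_ad_funpow_scaleR scaleR_sum_right)
  also have "\<dots> = sum ?g (Sigma {..n} (\<lambda>r. {..n - r}))"
    by (subst sum.Sigma) auto
  also have "Sigma {..n} (\<lambda>r. {..n - r}) = {(r, s). r + s \<le> n}"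
    by auto
  also have "sum ?g \<dots> = ?g (0, 0) + sum ?g ({(r, s). r + s \<le> n} - {(0, 0)})"
    by (rule sum.remove[OF fin]) simp
  also have "{(r, s). r + s \<le> n} - {(0, 0)} = {(r, s). r + s \<le> n \<and> (r, s) \<noteq> (0, 0)}"
    by auto
  finally show ?thesis by simp
qed

text \<open>Each factor T puts one block in front of a word, and v provides the last block. The
  shift from n to \<open>Suc n\<close> appears because v belongs to Z', whose degree in t is one
  less than the number of letters.\<close>

lemma dynkin_iterate_nth:
  fixes x y :: "'r::real_algebra_1"
  defines "T \<equiv> \<lambda>Y. fps_eval (fps_ad (fps_tvar x)) (fps_exp 1) (fps_eval (fps_ad (fps_tvar y)) (fps_exp 1) Y) - Y"
  defines "v \<equiv> fps_const x + fps_eval (fps_ad (fps_tvar x)) (fps_exp 1) (fps_const y)"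
  shows "(T ^^ m) v $ n = (\<Sum>ps\<in>dynkin_lists (Suc m) (Suc n).
    (1 / dynkin_fact ps) *\<^sub>R comm_word (dynkin_word x y ps))"
proof (induction m arbitrary: n)
  case 0
  let ?h = "\<lambda>(r, s). (1 / (fact r * fact s)) *\<^sub>R comm_word (replicate r x @ replicate s y)"
  have dl0: "dynkin_lists 0 k = (if k = 0 then {[]} else {})" for k
    by (auto simp: dynkin_lists_def)
  have fin: "finite {(r, s). r + s \<le> Suc n \<and> (r, s) \<noteq> (0, 0)}"
    by (rule finite_subset[of _ "{..Suc n} \<times> {..Suc n}"]) auto
  have "(\<Sum>ps\<in>dynkin_lists (Suc 0) (Suc n). (1 / dynkin_fact ps) *\<^sub>R comm_word (dynkin_word x y ps)) =
      (\<Sum>(r, s)\<in>{(r, s). r + s \<le> Suc n \<and> (r, s) \<noteq> (0, 0)}. if r + s = Suc n then ?h (r, s) else 0)"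
    unfolding sum_dynkin_lists_Suc by (intro sum.cong) (auto simp: dl0)
  \<comment> \<open>A one-block word ending in y y vanishes. What remains is x^(n+1), itself zero
    unless n = 0, and x^n y.\<close>
  also have "\<dots> = (\<Sum>(r, s)\<in>{(Suc n, 0), (n, 1)}. ?h (r, s))"
  proof (rule sum.mono_neutral_cong_right[OF fin])
    show "\<forall>i\<in>{(r, s). r + s \<le> Suc n \<and> (r, s) \<noteq> (0, 0)} - {(Suc n, 0), (n, 1)}.
       (case i of (r, s) \<Rightarrow> if r + s = Suc n then ?h (r, s) else 0) = 0"
    proof
      fix rs assume rs: "rs \<in> {(r, s). r + s \<le> Suc n \<and> (r, s) \<noteq> (0, 0)} - {(Suc n, 0), (n, 1)}"
      obtain r s where [simp]: "rs = (r, s)" by fastforce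
      have "?h (r, s) = 0" if "r + s = Suc n"
      proof -
        have "s \<noteq> 0" "s \<noteq> 1" using that rs by auto
        then have "s \<ge> 2" by simp
        then have "replicate s y \<noteq> []" by auto
        with \<open>s \<ge> 2\<close> show ?thesis
          by (simp add: comm_word_replicate_append comm_word_replicate)
      qed
      then show "(case rs of (r, s) \<Rightarrow> if r + s = Suc n then ?h (r, s) else 0) = 0" by auto
    qed
  qed auto
  also have "\<dots> = v $ n"
  proof -
    have "comm_word (replicate (Suc n) x) = (if n = 0 then x else 0)"
      using comm_word_replicate[of "Suc n" x] by (cases n) auto
    moreover have "comm_word (replicate n x @ [y]) = (ring_ad x ^^ n) y"
      by (simp add: comm_word_replicate_append)
    moreover have "(\<Sum>r\<le>n. (1 / fact r) *\<^sub>R (ring_ad x ^^ r) (fps_const y $ (n - r))) =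
        (\<Sum>r\<le>n. if r = n then (1 / fact n) *\<^sub>R (ring_ad x ^^ n) y else 0)"
      by (intro sum.cong) auto
    ultimately show ?thesis
      by (simp add: v_def fps_eval_ad_tvar_nth sum.delta)
  qed
  finally show ?case by simp
next
  case (Suc m)
  let ?A = "\<lambda>n. {(r, s). r + s \<le> n \<and> (r, s) \<noteq> (0::nat, 0::nat)}"
  let ?F = "\<lambda>ps. (1 / dynkin_fact ps) *\<^sub>R comm_word (dynkin_word x y ps)"
  \<comment> \<open>A first block using all \<open>Suc n\<close> letters would leave none for the
    other blocks, so only r + s \<le> n counts.\<close>
  have "dynkin_lists (Suc m) 0 = {}"
    by (auto simp: dynkin_lists_def length_Suc_conv)
  then have "(\<Sum>ps\<in>dynkin_lists (Suc (Suc m)) (Suc n). ?F ps) =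
      (\<Sum>(r, s)\<in>?A n. \<Sum>ps\<in>dynkin_lists (Suc m) (Suc n - (r + s)). ?F ((r, s) # ps))"
    unfolding sum_dynkin_lists_Suc[where m = "Suc m"]
    by (intro sum.mono_neutral_right finite_subset[of "?A (Suc n)" "{..Suc n} \<times> {..Suc n}"])
       (auto simp: not_le le_Suc_eq)
  also have "\<dots> = (\<Sum>(r, s)\<in>?A n. (1 / (fact r * fact s)) *\<^sub>R
      (ring_ad x ^^ r) ((ring_ad y ^^ s) ((T ^^ m) v $ (n - (r + s)))))"
  proof (intro sum.cong refl)
    fix rs assume "rs \<in> ?A n"
    then obtain r s where rs: "rs = (r, s)" "r + s \<le> n" by auto
    have "?F ((r, s) # ps) = (1 / (fact r * fact s)) *\<^sub>R (ring_ad x ^^ r) ((ring_ad y ^^ s) (?F ps))"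
      if "ps \<in> dynkin_lists (Suc m) (Suc n - (r + s))" for ps
    proof -
      have "dynkin_word x y ps \<noteq> []"
        using that rs length_dynkin_word[of x y ps] by (auto simp: dynkin_lists_def)
      then show ?thesis
        by (simp add: comm_word_replicate_append ring_ad_funpow_scaleR)
    qed
    then show "(case rs of (r, s) \<Rightarrow> \<Sum>ps\<in>dynkin_lists (Suc m) (Suc n - (r + s)). ?F ((r, s) # ps)) =
        (case rs of (r, s) \<Rightarrow>
          (1 / (fact r * fact s)) *\<^sub>R (ring_ad x ^^ r) ((ring_ad y ^^ s) ((T ^^ m) v $ (n - (r + s)))))"
      unfolding rs(1) prod.case Suc[of "n - (r + s)"] using rs(2)
      by (simp add: ring_ad_funpow_sum scaleR_sum_right Suc_diff_le)
  qed
  also have "\<dots> = (T ^^ Suc m) v $ n"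
    using dynkin_step_nth[of x y "(T ^^ m) v" n] by (simp add: T_def)
  finally show ?case ..
qed

text \<open>The coefficients arise from integrating Z' = (log(1 + T)/T) v: the series contributes
  (-1)^(m-1)/m for m blocks, and integrating t^(n-1) divides by the number n of letters.\<close>

theorem fps_Exp_dynkin:
  fixes x y :: "'r::real_algebra_1"
  shows "fps_Exp (Abs_fps (dynkin_sum x y)) = fps_Exp (fps_tvar x) * fps_Exp (fps_tvar y)"
proof -
  define T where "T = (\<lambda>Y. fps_eval (fps_ad (fps_tvar x)) (fps_exp 1) (fps_eval (fps_ad (fps_tvar y)) (fps_exp 1) Y) - Y)"
  define v where "v = fps_const x + fps_eval (fps_ad (fps_tvar x)) (fps_exp 1) (fps_const y)"
  obtain Z where Z: "Z $ 0 = 0" "fps_Exp Z = fps_Exp (fps_tvar x) * fps_Exp (fps_tvar y)"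
    "fps_deriv Z = fps_eval T fps_ln_quot v"
    unfolding T_def v_def by (rule dynkin_ode)
  have "Z $ n = dynkin_sum x y n" for n
  proof (cases n)
    case 0
    have *: "{ps. ps \<noteq> [] \<and> (0, 0) \<notin> set ps \<and> dynkin_size ps = 0} = {}"
      using length_le_dynkin_size by fastforce
    show ?thesis unfolding 0 Z dynkin_sum_def * by simp
  next
    case (Suc k)
    have "of_nat (Suc k) * Z $ n = fps_deriv Z $ k" by (simp add: Suc)
    also have "\<dots> = (\<Sum>m\<le>k. \<Sum>ps\<in>dynkin_lists (Suc m) (Suc k).
        ((- 1) ^ m / of_nat (Suc m) / dynkin_fact ps) *\<^sub>R comm_word (dynkin_word x y ps))"
      unfolding Z(3) fps_eval_def fps_nth_Abs_fps dynkin_iterate_nth[where x = x and y = y, folded T_def v_def]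
      by (simp add: fps_ln_quot_def scaleR_sum_right)
    also have "\<dots> = (\<Sum>m\<le>k. \<Sum>ps\<in>dynkin_lists (Suc m) (Suc k).
        of_nat (Suc k) * (dynkin_coeff ps *\<^sub>R comm_word (dynkin_word x y ps)))"
    proof (intro sum.cong refl)
      fix m ps assume "ps \<in> dynkin_lists (Suc m) (Suc k)"
      then have *: "(- 1) ^ m / of_nat (Suc m) / dynkin_fact ps = real (Suc k) * dynkin_coeff ps"
        by (auto simp: dynkin_lists_def dynkin_coeff_def)
      show "((- 1) ^ m / of_nat (Suc m) / dynkin_fact ps) *\<^sub>R comm_word (dynkin_word x y ps) =
          of_nat (Suc k) * (dynkin_coeff ps *\<^sub>R comm_word (dynkin_word x y ps))"
        unfolding * by (metis of_real_of_nat_eq scaleR_conv_of_real scaleR_scaleR)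
    qed
    also have "\<dots> = (\<Sum>ps\<in>(\<Union>m\<le>k. dynkin_lists (Suc m) (Suc k)).
        of_nat (Suc k) * (dynkin_coeff ps *\<^sub>R comm_word (dynkin_word x y ps)))"
      by (subst sum.UNION_disjoint) (auto simp: finite_dynkin_lists, auto simp: dynkin_lists_def)
    also have "(\<Union>m\<le>k. dynkin_lists (Suc m) (Suc k)) = {ps. ps \<noteq> [] \<and> (0, 0) \<notin> set ps \<and> dynkin_size ps = n}"
    proof (intro Set.set_eqI iffI)
      fix ps assume "ps \<in> {ps. ps \<noteq> [] \<and> (0, 0) \<notin> set ps \<and> dynkin_size ps = n}"
      then have "ps \<in> dynkin_lists (Suc (length ps - 1)) (Suc k)" "length ps - 1 \<le> k"
        using length_le_dynkin_size[of ps] by (auto simp: dynkin_lists_def Suc)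
      then show "ps \<in> (\<Union>m\<le>k. dynkin_lists (Suc m) (Suc k))" by blast
    qed (auto simp: dynkin_lists_def Suc)
    finally have "of_nat (Suc k) * Z $ n = of_nat (Suc k) * dynkin_sum x y n"
      by (simp only: sum_distrib_left dynkin_sum_def)
    then have "real (Suc k) *\<^sub>R Z $ n = real (Suc k) *\<^sub>R dynkin_sum x y n"
      by (metis of_real_of_nat_eq scaleR_conv_of_real)
    then show ?thesis by simp
  qed
  then have "Z = Abs_fps (dynkin_sum x y)" by (intro fps_ext) simp
  with Z(2) show ?thesis by simp
qed

section \<open>Associativity of the Baker--Campbell--Hausdorff product\<close>

unbundle no fps_syntax
unbundle vec_syntax

section \<open>The incidence algebra of an ordered lattice and its exponential\<close>

lemma finite_vec_interval: "finite {m..n :: int ^ 'n::finite}"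
proof (rule finite_subset)
  show "{m..n} \<subseteq> (\<lambda>f. \<chi> i. f i) ` (\<Pi>\<^sub>E i\<in>UNIV. {m $ i..n $ i})"
  proof
    fix x assume "x \<in> {m..n}"
    then have "(\<lambda>i. x $ i) \<in> (\<Pi>\<^sub>E i\<in>UNIV. {m $ i..n $ i})"
      by (auto simp: less_eq_vec_def)
    moreover have "x = (\<chi> i. x $ i)" by simp
    ultimately show "x \<in> (\<lambda>f. \<chi> i. f i) ` (\<Pi>\<^sub>E i\<in>UNIV. {m $ i..n $ i})" by blast
  qed
  show "finite ((\<lambda>f. \<chi> i. f i) ` (\<Pi>\<^sub>E i\<in>UNIV. {m $ i..n $ i}))"
    by (intro finite_imageI finite_PiE) auto
qed

text \<open>Infinite matrices over the lattice with entries K m n only for n \<le> m componentwise.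
  Order intervals are finite, so products are finite sums, and formal infinite sums of monomials can
  be represented without any convergence.\<close>

typedef (overloaded) 'n::finite incidence = "{K :: int ^ 'n \<Rightarrow> int ^ 'n \<Rightarrow> complex. \<forall>m n. \<not> n \<le> m \<longrightarrow> K m n = 0}"
  by (rule exI[of _ "\<lambda>m n. 0"]) simp

setup_lifting type_definition_incidence

lemma incidence_eqI: "(\<And>m n. Rep_incidence K m n = Rep_incidence L m n) \<Longrightarrow> K = L"
  by (metis Rep_incidence_inject ext)

lemma incidence_nonzero: "Rep_incidence K m n \<noteq> 0 \<Longrightarrow> n \<le> m"
  using Rep_incidence[of K] by auto

lemma incidence_zero: "\<not> n \<le> m \<Longrightarrow> Rep_incidence K m n = 0"
  using incidence_nonzero by blast

instantiation incidence :: (finite) real_algebra_1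
begin

lift_definition zero_incidence :: "'a incidence" is "\<lambda>m n. 0" by simp
lift_definition one_incidence :: "'a incidence" is "\<lambda>m n. if m = n then 1 else 0" by auto
lift_definition plus_incidence :: "'a incidence \<Rightarrow> 'a incidence \<Rightarrow> 'a incidence" is
  "\<lambda>K L m n. K m n + L m n" by simp
lift_definition minus_incidence :: "'a incidence \<Rightarrow> 'a incidence \<Rightarrow> 'a incidence" is
  "\<lambda>K L m n. K m n - L m n" by simp
lift_definition uminus_incidence :: "'a incidence \<Rightarrow> 'a incidence" is
  "\<lambda>K m n. - K m n" by simp
lift_definition scaleR_incidence :: "real \<Rightarrow> 'a incidence \<Rightarrow> 'a incidence" is
  "\<lambda>c K m n. c *\<^sub>R K m n" by simp
lift_definition times_incidence :: "'a incidence \<Rightarrow> 'a incidence \<Rightarrow> 'a incidence" is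
  "\<lambda>K L m n. \<Sum>p\<in>{n..m}. K m p * L p n" by simp

instance
proof
  fix K L M :: "'a incidence" and c d :: real
  show "K * L * M = K * (L * M)"
  proof (rule incidence_eqI)
    fix m n
    let ?K = "Rep_incidence K" and ?L = "Rep_incidence L" and ?M = "Rep_incidence M"
    have "Rep_incidence (K * L * M) m n = (\<Sum>p\<in>{n..m}. (\<Sum>q\<in>{p..m}. ?K m q * ?L q p) * ?M p n)"
      by (simp add: times_incidence.rep_eq)
    also have "\<dots> = (\<Sum>p\<in>{n..m}. \<Sum>q\<in>{n..m}. ?K m q * ?L q p * ?M p n)"
      unfolding sum_distrib_right
      by (rule sum.cong[OF refl], rule sum.mono_neutral_left[OF finite_vec_interval])
         (auto simp: incidence_zero intro: order_trans)
    also have "\<dots> = (\<Sum>q\<in>{n..m}. \<Sum>p\<in>{n..m}. ?K m q * ?L q p * ?M p n)"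
      by (rule sum.swap)
    also have "\<dots> = (\<Sum>q\<in>{n..m}. ?K m q * (\<Sum>p\<in>{n..q}. ?L q p * ?M p n))"
      unfolding sum_distrib_left mult.assoc
      by (rule sum.cong[OF refl], rule sum.mono_neutral_right[OF finite_vec_interval])
         (auto simp: incidence_zero intro: order_trans)
    also have "\<dots> = Rep_incidence (K * (L * M)) m n"
      by (simp add: times_incidence.rep_eq)
    finally show "Rep_incidence (K * L * M) m n = Rep_incidence (K * (L * M)) m n" .
  qed
  show "1 * K = K"
  proof (rule incidence_eqI)
    fix m n
    have "Rep_incidence (1 * K) m n = (\<Sum>p\<in>{n..m}. if p = m then Rep_incidence K m n else 0)"
      unfolding times_incidence.rep_eq one_incidence.rep_eq by (intro sum.cong) auto
    then show "Rep_incidence (1 * K) m n = Rep_incidence K m n"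
      using incidence_nonzero by (auto simp: sum.delta finite_vec_interval)
  qed
  show "K * 1 = K"
  proof (rule incidence_eqI)
    fix m n
    have "Rep_incidence (K * 1) m n = (\<Sum>p\<in>{n..m}. if p = n then Rep_incidence K m n else 0)"
      unfolding times_incidence.rep_eq one_incidence.rep_eq by (intro sum.cong) auto
    then show "Rep_incidence (K * 1) m n = Rep_incidence K m n"
      using incidence_nonzero by (auto simp: sum.delta finite_vec_interval)
  qed
  show "(0 :: 'a incidence) \<noteq> 1"
    by (metis one_incidence.rep_eq zero_incidence.rep_eq zero_neq_one)
  show "(K + L) * M = K * M + L * M" "K * (L + M) = K * L + K * M"
    by (transfer; simp add: fun_eq_iff algebra_simps sum.distrib)+
  show "c *\<^sub>R K * L = c *\<^sub>R (K * L)" "K * c *\<^sub>R L = c *\<^sub>R (K * L)"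
    by (transfer; simp add: fun_eq_iff scaleR_sum_right)+
qed (transfer; auto simp: fun_eq_iff algebra_simps)+

end

lemmas incidence_rep_simps = zero_incidence.rep_eq one_incidence.rep_eq plus_incidence.rep_eq
  minus_incidence.rep_eq uminus_incidence.rep_eq scaleR_incidence.rep_eq

lemma Rep_incidence_sum: "Rep_incidence (\<Sum>i\<in>I. f i) m n = (\<Sum>i\<in>I. Rep_incidence (f i) m n)"
  by (induction I rule: infinite_finite_induct) (auto simp: incidence_rep_simps)

lemma deg_add: "deg (m + n) = deg m + deg n"
  and deg_diff: "deg (m - n) = deg m - deg n"
  by (simp_all add: deg_def sum.distrib sum_subtractf)

lemma deg_0 [simp]: "deg 0 = 0"
  by (simp add: deg_def)

lemma deg_mono: "n \<le> m \<Longrightarrow> deg n \<le> deg m"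
  by (auto simp: deg_def less_eq_vec_def intro: sum_mono)

definition incidence_order :: "nat \<Rightarrow> 'n::finite incidence \<Rightarrow> bool" where
  "incidence_order l K \<longleftrightarrow> (\<forall>m n. Rep_incidence K m n \<noteq> 0 \<longrightarrow> int l \<le> deg m - deg n)"

lemma incidence_order_zero: "incidence_order l 0"
  by (simp add: incidence_order_def incidence_rep_simps)

lemma incidence_order_add: "incidence_order l K \<Longrightarrow> incidence_order l L \<Longrightarrow> incidence_order l (K + L)"
  unfolding incidence_order_def incidence_rep_simps by (metis add.right_neutral)

lemma incidence_order_diff: "incidence_order l K \<Longrightarrow> incidence_order l L \<Longrightarrow> incidence_order l (K - L)"
  unfolding incidence_order_def incidence_rep_simps by (metis diff_zero diff_0 minus_equation_iff minus_zero)

lemma incidence_order_scaleR: "incidence_order l K \<Longrightarrow> incidence_order l (c *\<^sub>R K)"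
  by (auto simp: incidence_order_def incidence_rep_simps)

lemma incidence_order_sum: "(\<And>i. i \<in> I \<Longrightarrow> incidence_order l (f i)) \<Longrightarrow> incidence_order l (\<Sum>i\<in>I. f i)"
  by (induction I rule: infinite_finite_induct) (auto simp: incidence_order_zero incidence_order_add)

lemma incidence_order_one: "incidence_order 0 1"
  by (auto simp: incidence_order_def incidence_rep_simps)

lemma incidence_order_mult:
  assumes "incidence_order k K" "incidence_order l L"
  shows "incidence_order (k + l) (K * L)"
  unfolding incidence_order_def
proof (intro allI impI)
  fix m n assume "Rep_incidence (K * L) m n \<noteq> 0"
  then obtain p where "Rep_incidence K m p * Rep_incidence L p n \<noteq> 0"
    unfolding times_incidence.rep_eq by (meson sum.not_neutral_contains_not_neutral)
  then show "int (k + l) \<le> deg m - deg n"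
    using assms unfolding incidence_order_def by fastforce
qed

lemma incidence_order_power:
  assumes "incidence_order 1 K" shows "incidence_order k (K ^ k)"
proof (induction k)
  case (Suc k)
  then show ?case using incidence_order_mult[OF assms Suc] by simp
qed (simp add: incidence_order_one)

text \<open>If K raises the degree by at least one, K^k has no entry at (m, n) for k > deg m - deg
  n, so the truncated sum is the full exponential.\<close>

definition incidence_Exp :: "'n::finite incidence \<Rightarrow> int ^ 'n \<Rightarrow> int ^ 'n \<Rightarrow> complex" where
  "incidence_Exp K m n = (\<Sum>k\<le>nat (deg m - deg n). (1 / fact k) *\<^sub>R Rep_incidence (K ^ k) m n)"

text \<open>Comparison of leading terms: if K - L raises the degree by at least d + 1, the
  differences of higher powers raise it by more. In degree d + 1 the exponentials therefore differ
  by K - L alone, which must vanish there; iterating exhausts all degrees.\<close>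

lemma incidence_Exp_inj:
  assumes "incidence_order 1 K" "incidence_order 1 L" "incidence_Exp K = incidence_Exp L"
  shows "K = L"
proof -
  have "incidence_order (Suc d) (K - L)" for d
  proof (induction d)
    case 0
    then show ?case using assms incidence_order_diff by simp
  next
    case (Suc d)
    \<comment> \<open>Telescoping one factor at a time: each further factor K or L adds one to the
      order of the difference.\<close>
    have pow: "incidence_order (Suc d + k) (K ^ Suc k - L ^ Suc k)" for k
    proof (induction k)
      case (Suc k)
      have "K ^ Suc (Suc k) - L ^ Suc (Suc k) = K * (K ^ Suc k - L ^ Suc k) + (K - L) * L ^ Suc k"
        by (simp add: algebra_simps)
      moreover have "incidence_order (Suc d + Suc k) (K * (K ^ Suc k - L ^ Suc k))"
        using incidence_order_mult[OF assms(1) Suc] by simp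
      moreover have "incidence_order (Suc d + Suc k) ((K - L) * L ^ Suc k)"
        using incidence_order_mult[OF \<open>incidence_order (Suc d) (K - L)\<close> incidence_order_power[OF assms(2), of "Suc k"]]
        by simp
      ultimately show ?case by (metis incidence_order_add)
    qed (use Suc in simp)
    show ?case
      unfolding incidence_order_def
    proof (intro allI impI, rule ccontr)
      fix m n assume ne: "Rep_incidence (K - L) m n \<noteq> 0" and lt: "\<not> int (Suc (Suc d)) \<le> deg m - deg n"
      have "int (Suc d) \<le> deg m - deg n"
        using Suc ne unfolding incidence_order_def by blast
      then have d: "nat (deg m - deg n) = Suc d" using lt by simp
      have "Rep_incidence (K ^ Suc (Suc k)) m n = Rep_incidence (L ^ Suc (Suc k)) m n" for k
      proof -
        have "Rep_incidence (K ^ Suc (Suc k) - L ^ Suc (Suc k)) m n = 0"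
          using pow[of "Suc k"] lt unfolding incidence_order_def by fastforce
        then show ?thesis by (simp only: incidence_rep_simps right_minus_eq)
      qed
      then have "(\<Sum>k\<le>d. (1 / fact (Suc k)) *\<^sub>R Rep_incidence (K ^ Suc k) m n)
          - (\<Sum>k\<le>d. (1 / fact (Suc k)) *\<^sub>R Rep_incidence (L ^ Suc k) m n)
          = Rep_incidence (K - L) m n"
        unfolding sum.atMost_shift
        by (simp add: incidence_rep_simps del: power_Suc fact_Suc)
      moreover have "incidence_Exp K m n = incidence_Exp L m n" using assms(3) by simp
      ultimately show False
        using ne by (simp add: incidence_Exp_def d sum.atMost_Suc_shift del: sum.atMost_Suc power_Suc fact_Suc)
    qed
  qed
  then have "Rep_incidence (K - L) m n \<noteq> 0 \<Longrightarrow> int (Suc (nat (deg m - deg n))) \<le> deg m - deg n" for m n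
    unfolding incidence_order_def by blast
  moreover have "\<not> int (Suc (nat (deg m - deg n))) \<le> deg m - deg n" for m n :: "int ^ 'a"
    by linarith
  ultimately have "Rep_incidence (K - L) m n = 0" for m n
    by blast
  then show "K = L"
    by (intro incidence_eqI) (simp add: incidence_rep_simps)
qed

definition incidence_graded :: "'n::finite incidence fps \<Rightarrow> bool" where
  "incidence_graded U \<longleftrightarrow> (\<forall>l. incidence_order l (fps_nth U l))"

text \<open>The value at t = 1. In a graded series the coefficient of t^l has no entry with deg m -
  deg n < l, so the sum stops at the degree distance.\<close>

definition incidence_total :: "'n::finite incidence fps \<Rightarrow> int ^ 'n \<Rightarrow> int ^ 'n \<Rightarrow> complex" where
  "incidence_total U m n = (\<Sum>l\<le>nat (deg m - deg n). Rep_incidence (fps_nth U l) m n)"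

lemma incidence_total_ge:
  assumes "incidence_graded U" "nat (deg m - deg n) \<le> N"
  shows "incidence_total U m n = (\<Sum>l\<le>N. Rep_incidence (fps_nth U l) m n)"
  unfolding incidence_total_def
proof (rule sum.mono_neutral_left)
  show "\<forall>l\<in>{..N} - {..nat (deg m - deg n)}. Rep_incidence (fps_nth U l) m n = 0"
    using assms(1) unfolding incidence_graded_def incidence_order_def by force
qed (use assms in auto)

lemma incidence_graded_mult:
  assumes "incidence_graded U" "incidence_graded V"
  shows "incidence_graded (U * V)"
  unfolding incidence_graded_def fps_mult_nth
proof (intro allI incidence_order_sum)
  fix l i :: nat assume "i \<in> {0..l}"
  then show "incidence_order l (fps_nth U i * fps_nth V (l - i))"
    using incidence_order_mult[of i "fps_nth U i" "l - i" "fps_nth V (l - i)"] assms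
    by (simp add: incidence_graded_def)
qed

text \<open>Degree distances add up along n \<le> p \<le> m, so products of coefficients with i + j
  beyond the distance from n to m vanish. This makes t = 1 compatible with products.\<close>

lemma incidence_total_mult:
  assumes "incidence_graded U" "incidence_graded V"
  shows "incidence_total (U * V) m n = (\<Sum>p\<in>{n..m}. incidence_total U m p * incidence_total V p n)"
proof -
  define d where "d = nat (deg m - deg n)"
  let ?U = "\<lambda>l. Rep_incidence (fps_nth U l)" and ?V = "\<lambda>l. Rep_incidence (fps_nth V l)"
  have le: "nat (deg m - deg p) \<le> d" "nat (deg p - deg n) \<le> d" if "p \<in> {n..m}" for p
    using that deg_mono[of n p] deg_mono[of p m] by (auto simp: d_def)
  have zero: "(\<Sum>p\<in>{n..m}. ?U i m p * ?V j p n) = 0" if "i + j > d" for i j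
  proof (rule sum.neutral, rule ballI)
    fix p assume p: "p \<in> {n..m}"
    show "?U i m p * ?V j p n = 0"
    proof (rule ccontr)
      assume "?U i m p * ?V j p n \<noteq> 0"
      then have "int i \<le> deg m - deg p" "int j \<le> deg p - deg n"
        using assms unfolding incidence_graded_def incidence_order_def by auto
      with that show False by (simp add: d_def)
    qed
  qed
  have "incidence_total (U * V) m n = (\<Sum>l\<le>d. \<Sum>i\<le>l. \<Sum>p\<in>{n..m}. ?U i m p * ?V (l - i) p n)"
    by (simp add: incidence_total_def d_def fps_mult_nth Rep_incidence_sum times_incidence.rep_eq atLeast0AtMost)
  also have "\<dots> = (\<Sum>(i, j)\<in>{(i, j). i + j \<le> d}. \<Sum>p\<in>{n..m}. ?U i m p * ?V j p n)"
    by (rule sum.triangle_reindex_eq[symmetric])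
  also have "\<dots> = (\<Sum>(i, j)\<in>{..d} \<times> {..d}. \<Sum>p\<in>{n..m}. ?U i m p * ?V j p n)"
    by (rule sum.mono_neutral_left) (auto, metis zero not_le)
  also have "\<dots> = (\<Sum>p\<in>{n..m}. \<Sum>(i, j)\<in>{..d} \<times> {..d}. ?U i m p * ?V j p n)"
    by (simp add: case_prod_beta) (rule sum.swap)
  also have "\<dots> = (\<Sum>p\<in>{n..m}. (\<Sum>i\<le>d. ?U i m p) * (\<Sum>j\<le>d. ?V j p n))"
    by (simp add: sum_product sum.cartesian_product)
  also have "\<dots> = (\<Sum>p\<in>{n..m}. incidence_total U m p * incidence_total V p n)"
    by (intro sum.cong refl) (simp add: incidence_total_ge[OF assms(1) le(1)] incidence_total_ge[OF assms(2) le(2)])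
  finally show ?thesis .
qed

lemma incidence_graded_one: "incidence_graded 1"
  by (auto simp: incidence_graded_def incidence_order_one incidence_order_zero)

lemma incidence_graded_power: "incidence_graded U \<Longrightarrow> incidence_graded (U ^ k)"
  by (induction k) (auto simp: incidence_graded_one incidence_graded_mult)

lemma incidence_total_power:
  assumes "incidence_graded U" "\<And>m n. incidence_total U m n = Rep_incidence K m n"
  shows "incidence_total (U ^ k) m n = Rep_incidence (K ^ k) m n"
proof (induction k arbitrary: m n)
  case 0
  have "incidence_total 1 m n = (\<Sum>l\<le>nat (deg m - deg n). if l = 0 then Rep_incidence 1 m n else 0)"
    unfolding incidence_total_def by (intro sum.cong) (auto simp: incidence_rep_simps)
  then show ?case by (simp add: sum.delta)
next
  case (Suc k)
  then show ?case
    by (simp add: incidence_total_mult[OF assms(1) incidence_graded_power[OF assms(1)]] assms(2) times_incidence.rep_eq)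
qed

lemma incidence_graded_Exp:
  assumes "incidence_graded Z" "fps_nth Z 0 = 0"
  shows "incidence_graded (fps_Exp Z)"
  unfolding incidence_graded_def fps_Exp_nth[OF assms(2) order_refl]
  using incidence_graded_power[OF assms(1)]
  by (intro allI incidence_order_sum incidence_order_scaleR) (simp add: incidence_graded_def)

lemma incidence_total_Exp:
  assumes "incidence_graded Z" "fps_nth Z 0 = 0" "\<And>m n. incidence_total Z m n = Rep_incidence K m n"
  shows "incidence_total (fps_Exp Z) m n = incidence_Exp K m n"
proof -
  let ?d = "nat (deg m - deg n)"
  have "incidence_total (fps_Exp Z) m n =
      (\<Sum>l\<le>?d. \<Sum>k\<le>?d. (1 / fact k) *\<^sub>R Rep_incidence (fps_nth (Z ^ k) l) m n)"
    unfolding incidence_total_def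
    by (intro sum.cong refl, subst fps_Exp_nth[OF assms(2)]) (auto simp: Rep_incidence_sum incidence_rep_simps)
  also have "\<dots> = (\<Sum>k\<le>?d. (1 / fact k) *\<^sub>R incidence_total (Z ^ k) m n)"
    unfolding incidence_total_def scaleR_sum_right by (rule sum.swap)
  finally show ?thesis
    by (simp add: incidence_total_power[OF assms(1,3)] incidence_Exp_def)
qed

lemma incidence_order_comm_word:
  assumes "\<And>a. a \<in> set ws \<Longrightarrow> incidence_order 1 a"
  shows "incidence_order (length ws) (comm_word ws)"
  using assms
proof (induction ws rule: comm_word.induct)
  case (3 a b ws)
  then have *: "incidence_order 1 a" "incidence_order (length (b # ws)) (comm_word (b # ws))"
    by simp_all
  then show ?case
    using incidence_order_mult[OF *(1) *(2)] incidence_order_mult[OF *(2) *(1)]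
    by (simp add: ring_ad_def incidence_order_diff)
qed (auto simp: incidence_order_zero)

lemma set_dynkin_word: "set (dynkin_word x y ps) \<subseteq> {x, y}"
proof (induction ps)
  case (Cons p ps)
  then show ?case by (cases p) auto
qed simp

lemma incidence_graded_dynkin:
  assumes "incidence_order 1 x" "incidence_order 1 y"
  shows "incidence_graded (Abs_fps (dynkin_sum x y))"
  unfolding incidence_graded_def dynkin_sum_def fps_nth_Abs_fps
proof (intro allI incidence_order_sum incidence_order_scaleR)
  fix l ps assume ps: "ps \<in> {ps. ps \<noteq> [] \<and> (0, 0) \<notin> set ps \<and> dynkin_size ps = l}"
  have "\<And>a. a \<in> set (dynkin_word x y ps) \<Longrightarrow> incidence_order 1 a"
    using set_dynkin_word[of x y ps] assms by auto
  then show "incidence_order l (comm_word (dynkin_word x y ps))"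
    using incidence_order_comm_word[of "dynkin_word x y ps"] ps by (simp add: length_dynkin_word)
qed

lemma incidence_total_tvar:
  assumes "incidence_order 1 x"
  shows "incidence_graded (fps_tvar x)" "incidence_total (fps_tvar x) m n = Rep_incidence x m n"
proof -
  have nth: "fps_nth (fps_tvar x) l = (if l = 1 then x else 0)" for l
    by (auto simp: fps_X_def)
  show "incidence_graded (fps_tvar x)"
    unfolding incidence_graded_def nth using assms incidence_order_zero by auto
  have "incidence_total (fps_tvar x) m n =
      (\<Sum>l\<le>nat (deg m - deg n). if l = 1 then Rep_incidence x m n else 0)"
    unfolding incidence_total_def nth by (intro sum.cong) (auto simp: incidence_rep_simps)
  moreover have "Rep_incidence x m n = 0" if "\<not> 1 \<le> nat (deg m - deg n)"
    using assms that unfolding incidence_order_def by fastforce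
  ultimately show "incidence_total (fps_tvar x) m n = Rep_incidence x m n"
    by (auto simp: sum.delta)
qed

text \<open>The identity \<open>fps_Exp_dynkin\<close> at t = 1.\<close>

lemma incidence_Exp_dynkin:
  assumes "incidence_order 1 x" "incidence_order 1 y"
    and "\<And>m n. incidence_total (Abs_fps (dynkin_sum x y)) m n = Rep_incidence z m n"
  shows "incidence_Exp z m n = (\<Sum>p\<in>{n..m}. incidence_Exp x m p * incidence_Exp y p n)"
proof -
  have "{ps. ps \<noteq> [] \<and> (0, 0) \<notin> set ps \<and> dynkin_size ps = 0} = {}"
    using length_le_dynkin_size by fastforce
  then have "fps_nth (Abs_fps (dynkin_sum x y)) 0 = 0"
    unfolding dynkin_sum_def fps_nth_Abs_fps by (metis sum.empty)
  then have "incidence_Exp z m n = incidence_total (fps_Exp (Abs_fps (dynkin_sum x y))) m n"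
    using incidence_total_Exp[OF incidence_graded_dynkin[OF assms(1,2)] _ assms(3)] by simp
  also have "\<dots> = (\<Sum>p\<in>{n..m}. incidence_total (fps_Exp (fps_tvar x)) m p * incidence_total (fps_Exp (fps_tvar y)) p n)"
    unfolding fps_Exp_dynkin
    by (intro incidence_total_mult incidence_graded_Exp incidence_total_tvar assms fps_tvar_0)
  also have "\<dots> = (\<Sum>p\<in>{n..m}. incidence_Exp x m p * incidence_Exp y p n)"
    by (simp add: incidence_total_Exp[OF incidence_total_tvar(1)[OF assms(1)] fps_tvar_0 incidence_total_tvar(2)[OF assms(1)]]
        incidence_total_Exp[OF incidence_total_tvar(1)[OF assms(2)] fps_tvar_0 incidence_total_tvar(2)[OF assms(2)]])
  finally show ?thesis .
qed

section \<open>The graded Lie algebra inside the incidence algebra\<close>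

lemma lat_pos_iff: "n \<in> lat_pos \<longleftrightarrow> 0 \<le> n \<and> n \<noteq> 0"
  by (auto simp: lat_pos_def less_eq_vec_def)

lemma lat_pos_add: "m \<in> lat_pos \<Longrightarrow> n \<in> lat_pos \<Longrightarrow> m + n \<in> lat_pos"
  by (auto simp: lat_pos_def vec_eq_iff add_nonneg_eq_0_iff)

lemma deg_pos: 
  assumes "n \<in> lat_pos" shows "0 < deg n"
proof -
  obtain i where "n $ i \<noteq> 0" using assms by (auto simp: lat_pos_def vec_eq_iff)
  moreover have "\<And>i. 0 \<le> n $ i" using assms by (simp add: lat_pos_def)
  ultimately show ?thesis
    unfolding deg_def by (metis finite_class.finite_UNIV UNIV_I less_le sum_pos2)
qed

lemma form_add_left: "form b (m + n) p = form b m p + form b n p"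
  by (simp add: form_def algebra_simps sum.distrib)

lemma form_add_right: "form b p (m + n) = form b p m + form b p n"
  by (simp add: form_def algebra_simps sum.distrib)

lemma form_diff_left: "form b (m - n) p = form b m p - form b n p"
  by (simp add: form_def algebra_simps sum_subtractf)

lemma form_diff_right: "form b p (m - n) = form b p m - form b p n"
  by (simp add: form_def algebra_simps sum_subtractf)

lemma form_skew: 
  assumes "skew_matrix b" shows "form b n m = - form b m n"
proof -
  have skew: "b i j = - b j i" for i j
    using assms unfolding skew_matrix_def by blast
  have "form b n m = (\<Sum>i\<in>UNIV. \<Sum>j\<in>UNIV. n $ i * m $ j * - b j i)"
    unfolding form_def by (intro sum.cong refl arg_cong2[where f = "(*)"] skew)
  also have "\<dots> = (\<Sum>j\<in>UNIV. \<Sum>i\<in>UNIV. n $ i * m $ j * - b j i)"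
    by (rule sum.swap)
  also have "\<dots> = - form b m n"
    by (simp add: form_def sum_negf mult.commute)
  finally show ?thesis .
qed

lemma form_self: "skew_matrix b \<Longrightarrow> form b n n = 0"
  using form_skew[of b n n] by simp

lemma form_scale_left: "form b (c *s m) n = c * form b m n"
  by (simp add: form_def sum_distrib_left mult.assoc)

lemma form_scale_right: "form b m (c *s n) = c * form b m n"
  by (simp add: form_def sum_distrib_left algebra_simps)

lemma finite_lat_pos_diff: "finite {a. a \<in> lat_pos \<and> n - a \<in> lat_pos}"
  by (rule finite_subset[OF _ finite_vec_interval[of 0 n]]) (auto simp: lat_pos_def less_eq_vec_def)

lemma lie_carrier_zero: "f \<in> lie_carrier \<Longrightarrow> n \<notin> lat_pos \<Longrightarrow> f n = 0"
  by (simp add: lie_carrier_def)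

lemma lie_bracket_carrier: "lie_bracket b f g \<in> lie_carrier"
  unfolding lie_carrier_def lie_bracket_def
proof (safe)
  fix n :: "int ^ 'a" assume n: "n \<notin> lat_pos"
  then have "{a. a \<in> lat_pos \<and> n - a \<in> lat_pos} = {}"
    using lat_pos_add by fastforce
  then show "(\<Sum>a | a \<in> lat_pos \<and> n - a \<in> lat_pos. - of_int (form b a (n - a)) * f a * g (n - a)) = 0"
    by (simp only: sum.empty)
qed

lemma lie_word_carrier: "set ws \<subseteq> lie_carrier \<Longrightarrow> lie_word b ws \<in> lie_carrier"
  by (cases "(b, ws)" rule: lie_word.cases) (auto simp: lie_bracket_carrier, simp add: lie_carrier_def)

lemma bch_eq:
  "bch b x y n = (\<Sum>ps | ps \<noteq> [] \<and> (0, 0) \<notin> set ps \<and> int (dynkin_size ps) \<le> deg n.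
     of_real (dynkin_coeff ps) * lie_word b (dynkin_word x y ps) n)"
proof -
  have "of_real (dynkin_fact ps) = (\<Prod>(r, s)\<leftarrow>ps. fact r * fact s :: complex)" for ps
    by (induction ps) (auto simp: dynkin_fact_def)
  then show ?thesis
    unfolding bch_def dynkin_size_def[symmetric] dynkin_word_def[symmetric]
    by (simp add: dynkin_coeff_def)
qed

lemma bch_carrier: 
  assumes "x \<in> lie_carrier" "y \<in> lie_carrier" shows "bch b x y \<in> lie_carrier"
proof -
  have "lie_word b (dynkin_word x y ps) n = 0" if "n \<notin> lat_pos" for ps n
    using lie_word_carrier[of "dynkin_word x y ps" b] set_dynkin_word[of x y ps] assms that
    by (auto intro!: lie_carrier_zero)
  then show ?thesis by (simp add: lie_carrier_def bch_eq)
qed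

text \<open>
  The monomial $z^a$ acts by $v_n \mapsto (\deg a - \{a, n\}) \, v_{n + a}$.  The degree term keeps the
  representation faithful when the form is degenerate.
\<close>

lift_definition incidence_rep :: "('n::finite \<Rightarrow> 'n \<Rightarrow> int) \<Rightarrow> 'n series \<Rightarrow> 'n incidence" is
  "\<lambda>b f m n. if n \<le> m then f (m - n) * of_int (deg (m - n) - form b (m - n) n) else 0"
  by simp

lemma incidence_rep_order:
  assumes "f \<in> lie_carrier" shows "incidence_order 1 (incidence_rep b f)"
  unfolding incidence_order_def
proof (intro allI impI)
  fix m n assume "Rep_incidence (incidence_rep b f) m n \<noteq> 0"
  then have "f (m - n) \<noteq> 0" by (auto simp: incidence_rep.rep_eq split: if_splits)
  then have "m - n \<in> lat_pos" using assms lie_carrier_zero by blast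
  then show "int 1 \<le> deg m - deg n" using deg_pos[of "m - n"] by (simp add: deg_diff)
qed

lemma incidence_rep_inj:
  assumes "f \<in> lie_carrier" "g \<in> lie_carrier" "incidence_rep b f = incidence_rep b g"
  shows "f = g"
proof
  fix n
  show "f n = g n"
  proof (cases "n \<in> lat_pos")
    case True
    have "form b n 0 = 0" by (simp add: form_def)
    \<comment> \<open>In column 0 the form vanishes, and the degree term leaves the nonzero factor
      deg n.\<close>
    then have "f n * of_int (deg n) = g n * of_int (deg n)"
      using arg_cong[OF assms(3), of "\<lambda>K. Rep_incidence K n 0"] True
      by (simp add: incidence_rep.rep_eq lat_pos_iff)
    then show ?thesis using deg_pos[OF True] by simp
  next
    case False
    then show ?thesis using assms by (simp add: lie_carrier_def)
  qed
qed

lemma incidence_rep_mult: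
  assumes "f \<in> lie_carrier" "g \<in> lie_carrier" "n \<le> m"
  shows "Rep_incidence (incidence_rep b f * incidence_rep b g) m n =
    (\<Sum>a | a \<in> lat_pos \<and> (m - n) - a \<in> lat_pos.
       f a * g (m - n - a) * of_int ((deg a - form b a (m - a)) * (deg (m - n - a) - form b (m - n - a) n)))"
    (is "?l = sum ?h ?A")
proof -
  let ?g = "\<lambda>p. Rep_incidence (incidence_rep b f) m p * Rep_incidence (incidence_rep b g) p n"
  have "?l = (\<Sum>p\<in>{n..m}. ?g p)"
    by (simp add: times_incidence.rep_eq)
  also have "\<dots> = (\<Sum>p\<in>(\<lambda>a. m - a) ` ?A. ?g p)"
  proof (rule sum.mono_neutral_right[OF finite_vec_interval])
    show "(\<lambda>a. m - a) ` ?A \<subseteq> {n..m}"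
      by (auto simp: lat_pos_def less_eq_vec_def algebra_simps)
    show "\<forall>p\<in>{n..m} - (\<lambda>a. m - a) ` ?A. ?g p = 0"
    proof
      fix p assume p: "p \<in> {n..m} - (\<lambda>a. m - a) ` ?A"
      have "m - p \<notin> ?A"
      proof
        assume "m - p \<in> ?A"
        then have "m - (m - p) \<in> (\<lambda>a. m - a) ` ?A" by (rule imageI)
        with p show False by simp
      qed
      then have "m - p \<notin> lat_pos \<or> p - n \<notin> lat_pos" by simp
      then show "?g p = 0"
        using assms by (auto simp: incidence_rep.rep_eq lie_carrier_zero)
    qed
  qed
  also have "\<dots> = (\<Sum>a\<in>?A. ?g (m - a))"
    by (subst sum.reindex) (auto intro: inj_onI)
  also have "\<dots> = sum ?h ?A"
  proof (rule sum.cong[OF refl])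
    fix a assume "a \<in> ?A"
    then have "m - a \<le> m" "n \<le> m - a"
      by (auto simp: lat_pos_def less_eq_vec_def algebra_simps)
    moreover have eq: "m - a - n = m - n - a" by simp
    ultimately show "?g (m - a) = ?h a"
      by (simp add: incidence_rep.rep_eq eq mult_ac del: of_int_diff)
  qed
  finally show ?thesis .
qed

lemma incidence_rep_bracket:
  assumes "skew_matrix b" "f \<in> lie_carrier" "g \<in> lie_carrier"
  shows "incidence_rep b (lie_bracket b f g) = ring_ad (incidence_rep b f) (incidence_rep b g)"
proof (rule incidence_eqI)
  fix m n
  show "Rep_incidence (incidence_rep b (lie_bracket b f g)) m n =
      Rep_incidence (ring_ad (incidence_rep b f) (incidence_rep b g)) m n"
  proof (cases "n \<le> m")
    case True
    let ?A = "{a. a \<in> lat_pos \<and> (m - n) - a \<in> lat_pos}"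
    have "Rep_incidence (incidence_rep b g * incidence_rep b f) m n = (\<Sum>a\<in>?A.
       f a * g (m - n - a) * of_int ((deg (m - n - a) - form b (m - n - a) (n + a)) * (deg a - form b a n)))"
      unfolding incidence_rep_mult[OF assms(3,2) True]
      by (rule sum.reindex_bij_witness[of _ "\<lambda>a. m - n - a" "\<lambda>a. m - n - a"]) (auto simp: algebra_simps)
    then have "Rep_incidence (ring_ad (incidence_rep b f) (incidence_rep b g)) m n =
      (\<Sum>a\<in>?A. f a * g (m - n - a) * of_int ((deg a - form b a (m - a)) * (deg (m - n - a) - form b (m - n - a) n)
        - (deg (m - n - a) - form b (m - n - a) (n + a)) * (deg a - form b a n)))"
      unfolding ring_ad_def minus_incidence.rep_eq incidence_rep_mult[OF assms(2,3) True]
      by (simp only: sum_subtractf[symmetric] of_int_diff right_diff_distrib)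
    also have "\<dots> = (\<Sum>a\<in>?A. (- of_int (form b a (m - n - a)) * f a * g (m - n - a)) * of_int (deg (m - n) - form b (m - n) n))"
    proof (rule sum.cong[OF refl])
      fix a
      define c where "c = m - n - a"
      have m: "m = n + a + c" by (simp add: c_def)
      \<comment> \<open>With A = deg a - {a, n} and C = deg c - {c, n} the difference is (A - {a,
        c}) C - (C - {c, a}) A = - {a, c} (A + C) by skew-symmetry, and A + C is the factor
        belonging to z^(a+c).\<close>
      have "form b c a = - form b a c" "form b a a = 0" 
        by (rule form_skew[OF assms(1)], rule form_self[OF assms(1)])
      then have "(deg a - form b a (m - a)) * (deg c - form b c n) - (deg c - form b c (n + a)) * (deg a - form b a n)
          = - form b a c * (deg (m - n) - form b (m - n) n)"
        unfolding m by (simp add: form_add_left form_add_right form_diff_left form_diff_right deg_add deg_diff algebra_simps)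
      then show "f a * g (m - n - a) * of_int ((deg a - form b a (m - a)) * (deg (m - n - a) - form b (m - n - a) n)
        - (deg (m - n - a) - form b (m - n - a) (n + a)) * (deg a - form b a n)) = 
        (- of_int (form b a (m - n - a)) * f a * g (m - n - a)) * of_int (deg (m - n) - form b (m - n) n)"
        unfolding c_def[symmetric] by (simp del: of_int_diff of_int_mult) (simp add: algebra_simps)
    qed
    also have "\<dots> = Rep_incidence (incidence_rep b (lie_bracket b f g)) m n"
      using True by (simp add: incidence_rep.rep_eq lie_bracket_def sum_distrib_right del: of_int_diff)
    finally show ?thesis ..
  next
    case False
    then show ?thesis by (metis incidence_nonzero)
  qed
qed

lemma incidence_rep_word:
  assumes "skew_matrix b" "set ws \<subseteq> lie_carrier"
  shows "incidence_rep b (lie_word b ws) = comm_word (map (incidence_rep b) ws)"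
  using assms(2)
proof (induction ws rule: induct_list012)
  case 1
  show ?case by (rule incidence_eqI) (simp add: incidence_rep.rep_eq zero_incidence.rep_eq)
next
  case (3 x y ws)
  then show ?case
    using incidence_rep_bracket[OF assms(1)] lie_word_carrier[of "y # ws" b] by simp
qed simp

lemma map_dynkin_word: "map h (dynkin_word x y ps) = dynkin_word (h x) (h y) ps"
proof (induction ps)
  case (Cons p ps)
  then show ?case by (cases p) simp
qed simp

text \<open>At the entry (m, n) both the value at t = 1 and the definition of \<open>bch\<close>
  stop at words of deg (m - n) letters, and the representation maps word to word.\<close>

lemma incidence_rep_bch:
  assumes "skew_matrix b" "f \<in> lie_carrier" "g \<in> lie_carrier"
  shows "incidence_total (Abs_fps (dynkin_sum (incidence_rep b f) (incidence_rep b g))) m n =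
    Rep_incidence (incidence_rep b (bch b f g)) m n"
proof (cases "n \<le> m")
  case True
  let ?d = "nat (deg m - deg n)"
  let ?P = "\<lambda>l. {ps. ps \<noteq> [] \<and> (0, 0) \<notin> set ps \<and> dynkin_size ps = l}"
  let ?w = "\<lambda>ps. of_real (dynkin_coeff ps) * Rep_incidence (comm_word (dynkin_word (incidence_rep b f) (incidence_rep b g) ps)) m n"
  have fin: "finite (?P l)" for l
    by (rule finite_subset[OF _ finite_dynkin_lists_le[of l]]) auto
  have "incidence_total (Abs_fps (dynkin_sum (incidence_rep b f) (incidence_rep b g))) m n =
      (\<Sum>l\<le>?d. \<Sum>ps\<in>?P l. ?w ps)"
    by (simp add: incidence_total_def dynkin_sum_def Rep_incidence_sum scaleR_incidence.rep_eq
        scaleR_conv_of_real[where 'a = complex])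
  also have "\<dots> = (\<Sum>ps\<in>(\<Union>l\<le>?d. ?P l). ?w ps)"
    by (subst sum.UNION_disjoint) (auto simp: fin)
  also have "(\<Union>l\<le>?d. ?P l) = {ps. ps \<noteq> [] \<and> (0, 0) \<notin> set ps \<and> int (dynkin_size ps) \<le> deg (m - n)}"
    using deg_mono[OF True] by (auto simp: deg_diff le_nat_iff)
  also have "(\<Sum>ps\<in>\<dots>. ?w ps) = Rep_incidence (incidence_rep b (bch b f g)) m n"
  proof -
    have "Rep_incidence (comm_word (dynkin_word (incidence_rep b f) (incidence_rep b g) ps)) m n =
        lie_word b (dynkin_word f g ps) (m - n) * of_int (deg (m - n) - form b (m - n) n)" for ps
    proof -
      have "set (dynkin_word f g ps) \<subseteq> lie_carrier"
        using set_dynkin_word[of f g ps] assms by auto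
      then show ?thesis
        using incidence_rep_word[OF assms(1), of "dynkin_word f g ps", symmetric] True
        by (simp add: map_dynkin_word incidence_rep.rep_eq)
    qed
    then show ?thesis
      using True by (simp add: incidence_rep.rep_eq bch_eq sum_distrib_right mult.assoc del: of_int_diff)
  qed
  finally show ?thesis .
next
  case False
  then have "Rep_incidence K m n = 0" for K using incidence_nonzero by blast
  then show ?thesis by (simp add: incidence_total_def)
qed

text \<open>The map from f to the exponential of its matrix is injective and, by \<open>hom\<close>,
  turns \<open>bch\<close> into matrix multiplication; associativity is pulled back along
  it.\<close>

theorem bch_assoc:
  assumes b: "skew_matrix b" and "x \<in> lie_carrier" "y \<in> lie_carrier" "z \<in> lie_carrier"
  shows "bch b (bch b x y) z = bch b x (bch b y z)"
proof -
  let ?E = "\<lambda>f. incidence_Exp (incidence_rep b f)"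
  have hom: "?E (bch b f g) m n = (\<Sum>p\<in>{n..m}. ?E f m p * ?E g p n)"
    if "f \<in> lie_carrier" "g \<in> lie_carrier" for f g m n
    using incidence_Exp_dynkin[OF incidence_rep_order[OF that(1)] incidence_rep_order[OF that(2)]
      incidence_rep_bch[OF b that]] .
  have "?E (bch b (bch b x y) z) m n = ?E (bch b x (bch b y z)) m n" for m n
  proof -
    have "?E (bch b (bch b x y) z) m n = (\<Sum>p\<in>{n..m}. \<Sum>q\<in>{p..m}. ?E x m q * ?E y q p * ?E z p n)"
      using assms by (simp add: hom bch_carrier sum_distrib_right)
    also have "\<dots> = (\<Sum>(p, q)\<in>Sigma {n..m} (\<lambda>p. {p..m}). ?E x m q * ?E y q p * ?E z p n)"
      by (rule sum.Sigma) (auto simp: finite_vec_interval)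
    also have "\<dots> = (\<Sum>(q, p)\<in>Sigma {n..m} (\<lambda>q. {n..q}). ?E x m q * ?E y q p * ?E z p n)"
      by (rule sum.reindex_bij_witness[of _ "\<lambda>(q, p). (p, q)" "\<lambda>(p, q). (q, p)"]) (auto intro: order_trans)
    also have "\<dots> = (\<Sum>q\<in>{n..m}. \<Sum>p\<in>{n..q}. ?E x m q * ?E y q p * ?E z p n)"
      by (rule sum.Sigma[symmetric]) (auto simp: finite_vec_interval)
    also have "\<dots> = ?E (bch b x (bch b y z)) m n"
      using assms by (simp add: hom bch_carrier sum_distrib_left mult.assoc)
    finally show ?thesis .
  qed
  then have "?E (bch b (bch b x y) z) = ?E (bch b x (bch b y z))" by blast
  then have "incidence_rep b (bch b (bch b x y) z) = incidence_rep b (bch b x (bch b y z))"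
    using assms by (intro incidence_Exp_inj incidence_rep_order bch_carrier)
  then show ?thesis
    using assms by (intro incidence_rep_inj[of _ _ b] bch_carrier)
qed

section \<open>Agreement up to a degree and leading terms of the product\<close>

definition agree_below :: "int \<Rightarrow> 'n::finite series \<Rightarrow> 'n series \<Rightarrow> bool" where
  "agree_below d f g \<longleftrightarrow> (\<forall>n. deg n < d \<longrightarrow> f n = g n)"

lemma agree_below_mono: "agree_below d f g \<Longrightarrow> d' \<le> d \<Longrightarrow> agree_below d' f g"
  by (auto simp: agree_below_def)

lemma agree_below_refl [simp]: "agree_below d f f"
  by (simp add: agree_below_def)

text \<open>Both factors of a bracket have positive degree, so each coefficient of the result sees
  its arguments only in strictly smaller degree. This gain of one degree drives the later
  induction.\<close>

lemma lie_bracket_agree: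
  assumes "agree_below d f f'" "agree_below d g g'"
  shows "agree_below (d + 1) (lie_bracket b f g) (lie_bracket b f' g')"
  unfolding agree_below_def lie_bracket_def
proof (intro allI impI sum.cong refl)
  fix n a :: "int ^ 'a" assume "deg n < d + 1" and a: "a \<in> {a. a \<in> lat_pos \<and> n - a \<in> lat_pos}"
  then have "deg a < d" "deg (n - a) < d"
    using deg_pos[of a] deg_pos[of "n - a"] by (auto simp: deg_diff)
  then show "- of_int (form b a (n - a)) * f a * g (n - a) = - of_int (form b a (n - a)) * f' a * g' (n - a)"
    using assms by (simp add: agree_below_def)
qed

lemma lie_word_agree:
  assumes "list_all2 (agree_below d) ws ws'"
  shows "agree_below d (lie_word b ws) (lie_word b ws')"
    and "length ws \<ge> 2 \<Longrightarrow> agree_below (d + 1) (lie_word b ws) (lie_word b ws')"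
proof -
  have "agree_below d (lie_word b ws) (lie_word b ws') \<and>
      (length ws \<ge> 2 \<longrightarrow> agree_below (d + 1) (lie_word b ws) (lie_word b ws'))"
    using assms
  proof (induction ws arbitrary: ws' rule: induct_list012)
    case (3 x y ws)
    then obtain x' y' vs where ws': "ws' = x' # y' # vs" "agree_below d x x'"
      "list_all2 (agree_below d) (y # ws) (y' # vs)"
      by (auto simp: list_all2_Cons1)
    have "agree_below (d + 1) (lie_word b (x # y # ws)) (lie_word b ws')"
      using lie_bracket_agree[OF ws'(2)] 3(2)[OF ws'(3)] by (simp add: ws'(1))
    then show ?case using agree_below_mono[of "d + 1" _ _ d] by auto
  qed (auto simp: list_all2_Cons1)
  then show "agree_below d (lie_word b ws) (lie_word b ws')"
    "length ws \<ge> 2 \<Longrightarrow> agree_below (d + 1) (lie_word b ws) (lie_word b ws')" by auto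
qed

text \<open>The terms of Dynkin's series with at least two letters; the one-letter words give the
  linear part x + y.\<close>

definition bch_rest :: "('n::finite \<Rightarrow> 'n \<Rightarrow> int) \<Rightarrow> 'n series \<Rightarrow> 'n series \<Rightarrow> 'n series" where
  "bch_rest b x y n = (\<Sum>ps | ps \<noteq> [] \<and> (0, 0) \<notin> set ps \<and> dynkin_size ps \<ge> 2 \<and> int (dynkin_size ps) \<le> deg n.
     of_real (dynkin_coeff ps) * lie_word b (dynkin_word x y ps) n)"

lemma bch_eq_rest:
  assumes "x \<in> lie_carrier" "y \<in> lie_carrier"
  shows "bch b x y n = x n + y n + bch_rest b x y n"
proof (cases "deg n \<ge> 1")
  case True
  let ?A = "{ps :: (nat \<times> nat) list. ps \<noteq> [] \<and> (0, 0) \<notin> set ps \<and> int (dynkin_size ps) \<le> deg n}"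
  let ?B = "{ps :: (nat \<times> nat) list. ps \<noteq> [] \<and> (0, 0) \<notin> set ps \<and> dynkin_size ps \<ge> 2 \<and> int (dynkin_size ps) \<le> deg n}"
  have fin: "finite ?B"
    by (rule finite_subset[OF _ finite_dynkin_lists_le[of "nat (deg n)"]]) auto
  have "?A = insert [(1, 0)] (insert [(0, 1)] ?B)"
  proof (intro equalityI subsetI)
    fix ps assume ps: "ps \<in> ?A"
    show "ps \<in> insert [(1, 0)] (insert [(0, 1)] ?B)"
    proof (cases "dynkin_size ps \<ge> 2")
      case False
      moreover have "length ps \<le> dynkin_size ps" "length ps \<noteq> 0"
        using ps length_le_dynkin_size[of ps] by auto
      ultimately have "length ps = 1" by linarith
      then obtain r s where "ps = [(r, s)]" by (metis One_nat_def length_0_conv length_Suc_conv surj_pair)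
      then show ?thesis using ps False by auto
    qed (use ps in auto)
  qed (use True in auto)
  then show ?thesis
    unfolding bch_eq bch_rest_def using fin by (simp add: dynkin_coeff_def add.assoc)
next
  case False
  then have "n \<notin> lat_pos" using deg_pos by fastforce
  moreover have "bch_rest b x y n = 0"
    unfolding bch_rest_def using False by (intro sum.neutral) auto
  ultimately show ?thesis
    using assms bch_carrier[OF assms, of b] by (simp add: lie_carrier_zero)
qed

lemma list_all2_dynkin_word:
  "R x x' \<Longrightarrow> R y y' \<Longrightarrow> list_all2 R (dynkin_word x y ps) (dynkin_word x' y' ps)"
proof (induction ps)
  case (Cons p ps)
  have "R v v' \<Longrightarrow> list_all2 R (replicate k v) (replicate k v')" for k v v'
    by (induction k) auto
  with Cons show ?case
    by (cases p) (auto intro!: list_all2_appendI)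
qed simp

lemma bch_rest_agree:
  assumes "agree_below d x x'" "agree_below d y y'" "deg n \<le> d"
  shows "bch_rest b x y n = bch_rest b x' y' n"
  unfolding bch_rest_def
proof (intro sum.cong refl arg_cong2[where f = "(*)"])
  fix ps :: "(nat \<times> nat) list" assume "ps \<in> {ps. ps \<noteq> [] \<and> (0, 0) \<notin> set ps \<and> 2 \<le> dynkin_size ps \<and> int (dynkin_size ps) \<le> deg n}"
  then have "agree_below (d + 1) (lie_word b (dynkin_word x y ps)) (lie_word b (dynkin_word x' y' ps))"
    using assms by (intro lie_word_agree(2) list_all2_dynkin_word) (auto simp: length_dynkin_word)
  then show "lie_word b (dynkin_word x y ps) n = lie_word b (dynkin_word x' y' ps) n"
    using assms(3) by (simp add: agree_below_def)
qed

text \<open>Terms with at least two letters gain a degree over their arguments, so a change of x or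
  y that starts in degree d enters degree d only linearly.\<close>

lemma bch_top_degree:
  assumes "x \<in> lie_carrier" "y \<in> lie_carrier" "x' \<in> lie_carrier" "y' \<in> lie_carrier"
    and "agree_below d x x'" "agree_below d y y'" "deg n \<le> d"
  shows "bch b x y n - bch b x' y' n = (x n - x' n) + (y n - y' n)"
  using assms bch_rest_agree[OF assms(5-7), of b] by (simp add: bch_eq_rest)

lemma bch_agree:
  assumes "x \<in> lie_carrier" "y \<in> lie_carrier" "x' \<in> lie_carrier" "y' \<in> lie_carrier"
    and "agree_below d x x'" "agree_below d y y'"
  shows "agree_below d (bch b x y) (bch b x' y')"
  unfolding agree_below_def
proof (intro allI impI)
  fix n :: "int ^ 'a" assume "deg n < d"
  then show "bch b x y n = bch b x' y' n"
    using bch_top_degree[OF assms, of n b] assms(5,6) by (simp add: agree_below_def)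
qed

section \<open>Commuting factors and the group structure\<close>

lemma lie_bracket_swap:
  assumes "skew_matrix b" shows "lie_bracket b g f n = - lie_bracket b f g n"
proof -
  have "lie_bracket b g f n = (\<Sum>a | a \<in> lat_pos \<and> n - a \<in> lat_pos. - of_int (form b (n - a) a) * g (n - a) * f a)"
    unfolding lie_bracket_def
    by (rule sum.reindex_bij_witness[of _ "\<lambda>a. n - a" "\<lambda>a. n - a"]) auto
  also have "\<dots> = (\<Sum>a | a \<in> lat_pos \<and> n - a \<in> lat_pos. - (- of_int (form b a (n - a)) * f a * g (n - a)))"
    by (rule sum.cong[OF refl], subst form_skew[OF assms]) simp
  finally show ?thesis by (simp add: lie_bracket_def sum_negf)
qed

lemma lie_bracket_self: "skew_matrix b \<Longrightarrow> lie_bracket b f f = (\<lambda>n. 0)"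
  using lie_bracket_swap[of b f f] by (simp add: fun_eq_iff)

lemma lie_bracket_zero_right: "lie_bracket b f (\<lambda>n. 0) = (\<lambda>n. 0)"
  by (simp add: lie_bracket_def)

text \<open>The innermost bracket involves two letters from {x, y} and vanishes, and the outer
  brackets vanish with it.\<close>

lemma lie_word_commuting:
  assumes "skew_matrix b" "lie_bracket b x y = (\<lambda>n. 0)" "set ws \<subseteq> {x, y}" "length ws \<ge> 2"
  shows "lie_word b ws = (\<lambda>n. 0)"
  using assms(3,4)
proof (induction ws rule: induct_list012)
  case (3 v w ws)
  show ?case
  proof (cases ws)
    case Nil
    have "lie_bracket b y x = (\<lambda>n. 0)"
      using lie_bracket_swap[OF assms(1), of y x] assms(2) by (simp add: fun_eq_iff)
    then show ?thesis using 3 Nil assms lie_bracket_self[OF assms(1)] by auto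
  next
    case (Cons u us)
    then show ?thesis using 3 by (simp add: lie_bracket_zero_right)
  qed
qed auto

lemma bch_commuting:
  assumes "skew_matrix b" "x \<in> lie_carrier" "y \<in> lie_carrier" "lie_bracket b x y = (\<lambda>n. 0)"
  shows "bch b x y = (\<lambda>n. x n + y n)"
proof
  fix n
  have "bch_rest b x y n = 0"
    unfolding bch_rest_def
  proof (rule sum.neutral, rule ballI)
    fix ps :: "(nat \<times> nat) list" assume "ps \<in> {ps. ps \<noteq> [] \<and> (0, 0) \<notin> set ps \<and> 2 \<le> dynkin_size ps \<and> int (dynkin_size ps) \<le> deg n}"
    then have "lie_word b (dynkin_word x y ps) = (\<lambda>n. 0)"
      using lie_word_commuting[OF assms(1,4) set_dynkin_word] by (simp add: length_dynkin_word)
    then show "of_real (dynkin_coeff ps) * lie_word b (dynkin_word x y ps) n = 0" by simp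
  qed
  then show "bch b x y n = x n + y n"
    using bch_eq_rest[OF assms(2,3)] by simp
qed

lemma lie_carrier_0 [simp]: "(\<lambda>n. 0) \<in> lie_carrier"
  by (simp add: lie_carrier_def)

lemma lie_carrier_add: "x \<in> lie_carrier \<Longrightarrow> y \<in> lie_carrier \<Longrightarrow> (\<lambda>n. x n + y n) \<in> lie_carrier"
  by (simp add: lie_carrier_def)

lemma lie_carrier_uminus: "x \<in> lie_carrier \<Longrightarrow> (\<lambda>n. - x n) \<in> lie_carrier"
  by (simp add: lie_carrier_def)

lemma lie_carrier_sum: "(\<And>a. a \<in> A \<Longrightarrow> f a \<in> lie_carrier) \<Longrightarrow> (\<lambda>n. \<Sum>a\<in>A. f a n) \<in> lie_carrier"
  by (simp add: lie_carrier_def)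

lemma bch_0_left: "skew_matrix b \<Longrightarrow> x \<in> lie_carrier \<Longrightarrow> bch b (\<lambda>n. 0) x = x"
  by (subst bch_commuting) (auto simp: lie_bracket_def)

lemma lie_bracket_uminus_left: "lie_bracket b (\<lambda>n. - x n) y n = - lie_bracket b x y n"
  by (simp add: lie_bracket_def flip: sum_negf)

lemma bch_uminus_left: "skew_matrix b \<Longrightarrow> x \<in> lie_carrier \<Longrightarrow> bch b (\<lambda>n. - x n) x = (\<lambda>n. 0)"
  by (subst bch_commuting)
     (auto simp: lie_carrier_uminus lie_bracket_uminus_left lie_bracket_self fun_eq_iff)

lemma group_scat_group:
  assumes "skew_matrix b" shows "group (scat_group b)"
proof (rule groupI)
  fix x assume "x \<in> carrier (scat_group b)"
  then show "\<exists>y\<in>carrier (scat_group b). y \<otimes>\<^bsub>scat_group b\<^esub> x = \<one>\<^bsub>scat_group b\<^esub>"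
    by (intro bexI[of _ "\<lambda>n. - x n"])
       (simp_all add: scat_group_def lie_carrier_uminus bch_uminus_left[OF assms])
qed (simp_all add: scat_group_def bch_carrier bch_assoc[OF assms] bch_0_left[OF assms])

text \<open>The inverse of exp(f) is exp(-f), so a crossing sign acts as a scalar on the
  logarithm.\<close>

lemma scat_group_int_pow:
  assumes "skew_matrix b" "x \<in> lie_carrier"
  shows "x [^]\<^bsub>scat_group b\<^esub> (1 :: int) = x"
    and "x [^]\<^bsub>scat_group b\<^esub> (- 1 :: int) = (\<lambda>n. - x n)"
proof -
  interpret group "scat_group b" by (rule group_scat_group[OF assms(1)])
  have x: "x \<in> carrier (scat_group b)" using assms(2) by (simp add: scat_group_def)
  then show "x [^]\<^bsub>scat_group b\<^esub> (1 :: int) = x"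
    by (simp add: int_pow_1)
  have "inv\<^bsub>scat_group b\<^esub> x = (\<lambda>n. - x n)"
    by (rule inv_equality)
       (simp_all add: scat_group_def assms lie_carrier_uminus bch_uminus_left[OF assms(1)])
  then show "x [^]\<^bsub>scat_group b\<^esub> (- 1 :: int) = (\<lambda>n. - x n)"
    using x int_pow_neg[of x 1] by (simp add: int_pow_1)
qed

lemma par_group_carrier:
  "f \<in> carrier (par_group b n0) \<longleftrightarrow>
    f \<in> lie_carrier \<and> (\<forall>n. f n \<noteq> 0 \<longrightarrow> (\<exists>k::nat. 1 \<le> k \<and> n = of_nat k *s n0))"
  by (auto simp: par_group_def)

lemma lie_bracket_parallel:
  assumes "skew_matrix b"
    and "\<And>n. f n \<noteq> 0 \<Longrightarrow> \<exists>k::int. n = k *s n0" "\<And>n. g n \<noteq> 0 \<Longrightarrow> \<exists>k::int. n = k *s n0"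
  shows "lie_bracket b f g = (\<lambda>n. 0)"
proof
  fix n
  have "of_int (form b a (n - a)) * f a * g (n - a) = (0 :: complex)" for a
  proof (rule ccontr)
    assume "of_int (form b a (n - a)) * f a * g (n - a) \<noteq> (0 :: complex)"
    then obtain k l where "a = k *s n0" "n - a = l *s n0" and "form b a (n - a) \<noteq> 0"
      using assms(2,3) by fastforce
    then show False by (simp add: form_scale_left form_scale_right form_self[OF assms(1)])
  qed
  then show "lie_bracket b f g n = 0"
    unfolding lie_bracket_def by (intro sum.neutral) auto
qed

lemma bch_par_group:
  assumes "skew_matrix b" "f \<in> carrier (par_group b n0)" "g \<in> carrier (par_group b n0)"
  shows "bch b f g = (\<lambda>n. f n + g n)"
  using assms by (intro bch_commuting lie_bracket_parallel[of b _ n0]) (auto simp: par_group_carrier)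

lemma par_group_add:
  "f \<in> carrier (par_group b n0) \<Longrightarrow> g \<in> carrier (par_group b n0) \<Longrightarrow>
    (\<lambda>n. f n + g n) \<in> carrier (par_group b n0)"
  unfolding par_group_carrier using lie_carrier_add by (metis add.right_neutral)

lemma par_group_0: "(\<lambda>n. 0) \<in> carrier (par_group b n0)"
  by (simp add: par_group_carrier)

lemma comm_monoid_par_group:
  assumes "skew_matrix b" shows "comm_monoid (par_group b n0)"
proof -
  have ops: "x \<otimes>\<^bsub>par_group b n0\<^esub> y = bch b x y" "\<one>\<^bsub>par_group b n0\<^esub> = (\<lambda>n. 0)" for x y
    by (simp_all add: par_group_def scat_group_def)
  show ?thesis
    by (rule comm_monoidI)
       (simp_all add: ops bch_par_group[OF assms, where ?n0.0 = n0] par_group_add par_group_0 add_ac)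
qed

text \<open>In an abelian subgroup the product of exponentials is the exponential of the sum. From
  here on local products are handled as sums of coefficients.\<close>

lemma finprod_par_group:
  assumes "skew_matrix b" "finite A" "\<And>a. a \<in> A \<Longrightarrow> f a \<in> carrier (par_group b n0)"
  shows "finprod (par_group b n0) f A = (\<lambda>n. \<Sum>a\<in>A. f a n)"
    and "(\<lambda>n. \<Sum>a\<in>A. f a n) \<in> carrier (par_group b n0)"
proof -
  interpret comm_monoid "par_group b n0" by (rule comm_monoid_par_group[OF assms(1)])
  have ops: "x \<otimes>\<^bsub>par_group b n0\<^esub> y = bch b x y" "\<one>\<^bsub>par_group b n0\<^esub> = (\<lambda>n. 0)" for x y
    by (simp_all add: par_group_def scat_group_def)
  have "finprod (par_group b n0) f A = (\<lambda>n. \<Sum>a\<in>A. f a n) \<and> (\<lambda>n. \<Sum>a\<in>A. f a n) \<in> carrier (par_group b n0)"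
    using assms(2,3)
  proof (induction A)
    case (insert a A)
    then show ?case
      by (simp add: ops bch_par_group[OF assms(1), where ?n0.0 = n0] par_group_add)
  qed (simp add: ops par_group_0)
  then show "finprod (par_group b n0) f A = (\<lambda>n. \<Sum>a\<in>A. f a n)"
    "(\<lambda>n. \<Sum>a\<in>A. f a n) \<in> carrier (par_group b n0)" by auto
qed

section \<open>Folding\<close>

text \<open>The orbits enter as a partition of the index set into nonempty blocks, on whose pairs
  the form is constant; the type \<open>'j\<close> labels the blocks.\<close>

locale folding =
  fixes b :: "'i::finite \<Rightarrow> 'i \<Rightarrow> int" and b' :: "'j::finite \<Rightarrow> 'j \<Rightarrow> int" and orb :: "'j \<Rightarrow> 'i set"
  assumes skew_b: "skew_matrix b"
    and orb_ex1: "\<exists>!k. i \<in> orb k"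
    and orb_nonempty: "orb k \<noteq> {}"
    and form_orb: "i \<in> orb k \<Longrightarrow> j \<in> orb l \<Longrightarrow> b' k l = b i j"
begin

definition orbit_of :: "'i \<Rightarrow> 'j" where
  "orbit_of i = (THE k. i \<in> orb k)"

lemma in_orb_iff: "i \<in> orb k \<longleftrightarrow> orbit_of i = k"
  unfolding orbit_of_def using theI'[OF orb_ex1[of i]] the1_equality[OF orb_ex1[of i]] by blast

lemma sum_orb: "(\<Sum>k\<in>UNIV. \<Sum>i\<in>orb k. g k i) = (\<Sum>i\<in>UNIV. g (orbit_of i) i)"
proof -
  have "(\<Sum>k\<in>UNIV. \<Sum>i\<in>orb k. g k i) = (\<Sum>(k, i)\<in>Sigma UNIV orb. g k i)"
    by (rule sum.Sigma) auto
  also have "\<dots> = (\<Sum>i\<in>UNIV. g (orbit_of i) i)"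
    by (rule sum.reindex_bij_witness[of _ "\<lambda>i. (orbit_of i, i)" snd]) (auto simp: in_orb_iff)
  finally show ?thesis .
qed

lemma skew_b': "skew_matrix b'"
  unfolding skew_matrix_def
proof (intro allI)
  fix k l
  obtain i j where "i \<in> orb k" "j \<in> orb l" using orb_nonempty by blast
  then show "b' k l = - b' l k"
    using form_orb[of i k j l] form_orb[of j l i k] skew_b unfolding skew_matrix_def by metis
qed

lemma fold_map_add: "fold_map orb (m + n) = fold_map orb m + fold_map orb n"
  by (simp add: fold_map_def vec_eq_iff sum.distrib)

lemma fold_map_diff: "fold_map orb (m - n) = fold_map orb m - fold_map orb n"
  by (simp add: fold_map_def vec_eq_iff sum_subtractf)

lemma fold_map_scale: "fold_map orb (c *s n) = c *s fold_map orb n"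
  by (simp add: fold_map_def vec_eq_iff sum_distrib_left)

lemma fold_map_axis: "fold_map orb (axis i 1) = axis (orbit_of i) 1"
proof -
  have "(\<Sum>i'\<in>orb k. axis i 1 $ i') = (if orbit_of i = k then 1 else (0::int))" for k
    by (simp add: axis_def sum.delta in_orb_iff)
  then show ?thesis by (auto simp: fold_map_def vec_eq_iff axis_def)
qed

lemma form_fold_map: "form b' (fold_map orb m) (fold_map orb n) = form b m n"
proof -
  have "form b' (fold_map orb m) (fold_map orb n) =
      (\<Sum>k\<in>UNIV. \<Sum>l\<in>UNIV. \<Sum>i\<in>orb k. \<Sum>j\<in>orb l. m $ i * n $ j * b' k l)"
    unfolding form_def fold_map_def vec_lambda_beta sum_product unfolding sum_distrib_right ..
  also have "\<dots> = (\<Sum>k\<in>UNIV. \<Sum>i\<in>orb k. \<Sum>l\<in>UNIV. \<Sum>j\<in>orb l. m $ i * n $ j * b' k l)"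
    by (intro sum.cong refl sum.swap)
  also have "\<dots> = (\<Sum>i\<in>UNIV. \<Sum>j\<in>UNIV. m $ i * n $ j * b' (orbit_of i) (orbit_of j))"
    by (simp add: sum_orb)
  also have "\<dots> = form b m n"
    unfolding form_def by (intro sum.cong refl arg_cong2[where f = "(*)"] form_orb) (simp_all add: in_orb_iff)
  finally show ?thesis .
qed

lemma deg_fold_map: "deg (fold_map orb n) = deg n"
  by (simp add: deg_def fold_map_def sum_orb)

lemma fold_map_lat_pos:
  assumes "n \<in> lat_pos" shows "fold_map orb n \<in> lat_pos"
proof -
  have "fold_map orb n \<noteq> 0"
    using deg_pos[OF assms] deg_fold_map[of n] by auto
  then show ?thesis
    using assms by (auto simp: lat_pos_def fold_map_def intro: sum_nonneg)
qed

text \<open>One representative of each orbit carries the whole coefficient.\<close>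

lemma fold_map_surj:
  assumes "m \<in> lat_pos" obtains n where "n \<in> lat_pos" "fold_map orb n = m"
proof -
  obtain rep where rep: "\<And>k. rep k \<in> orb k" using orb_nonempty
    by (intro that[of "\<lambda>k. SOME i. i \<in> orb k"]) (simp add: some_in_eq)
  define n where "n = (\<chi> i. if i = rep (orbit_of i) then m $ orbit_of i else 0)"
  have "(\<Sum>i\<in>orb k. n $ i) = m $ k" for k
  proof -
    have "(\<Sum>i\<in>orb k. n $ i) = (\<Sum>i\<in>orb k. if i = rep k then m $ k else 0)"
      by (intro sum.cong) (auto simp: n_def in_orb_iff)
    then show ?thesis using rep[of k] by (simp add: sum.delta)
  qed
  then have q: "fold_map orb n = m" by (simp add: fold_map_def vec_eq_iff)
  have "n \<noteq> 0" using q assms fold_map_diff[of n n] by (auto simp: lat_pos_def)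
  then have "n \<in> lat_pos" using assms by (auto simp: lat_pos_def n_def)
  with q that show thesis by blast
qed

lemma fold_dual_nth: "fold_dual orb x $ i = x $ orbit_of i"
proof -
  have "pairing (axis k 1) x = x $ k" for k
    by (simp add: pairing_def axis_def if_distrib if_distribR sum.delta cong: if_cong)
  then show ?thesis by (simp add: fold_dual_def fold_map_axis)
qed

lemma pairing_fold_dual: "pairing n (fold_dual orb x) = pairing (fold_map orb n) x"
proof -
  have "pairing (fold_map orb n) x = (\<Sum>k\<in>UNIV. \<Sum>i\<in>orb k. of_int (n $ i) * x $ k)"
    by (simp add: pairing_def fold_map_def sum_distrib_right)
  also have "\<dots> = pairing n (fold_dual orb x)"
    by (simp add: sum_orb pairing_def fold_dual_nth)
  finally show ?thesis ..
qed

text \<open>\<open>fold_map\<close> preserves the degree, and the degree bounds every coordinate of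
  a nonnegative vector.\<close>

lemma finite_fold_fibre: "finite {n. n \<in> lat_pos \<and> fold_map orb n = m}"
proof (rule finite_subset[OF _ finite_vec_interval[of 0 "\<chi> i. deg m"]])
  show "{n. n \<in> lat_pos \<and> fold_map orb n = m} \<subseteq> {0..\<chi> i. deg m}"
  proof (clarsimp simp: less_eq_vec_def lat_pos_def)
    fix n :: "int ^ 'i" and i assume "\<forall>i. 0 \<le> n $ i"
    then show "n $ i \<le> deg (fold_map orb n)"
      unfolding deg_fold_map unfolding deg_def by (intro member_le_sum) auto
  qed
qed

lemma fold_group_carrier: "fold_group orb f \<in> lie_carrier"
  unfolding lie_carrier_def fold_group_def using fold_map_lat_pos by (auto intro!: sum.neutral)

lemma fold_group_sum: "fold_group orb (\<lambda>n. \<Sum>a\<in>A. f a n) = (\<lambda>m. \<Sum>a\<in>A. fold_group orb (f a) m)"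
  by (simp add: fold_group_def fun_eq_iff sum.swap[of _ A])

lemma fold_group_0: "fold_group orb (\<lambda>n. 0) = (\<lambda>m. 0)"
  by (simp add: fold_group_def)

lemma fold_group_uminus: "fold_group orb (\<lambda>n. - f n) = (\<lambda>m. - fold_group orb f m)"
  by (simp add: fold_group_def sum_negf fun_eq_iff)

lemma fold_group_bracket:
  "fold_group orb (lie_bracket b f g) = lie_bracket b' (fold_group orb f) (fold_group orb g)"
proof
  fix m
  let ?F = "\<lambda>m. {n. n \<in> lat_pos \<and> fold_map orb n = m}"
  let ?P = "{(a, c). a \<in> lat_pos \<and> c \<in> lat_pos \<and> fold_map orb a + fold_map orb c = m}"
  let ?h = "\<lambda>a c. - of_int (form b a c) * f a * g c"
  have "fold_group orb (lie_bracket b f g) m =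
      (\<Sum>(n, a)\<in>Sigma (?F m) (\<lambda>n. {a. a \<in> lat_pos \<and> n - a \<in> lat_pos}). ?h a (n - a))"
    unfolding fold_group_def lie_bracket_def
    by (rule sum.Sigma) (auto simp: finite_fold_fibre finite_lat_pos_diff)
  \<comment> \<open>Pairs whose images add up to m: grouped by a + c they give the image of the
    bracket, grouped by the image of a the bracket of the images. The coefficients agree by
    invariance of the form.\<close>
  also have "\<dots> = (\<Sum>(a, c)\<in>?P. ?h a c)"
    by (rule sum.reindex_bij_witness[of _ "\<lambda>(a, c). (a + c, a)" "\<lambda>(n, a). (a, n - a)"])
       (auto simp: fold_map_add fold_map_diff lat_pos_add)
  also have "\<dots> = (\<Sum>(a', ac)\<in>Sigma {a. a \<in> lat_pos \<and> m - a \<in> lat_pos} (\<lambda>a'. ?F a' \<times> ?F (m - a')).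
      - of_int (form b' a' (m - a')) * (f (fst ac) * g (snd ac)))"
  proof (rule sum.reindex_bij_witness[of _ "\<lambda>(a', ac). ac" "\<lambda>(a, c). (fold_map orb a, (a, c))"])
    fix ac assume "ac \<in> ?P"
    then show "(case ac of (a, c) \<Rightarrow> (fold_map orb a, (a, c))) \<in>
        Sigma {a. a \<in> lat_pos \<and> m - a \<in> lat_pos} (\<lambda>a'. ?F a' \<times> ?F (m - a'))"
      by (auto simp: fold_map_lat_pos algebra_simps)
  next
    fix ac assume "ac \<in> ?P"
    then obtain a c where ac: "ac = (a, c)" "m - fold_map orb a = fold_map orb c" by auto
    then show "(case case ac of (a, c) \<Rightarrow> (fold_map orb a, (a, c)) of
        (a', ac) \<Rightarrow> - of_int (form b' a' (m - a')) * (f (fst ac) * g (snd ac))) =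
        (case ac of (a, c) \<Rightarrow> ?h a c)"
      by (simp add: form_fold_map)
  qed auto
  also have "\<dots> = (\<Sum>a' | a' \<in> lat_pos \<and> m - a' \<in> lat_pos. \<Sum>ac\<in>?F a' \<times> ?F (m - a').
      - of_int (form b' a' (m - a')) * (f (fst ac) * g (snd ac)))"
    by (rule sum.Sigma[symmetric]) (auto simp: finite_fold_fibre finite_lat_pos_diff)
  also have "\<dots> = lie_bracket b' (fold_group orb f) (fold_group orb g) m"
    unfolding lie_bracket_def fold_group_def sum_distrib_left[symmetric] mult.assoc
    by (simp add: sum_product sum.cartesian_product case_prod_beta)
  finally show "fold_group orb (lie_bracket b f g) m = lie_bracket b' (fold_group orb f) (fold_group orb g) m" .
qed

lemma fold_group_word: "fold_group orb (lie_word b ws) = lie_word b' (map (fold_group orb) ws)"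
  by (induction ws rule: induct_list012) (simp_all add: fold_group_bracket fold_group_0)

text \<open>Folding respects brackets and degrees, so it maps each Dynkin word to the corresponding
  word under the same truncation.\<close>

lemma fold_group_bch: "fold_group orb (bch b x y) = bch b' (fold_group orb x) (fold_group orb y)"
proof
  fix m :: "int ^ 'j"
  let ?P = "{ps :: (nat \<times> nat) list. ps \<noteq> [] \<and> (0, 0) \<notin> set ps \<and> int (dynkin_size ps) \<le> deg m}"
  have "fold_group orb (bch b x y) m = (\<Sum>n | n \<in> lat_pos \<and> fold_map orb n = m.
      \<Sum>ps\<in>?P. of_real (dynkin_coeff ps) * lie_word b (dynkin_word x y ps) n)"
    unfolding fold_group_def bch_eq by (intro sum.cong) (auto simp: deg_fold_map)
  also have "\<dots> = (\<Sum>ps\<in>?P. of_real (dynkin_coeff ps) * fold_group orb (lie_word b (dynkin_word x y ps)) m)"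
    unfolding fold_group_def sum_distrib_left by (rule sum.swap)
  also have "\<dots> = bch b' (fold_group orb x) (fold_group orb y) m"
    by (simp add: fold_group_word map_dynkin_word bch_eq)
  finally show "fold_group orb (bch b x y) m = bch b' (fold_group orb x) (fold_group orb y) m" .
qed

end

section \<open>Ordered products\<close>

definition ordprod :: "('n::finite \<Rightarrow> 'n \<Rightarrow> int) \<Rightarrow> real set \<Rightarrow> (real \<Rightarrow> 'n series) \<Rightarrow> 'n series" where
  "ordprod b T h = fold (\<lambda>t p. bch b (h t) p) (sorted_list_of_set T) (\<lambda>n. 0)"

lemma ordprod_empty [simp]: "ordprod b {} h = (\<lambda>n. 0)"
  by (simp add: ordprod_def)

lemma ordprod_insert_max:
  assumes "finite T" "\<And>t. t \<in> T \<Longrightarrow> t < s"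
  shows "ordprod b (insert s T) h = bch b (h s) (ordprod b T h)"
proof -
  have "s \<notin> T" using assms(2) by blast
  then have "sorted_list_of_set (insert s T) = insort s (sorted_list_of_set T)"
    using assms(1) by simp
  also have "\<dots> = sorted_list_of_set T @ [s]"
    using assms by (intro sorted_insort_is_snoc) (auto simp: less_imp_le)
  finally show ?thesis by (simp add: ordprod_def)
qed

lemma ordprod_carrier:
  assumes "finite T" "\<And>t. t \<in> T \<Longrightarrow> h t \<in> lie_carrier"
  shows "ordprod b T h \<in> lie_carrier"
  using assms by (induction T rule: finite_linorder_max_induct) (auto simp: ordprod_insert_max bch_carrier)

lemma ordprod_cong:
  assumes "finite T" "\<And>t. t \<in> T \<Longrightarrow> h t = h' t"
  shows "ordprod b T h = ordprod b T h'"
  using assms by (induction T rule: finite_linorder_max_induct) (auto simp: ordprod_insert_max)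

text \<open>Lets two products with different crossing times be written over a common set of
  times.\<close>

lemma ordprod_superset:
  assumes "skew_matrix b" "finite T'" "T \<subseteq> T'" "\<And>t. t \<in> T' \<Longrightarrow> h t \<in> lie_carrier"
    and "\<And>t. t \<in> T' - T \<Longrightarrow> h t = (\<lambda>n. 0)"
  shows "ordprod b T' h = ordprod b T h"
  using assms(2-)
proof (induction T' arbitrary: T rule: finite_linorder_max_induct)
  case (insert s A)
  have fin: "finite (T - {s})" using insert(1,4) finite_subset[of "T - {s}" A] by auto
  have IH: "ordprod b A h = ordprod b (T - {s}) h"
    by (rule insert(3)) (use insert in auto)
  show ?case
  proof (cases "s \<in> T")
    case True
    then have "T = insert s (T - {s})" by auto
    then have "ordprod b T h = bch b (h s) (ordprod b (T - {s}) h)"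
      using ordprod_insert_max[OF fin, of s b h] insert by auto
    then show ?thesis using insert IH by (simp add: ordprod_insert_max)
  next
    case False
    then have "h s = (\<lambda>n. 0)" using insert by auto
    moreover have T: "T - {s} = T" using False by auto
    moreover have "ordprod b T h \<in> lie_carrier"
      using fin insert unfolding T by (intro ordprod_carrier) auto
    ultimately show ?thesis
      using insert(1,2) IH by (simp add: ordprod_insert_max bch_0_left[OF assms(1)])
  qed
qed simp

text \<open>Iterated \<open>bch_top_degree\<close>: if the factors agree below degree d, their
  differences in degree d simply add up, irrespective of order. This removes noncommutativity from
  the comparison of path-ordered products.\<close>

lemma ordprod_top_degree:
  assumes "finite T" "\<And>t. t \<in> T \<Longrightarrow> h t \<in> lie_carrier" "\<And>t. t \<in> T \<Longrightarrow> h' t \<in> lie_carrier"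
    and "\<And>t. t \<in> T \<Longrightarrow> agree_below d (h t) (h' t)"
  shows "agree_below d (ordprod b T h) (ordprod b T h')"
    and "deg n \<le> d \<Longrightarrow> ordprod b T h n - ordprod b T h' n = (\<Sum>t\<in>T. h t n - h' t n)"
proof -
  have "agree_below d (ordprod b T h) (ordprod b T h') \<and>
      (deg n \<le> d \<longrightarrow> ordprod b T h n - ordprod b T h' n = (\<Sum>t\<in>T. h t n - h' t n))"
    using assms
  proof (induction T rule: finite_linorder_max_induct)
    case (insert s T)
    have car: "h s \<in> lie_carrier" "h' s \<in> lie_carrier" "ordprod b T h \<in> lie_carrier" "ordprod b T h' \<in> lie_carrier"
      using insert by (auto intro!: ordprod_carrier)
    have IH: "agree_below d (ordprod b T h) (ordprod b T h')"
      "deg n \<le> d \<Longrightarrow> ordprod b T h n - ordprod b T h' n = (\<Sum>t\<in>T. h t n - h' t n)"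
      and s: "agree_below d (h s) (h' s)" and "s \<notin> T"
      using insert by auto
    then show ?case
      using insert(1,2) bch_agree[OF car(1,3,2,4) s IH(1), of b] bch_top_degree[OF car(1,3,2,4) s IH(1), of n b]
      by (simp add: ordprod_insert_max)
  qed simp
  then show "agree_below d (ordprod b T h) (ordprod b T h')"
    "deg n \<le> d \<Longrightarrow> ordprod b T h n - ordprod b T h' n = (\<Sum>t\<in>T. h t n - h' t n)" by auto
qed

lemma (in folding) fold_group_ordprod:
  assumes "finite T"
  shows "fold_group orb (ordprod b T h) = ordprod b' T (\<lambda>t. fold_group orb (h t))"
  using assms
  by (induction T rule: finite_linorder_max_induct)
     (auto simp: ordprod_insert_max fold_group_bch fold_group_0)

text \<open>A finite set \<open>S\<close> of events \<open>e\<close> occurring at times \<open>\<tau> e\<close> and contributing the factors \<open>h e\<close>;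
  simultaneous factors are assumed to commute, so that their product is their sum.\<close>

definition evprod ::
  "('n::finite \<Rightarrow> 'n \<Rightarrow> int) \<Rightarrow> 'e set \<Rightarrow> ('e \<Rightarrow> real) \<Rightarrow> ('e \<Rightarrow> 'n series) \<Rightarrow> 'n series" where
  "evprod b S \<tau> h = ordprod b (\<tau> ` S) (\<lambda>t n. \<Sum>e | e \<in> S \<and> \<tau> e = t. h e n)"

lemma lie_bracket_sum_right:
  "lie_bracket b f (\<lambda>n. \<Sum>e\<in>A. g e n) n = (\<Sum>e\<in>A. lie_bracket b f (g e) n)"
  unfolding lie_bracket_def sum_distrib_left by (rule sum.swap)

text \<open>Simultaneous latest events commute, so any one of them can serve as the leftmost factor;
  pulling it out is the regrouping that needs associativity of \<open>bch\<close>.\<close>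

lemma evprod_remove_max:
  assumes "skew_matrix b" "finite S" "e \<in> S" "\<And>e'. e' \<in> S \<Longrightarrow> \<tau> e' \<le> \<tau> e"
    and "\<And>e. e \<in> S \<Longrightarrow> h e \<in> lie_carrier"
    and comm: "\<And>e e'. e \<in> S \<Longrightarrow> e' \<in> S \<Longrightarrow> \<tau> e = \<tau> e' \<Longrightarrow> lie_bracket b (h e) (h e') = (\<lambda>n. 0)"
  shows "evprod b S \<tau> h = bch b (h e) (evprod b (S - {e}) \<tau> h)"
proof -
  define H where "H S = (\<lambda>t n. \<Sum>e | e \<in> S \<and> \<tau> e = t. h e n)" for S
  define T0 where "T0 = \<tau> ` S - {\<tau> e}"
  have ev: "evprod b S \<tau> h = ordprod b (\<tau> ` S) (H S)" for S
    by (simp add: evprod_def H_def)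
  have T0: "finite T0" "\<And>t. t \<in> T0 \<Longrightarrow> t < \<tau> e" "\<tau> ` S = insert (\<tau> e) T0"
    using assms(2-4) by (force simp: T0_def)+
  have car: "H S' t \<in> lie_carrier" if "S' \<subseteq> S" for S' t
    unfolding H_def using assms(5) that by (intro lie_carrier_sum) auto
  have eqT0: "ordprod b T0 (H S) = ordprod b T0 (H (S - {e}))"
    unfolding H_def
    by (intro ordprod_cong[OF T0(1)] ext sum.cong refl) (auto dest: T0(2))
  have H: "H S (\<tau> e) = (\<lambda>n. h e n + H (S - {e}) (\<tau> e) n)"
  proof
    fix n
    have "{e'. e' \<in> S \<and> \<tau> e' = \<tau> e} = insert e {e'. e' \<in> S - {e} \<and> \<tau> e' = \<tau> e}"
      using assms(3) by auto
    then show "H S (\<tau> e) n = h e n + H (S - {e}) (\<tau> e) n"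
      unfolding H_def using assms(2) by simp
  qed
  have "lie_bracket b (h e) (H (S - {e}) (\<tau> e)) = (\<lambda>n. 0)"
    unfolding H_def lie_bracket_sum_right using comm[OF assms(3)]
    by (intro ext) (auto simp: lie_bracket_sum_right intro!: sum.neutral)
  then have H': "H S (\<tau> e) = bch b (h e) (H (S - {e}) (\<tau> e))"
    using car[of "S - {e}"] by (subst bch_commuting[OF assms(1) assms(5)[OF assms(3)]]) (simp_all add: H)
  have carT0: "ordprod b T0 (H (S - {e})) \<in> lie_carrier"
    using T0(1) car by (intro ordprod_carrier) auto
  have 1: "evprod b S \<tau> h = bch b (H S (\<tau> e)) (ordprod b T0 (H S))"
    unfolding ev T0(3) by (rule ordprod_insert_max[OF T0(1,2)])
  have 2: "bch b (H S (\<tau> e)) (ordprod b T0 (H S)) = bch b (h e) (bch b (H (S - {e}) (\<tau> e)) (ordprod b T0 (H (S - {e}))))"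
    by (simp only: H' eqT0 bch_assoc[OF assms(1) assms(5)[OF assms(3)] car[OF Diff_subset] carT0])
  \<comment> \<open>Whether another event happens at time \<open>\<tau> e\<close> decides if this
    time survives the removal of e; if it does not, the middle factor is trivial.\<close>
  have 3: "bch b (H (S - {e}) (\<tau> e)) (ordprod b T0 (H (S - {e}))) = evprod b (S - {e}) \<tau> h"
  proof (cases "\<exists>e'\<in>S - {e}. \<tau> e' = \<tau> e")
    case True
    then obtain e' where e': "e' \<in> S - {e}" "\<tau> e' = \<tau> e" by blast
    have "\<tau> x \<in> \<tau> ` (S - {e})" if "x \<in> S" for x
    proof (cases "x = e")
      case True
      then show ?thesis using e' by (metis imageI)
    qed (use that in blast)
    then have "\<tau> ` (S - {e}) = insert (\<tau> e) T0"
      unfolding T0(3)[symmetric] by blast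
    then show ?thesis
      unfolding ev using ordprod_insert_max[OF T0(1,2), of b "H (S - {e})"] by simp
  next
    case False
    have "\<tau> ` (S - {e}) = T0"
    proof (intro equalityI subsetI)
      fix t assume "t \<in> \<tau> ` (S - {e})"
      then obtain x where "x \<in> S" "x \<noteq> e" "t = \<tau> x" by blast
      then show "t \<in> T0" using False unfolding T0_def by (metis Diff_iff imageI singletonD)
    next
      fix t assume "t \<in> T0"
      then obtain x where "x \<in> S" "t = \<tau> x" "\<tau> x \<noteq> \<tau> e" unfolding T0_def by blast
      then show "t \<in> \<tau> ` (S - {e})" by (metis Diff_iff imageI singletonD)
    qed
    moreover have "{e'. e' \<in> S - {e} \<and> \<tau> e' = \<tau> e} = {}" using False by blast
    then have "H (S - {e}) (\<tau> e) = (\<lambda>n. 0)"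
      unfolding H_def by (simp only: sum.empty)
    ultimately show ?thesis
      unfolding ev by (simp add: bch_0_left[OF assms(1) carT0])
  qed
  show ?thesis unfolding 1 2 3 ..
qed

text \<open>\<open>\<tau>'\<close> may separate, in any order, events that are simultaneous for
  \<open>\<tau>\<close>, but keeps strict order. Removing an event that is latest for
  \<open>\<tau>'\<close> strips the same factor from both products.\<close>

lemma evprod_refine:
  assumes "skew_matrix b" "finite S"
    and "\<And>e. e \<in> S \<Longrightarrow> h e \<in> lie_carrier"
    and "\<And>e e'. e \<in> S \<Longrightarrow> e' \<in> S \<Longrightarrow> \<tau> e = \<tau> e' \<Longrightarrow> lie_bracket b (h e) (h e') = (\<lambda>n. 0)"
    and "\<And>e e'. e \<in> S \<Longrightarrow> e' \<in> S \<Longrightarrow> \<tau> e < \<tau> e' \<Longrightarrow> \<tau>' e < \<tau>' e'"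
  shows "evprod b S \<tau> h = evprod b S \<tau>' h"
  using assms(2-)
proof (induction "card S" arbitrary: S)
  case 0
  then show ?case by (simp add: evprod_def)
next
  case (Suc k)
  then have "S \<noteq> {}" by auto
  then have "Max (\<tau>' ` S) \<in> \<tau>' ` S" using Suc(3) by simp
  then obtain e where e: "e \<in> S" "\<tau>' e = Max (\<tau>' ` S)" by auto
  have max': "\<tau>' e' \<le> \<tau>' e" if "e' \<in> S" for e'
    using that Suc(3) by (simp add: e(2))
  \<comment> \<open>An event latest for \<open>\<tau>'\<close> is latest for \<open>\<tau>\<close>
    too, since strictly later events stay strictly later.\<close>
  have max: "\<tau> e' \<le> \<tau> e" if "e' \<in> S" for e'
    using max'[OF that] Suc(6)[OF e(1) that] by (meson leD leI)
  have comm': "lie_bracket b (h e) (h e') = (\<lambda>n. 0)" if "e \<in> S" "e' \<in> S" "\<tau>' e = \<tau>' e'" for e e'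
    using Suc(5)[OF that(1,2)] Suc(6)[OF that(1,2)] Suc(6)[OF that(2,1)] that(3)
    by (metis less_irrefl linorder_neqE)
  have "evprod b (S - {e}) \<tau> h = evprod b (S - {e}) \<tau>' h"
    using Suc e(1) by (intro Suc(1)) auto
  moreover have "evprod b S \<tau> h = bch b (h e) (evprod b (S - {e}) \<tau> h)"
    by (rule evprod_remove_max[where \<tau> = \<tau> and h = h, OF assms(1) Suc(3) e(1) max Suc(4,5)])
  moreover have "evprod b S \<tau>' h = bch b (h e) (evprod b (S - {e}) \<tau>' h)"
    by (rule evprod_remove_max[where \<tau> = \<tau>' and h = h, OF assms(1) Suc(3) e(1) max' Suc(4) comm'])
  ultimately show ?case by (simp only:)
qed

lemma evprod_reindex:
  assumes "bij_betw \<beta> S S'"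
  shows "evprod b S' \<tau> h = evprod b S (\<lambda>e. \<tau> (\<beta> e)) (\<lambda>e. h (\<beta> e))"
proof -
  have img: "\<tau> ` S' = (\<lambda>e. \<tau> (\<beta> e)) ` S"
    using assms by (auto simp: bij_betw_def)
  have "(\<Sum>e | e \<in> S' \<and> \<tau> e = t. h e n) = (\<Sum>e | e \<in> S \<and> \<tau> (\<beta> e) = t. h (\<beta> e) n)" for t n
    by (rule sum.reindex_bij_betw[symmetric])
       (use assms in \<open>auto simp: bij_betw_def inj_on_def image_iff\<close>)
  then show ?thesis unfolding evprod_def img by simp
qed

section \<open>Walls and general points\<close>

definition real_vec :: "int ^ 'n::finite \<Rightarrow> real ^ 'n" where
  "real_vec n = (\<chi> i. real_of_int (n $ i))"

lemma pairing_inner: "pairing n x = real_vec n \<bullet> x"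
  by (simp add: pairing_def real_vec_def inner_vec_def)

lemma perp_inner: "perp n = {x. real_vec n \<bullet> x = 0}"
  by (simp add: perp_def pairing_inner)

lemma real_vec_eq_0_iff [simp]: "real_vec n = 0 \<longleftrightarrow> n = 0"
  by (simp add: real_vec_def vec_eq_iff)

lemma perp_iff: "x \<in> perp n \<longleftrightarrow> pairing n x = 0"
  by (simp add: perp_def)

lemma pairing_add: "pairing n (x + y) = pairing n x + pairing n y"
  and pairing_diff: "pairing n (x - y) = pairing n x - pairing n y"
  and pairing_scaleR: "pairing n (c *\<^sub>R x) = c * pairing n x"
  by (simp_all add: pairing_inner inner_add_right inner_diff_right)

lemma pairing_scale_left: "pairing (c *s n) x = of_int c * pairing n x"
  by (simp add: pairing_def sum_distrib_left mult.assoc)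

lemma lat_pos_nonzero: "n \<in> lat_pos \<Longrightarrow> n \<noteq> 0"
  by (simp add: lat_pos_def)

text \<open>The vector n' minus its projection to n lies in \<open>perp n\<close>, hence is
  orthogonal to n and n' and so to itself.\<close>

lemma perp_subset_imp_parallel:
  assumes "n \<noteq> 0" "perp n \<subseteq> perp n'"
  obtains c where "real_vec n' = c *\<^sub>R real_vec n"
proof
  let ?a = "real_vec n" and ?a' = "real_vec n'"
  define c where "c = (?a \<bullet> ?a') / (?a \<bullet> ?a)"
  have "?a \<bullet> ?a \<noteq> 0" using assms(1) by simp
  then have "?a \<bullet> (?a' - c *\<^sub>R ?a) = 0"
    by (simp add: inner_diff_right c_def)
  then have "?a' \<bullet> (?a' - c *\<^sub>R ?a) = 0" "?a \<bullet> (?a' - c *\<^sub>R ?a) = 0"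
    using assms(2) by (auto simp: perp_inner)
  then have "(?a' - c *\<^sub>R ?a) \<bullet> (?a' - c *\<^sub>R ?a) = 0"
    by (simp add: inner_diff_left)
  then show "?a' = c *\<^sub>R ?a" by simp
qed

lemma perp_scale: "c \<noteq> 0 \<Longrightarrow> perp (c *s n) = perp n"
  by (auto simp: perp_iff pairing_scale_left)

lemma lat_pos_parallel:
  assumes "n \<in> lat_pos" "n' \<in> lat_pos" "perp n = perp n'"
  shows "deg n *s n' = deg n' *s n"
proof -
  obtain c where c: "real_vec n' = c *\<^sub>R real_vec n"
    by (rule perp_subset_imp_parallel[of n n']) (use assms lat_pos_nonzero in auto)
  then have i: "of_int (n' $ i) = c * of_int (n $ i)" for i
    by (simp add: real_vec_def vec_eq_iff)
  then have "of_int (deg n') = c * of_int (deg n)"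
    by (simp add: deg_def sum_distrib_left)
  then have "real_of_int (deg n * n' $ j) = of_int (deg n' * n $ j)" for j
    by (simp add: i)
  then show ?thesis by (simp only: of_int_eq_iff vec_eq_iff vector_smult_component) simp
qed

text \<open>Parallel positive vectors satisfy deg n * n' = deg n' * n; the gcd of the coordinates on
  both sides gives deg n = deg n'.\<close>

lemma primitive_vec_unique:
  assumes "n \<in> lat_pos" "n' \<in> lat_pos" "primitive_vec n" "primitive_vec n'" "perp n = perp n'"
  shows "n = n'"
proof -
  have *: "deg n * n' $ i = deg n' * n $ i" for i
    using lat_pos_parallel[OF assms(1,2,5)] by (simp add: vec_eq_iff)
  have Gcd: "Gcd (range (\<lambda>i. c * m $ i)) = c" if "primitive_vec m" "c > 0" for c :: int and m :: "int ^ 'a"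
    using that Gcd_mult[of c "range (\<lambda>i. m $ i)"] by (simp add: primitive_vec_def image_image)
  have "deg n = deg n'"
    using Gcd[OF assms(4) deg_pos[OF assms(1)]] Gcd[OF assms(3) deg_pos[OF assms(2)]] * by simp
  then show ?thesis using * deg_pos[OF assms(1)] by (simp add: vec_eq_iff)
qed

lemma primitive_multiple:
  assumes "n \<in> lat_pos"
  obtains n0 and k :: nat where "n0 \<in> lat_pos" "primitive_vec n0" "1 \<le> k" "n = of_nat k *s n0"
proof -
  define g where "g = Gcd (range (\<lambda>i. n $ i))"
  have "g \<ge> 0" by (simp add: g_def)
  moreover have "g \<noteq> 0" using assms by (auto simp: g_def lat_pos_def vec_eq_iff)
  ultimately have g: "g > 0" by simp
  define n0 where "n0 = (\<chi> i. n $ i div g)"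
  have dvd: "g dvd n $ i" for i by (simp add: g_def)
  have n: "n = g *s n0"
    using dvd by (simp add: n0_def vec_eq_iff)
  have "n0 \<noteq> 0" using assms n by (auto simp: lat_pos_def)
  moreover have "0 \<le> n0 $ i" for i
    using assms g by (simp add: n0_def lat_pos_def pos_imp_zdiv_nonneg_iff)
  ultimately have "n0 \<in> lat_pos" by (simp add: lat_pos_def)
  moreover have "primitive_vec n0"
  proof -
    have "n $ i = g * n0 $ i" for i
      by (subst n) simp
    then have "Gcd (range (\<lambda>i. n $ i)) = Gcd ((*) g ` range (\<lambda>i. n0 $ i))"
      by (simp add: image_image)
    also have "\<dots> = g * Gcd (range (\<lambda>i. n0 $ i))"
      using g by (simp only: Gcd_mult) (simp add: abs_mult)
    finally have "g = g * Gcd (range (\<lambda>i. n0 $ i))" by (simp only: g_def)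
    then show ?thesis using g by (simp add: primitive_vec_def)
  qed
  moreover have "1 \<le> nat g" "n = of_nat (nat g) *s n0" using g n by auto
  ultimately show thesis by (rule that)
qed

lemma general_point_perp:
  "general_point x \<Longrightarrow> n \<noteq> 0 \<Longrightarrow> n' \<noteq> 0 \<Longrightarrow> x \<in> perp n \<Longrightarrow> x \<in> perp n' \<Longrightarrow> perp n = perp n'"
  unfolding general_point_def by blast

lemma affine_hull_wall:
  fixes n :: "int ^ 'n::finite"
  assumes "C \<subseteq> perp n" "n \<noteq> 0" "aff_dim C = int CARD('n) - 1"
  shows "affine hull C = perp n"
proof (rule affine_dim_equal)
  show "affine (perp n)" unfolding perp_inner by (rule affine_hyperplane)
  then show "affine hull C \<subseteq> perp n" using assms(1) by (rule hull_minimal[rotated])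
  show "affine hull C \<noteq> {}"
  proof
    assume "affine hull C = {}"
    then have "aff_dim C = -1" using aff_dim_empty by auto
    with assms(3) show False by simp
  qed
  have "aff_dim (perp n) = int CARD('n) - 1"
    unfolding perp_inner using assms(2) by (subst aff_dim_hyperplane) auto
  then show "aff_dim (affine hull C) = aff_dim (perp n)"
    using assms(3) by (simp add: aff_dim_affine_hull)
qed simp

lemma wall_normal_eq:
  fixes C :: "(real ^ 'n::finite) set"
  assumes "n0 \<in> lat_pos" "primitive_vec n0" "C \<subseteq> perp n0" "aff_dim C = int CARD('n) - 1"
  shows "wall_normal C = n0"
  unfolding wall_normal_def
proof (rule the_equality)
  fix n assume "n \<in> lat_pos \<and> primitive_vec n \<and> C \<subseteq> perp n"
  then show "n = n0"
    using affine_hull_wall[of C n] affine_hull_wall[of C n0] assms lat_pos_nonzero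
    by (intro primitive_vec_unique) auto
qed (use assms in auto)

lemma is_wallD:
  fixes C :: "(real ^ 'n::finite) set"
  assumes "is_wall b C g"
  shows "wall_normal C \<in> lat_pos" "primitive_vec (wall_normal C)" "C \<subseteq> perp (wall_normal C)"
    "rational_polyhedral_cone C" "aff_dim C = int CARD('n) - 1" "g \<in> carrier (par_group b (wall_normal C))"
    "affine hull C = perp (wall_normal C)" "g \<in> lie_carrier"
proof -
  obtain n0 where n0: "n0 \<in> lat_pos" "primitive_vec n0" "C \<subseteq> perp n0" "rational_polyhedral_cone C"
    "aff_dim C = int CARD('n) - 1" "g \<in> carrier (par_group b n0)"
    using assms unfolding is_wall_def by blast
  have [simp]: "wall_normal C = n0" by (rule wall_normal_eq[OF n0(1-3,5)])
  show "wall_normal C \<in> lat_pos" "primitive_vec (wall_normal C)" "C \<subseteq> perp (wall_normal C)"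
    "rational_polyhedral_cone C" "aff_dim C = int CARD('n) - 1" "g \<in> carrier (par_group b (wall_normal C))"
    using n0 by simp_all
  show "affine hull C = perp (wall_normal C)"
    using affine_hull_wall[OF n0(3) lat_pos_nonzero[OF n0(1)] n0(5)] by simp
  show "g \<in> lie_carrier" using n0(6) by (simp add: par_group_carrier)
qed

lemma is_wall_support:
  assumes "is_wall b C g" "g n \<noteq> 0"
  shows "\<exists>k::nat. 1 \<le> k \<and> n = of_nat k *s wall_normal C" "perp n = perp (wall_normal C)" "n \<in> lat_pos"
proof -
  show *: "\<exists>k::nat. 1 \<le> k \<and> n = of_nat k *s wall_normal C"
    using is_wallD(6)[OF assms(1)] assms(2) by (simp add: par_group_carrier)
  then obtain k :: nat where "1 \<le> k" "n = of_nat k *s wall_normal C" by blast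
  then show "perp n = perp (wall_normal C)" using perp_scale[of "of_nat k"] by simp
  show "n \<in> lat_pos" using is_wallD(8)[OF assms(1)] assms(2) lie_carrier_zero by blast
qed

lemma general_point_wall_normal:
  assumes "general_point x" "is_wall b C g" "is_wall b C' g'" "x \<in> C" "x \<in> C'"
  shows "wall_normal C = wall_normal C'"
proof (rule primitive_vec_unique)
  show "perp (wall_normal C) = perp (wall_normal C')"
    using assms is_wallD(1,3)[OF assms(2)] is_wallD(1,3)[OF assms(3)]
    by (intro general_point_perp[OF assms(1)] lat_pos_nonzero) auto
qed (use is_wallD[OF assms(2)] is_wallD[OF assms(3)] in auto)

lemma closed_rational_polyhedral_cone: 
  assumes "rational_polyhedral_cone C" shows "closed C"
proof -
  obtain F where "finite F" "C = {x. \<forall>n\<in>F. 0 \<le> pairing n x}"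
    using assms unfolding rational_polyhedral_cone_def by blast
  then have "C = (\<Inter>n\<in>F. {x. 0 \<le> pairing n x})" by auto
  moreover have "closed {x. 0 \<le> pairing n x}" for n :: "int ^ 'a"
    unfolding pairing_inner by (rule closed_halfspace_ge)
  ultimately show ?thesis by auto
qed

text \<open>At a general point each inequality of the cone is strict, trivial, or an equality on the
  hyperplane of the wall. The finitely many strict ones persist on a ball, and the others hold on
  the whole hyperplane.\<close>

lemma general_point_rel_interior:
  assumes "general_point x" "is_wall b C g" "x \<in> C"
  shows "x \<in> rel_interior C"
proof -
  let ?n = "wall_normal C"
  obtain F where F: "finite F" "C = {x. \<forall>n\<in>F. 0 \<le> pairing n x}"
    using is_wallD(4)[OF assms(2)] unfolding rational_polyhedral_cone_def by blast
  have n: "?n \<noteq> 0" "x \<in> perp ?n"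
    using is_wallD(1,3)[OF assms(2)] assms(3) lat_pos_nonzero by auto
  define F' where "F' = {n \<in> F. n \<noteq> 0 \<and> perp n \<noteq> perp ?n}"
  have pos: "0 < pairing n x" if "n \<in> F'" for n
  proof -
    have "pairing n x \<noteq> 0"
      using that general_point_perp[OF assms(1), of n ?n] n by (auto simp: F'_def perp_iff)
    moreover have "0 \<le> pairing n x" using that assms(3) F(2) by (auto simp: F'_def)
    ultimately show ?thesis by simp
  qed
  have "open (\<Inter>n\<in>F'. {y. 0 < pairing n y})"
    unfolding pairing_inner using F(1) by (intro open_INT ballI open_halfspace_gt) (auto simp: F'_def)
  moreover have "x \<in> (\<Inter>n\<in>F'. {y. 0 < pairing n y})" using pos by auto
  ultimately obtain e where e: "e > 0" "ball x e \<subseteq> (\<Inter>n\<in>F'. {y. 0 < pairing n y})"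
    by (meson open_contains_ball)
  have "ball x e \<inter> perp ?n \<subseteq> C"
  proof
    fix y assume y: "y \<in> ball x e \<inter> perp ?n"
    have "0 \<le> pairing n y" if "n \<in> F" for n
    proof (cases "n \<in> F'")
      case True
      then have "y \<in> {y. 0 < pairing n y}" using e(2) y by blast
      then show ?thesis by simp
    next
      case False
      then have "n = 0 \<or> perp n = perp ?n" using that by (auto simp: F'_def)
      then have "y \<in> perp n" using y by (auto simp: perp_iff pairing_def)
      then show ?thesis by (simp add: perp_iff)
    qed
    then show "y \<in> C" by (simp add: F(2))
  qed
  then show ?thesis
    using assms(3) e(1) is_wallD(7)[OF assms(2)] by (auto simp: mem_rel_interior_ball)
qed

section \<open>Local elements as sums over walls\<close>

lemma scattering_wall: "scattering_diagram b D \<Longrightarrow> w \<in> walls D \<Longrightarrow> is_wall b (supp D w) (elt D w)"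
  by (simp add: scattering_diagram_def)

lemma finite_walls_at: "scattering_diagram b D \<Longrightarrow> finite (walls_at D k x)"
  unfolding scattering_diagram_def walls_at_def by (elim conjE allE[of _ k]) (auto elim!: finite_subset[rotated])

lemma normal_at_eq:
  assumes "scattering_diagram b D" "general_point x" "w \<in> walls_at D k x"
  shows "normal_at D k x = wall_normal (supp D w)"
proof -
  have w: "is_wall b (supp D w) (elt D w)"
    using assms(1,3) scattering_wall by (auto simp: walls_at_def)
  show ?thesis
    unfolding normal_at_def
  proof (rule the_equality)
    have "supp D v \<subseteq> perp (wall_normal (supp D w))" if "v \<in> walls_at D k x" for v
    proof -
      have v: "is_wall b (supp D v) (elt D v)"
        using assms(1) that scattering_wall by (auto simp: walls_at_def)
      have "wall_normal (supp D v) = wall_normal (supp D w)"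
        using that assms(3) by (intro general_point_wall_normal[OF assms(2) v w]) (auto simp: walls_at_def)
      then show ?thesis using is_wallD(3)[OF v] by simp
    qed
    then show "wall_normal (supp D w) \<in> lat_pos \<and> primitive_vec (wall_normal (supp D w)) \<and>
        (\<forall>v\<in>walls_at D k x. supp D v \<subseteq> perp (wall_normal (supp D w)))"
      using is_wallD[OF w] by blast
  next
    fix n assume n: "n \<in> lat_pos \<and> primitive_vec n \<and> (\<forall>w\<in>walls_at D k x. supp D w \<subseteq> perp n)"
    then show "n = wall_normal (supp D w)"
      using wall_normal_eq[of n "supp D w"] assms(3) is_wallD(5)[OF w] by simp
  qed
qed

lemma local_elt_eq:
  assumes "skew_matrix b" "scattering_diagram b D" "general_point x"
  shows "local_elt b D k x = (\<lambda>n. \<Sum>w\<in>walls_at D k x. elt D w n)"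
  unfolding local_elt_def
proof (rule finprod_par_group[OF assms(1) finite_walls_at[OF assms(2)]])
  fix w assume w: "w \<in> walls_at D k x"
  then have "is_wall b (supp D w) (elt D w)"
    using assms(2) scattering_wall by (auto simp: walls_at_def)
  then show "elt D w \<in> carrier (par_group b (normal_at D k x))"
    using normal_at_eq[OF assms(2,3) w] is_wallD(6) by metis
qed

lemma local_elt_carrier:
  assumes "skew_matrix b" "scattering_diagram b D" "general_point x"
  shows "local_elt b D k x \<in> lie_carrier"
  unfolding local_elt_eq[OF assms]
proof (rule lie_carrier_sum)
  fix w assume "w \<in> walls_at D k x"
  then show "elt D w \<in> lie_carrier"
    using assms(2) scattering_wall is_wallD(8) by (fastforce simp: walls_at_def)
qed

text \<open>Unlike \<open>local_elt\<close>, this is meaningful at points that lie on several hyperplanes, such as the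
  image under $q^*$ of a general point.\<close>

definition wall_sum :: "('w, 'n::finite) diagram \<Rightarrow> real ^ 'n \<Rightarrow> 'n series" where
  "wall_sum D x n = (\<Sum>w | w \<in> walls D \<and> x \<in> supp D w \<and> elt D w n \<noteq> 0. elt D w n)"

text \<open>Walls without z^n component contribute nothing in degree n, so the coefficient does not
  depend on the order k once deg n \<le> k.\<close>

lemma local_elt_wall_sum:
  assumes "skew_matrix b" "scattering_diagram b D" "general_point x" "deg n \<le> int k"
  shows "local_elt b D k x n = wall_sum D x n"
  unfolding local_elt_eq[OF assms(1-3)] wall_sum_def
  by (rule sum.mono_neutral_right[OF finite_walls_at[OF assms(2)]])
     (use assms(4) in \<open>auto simp: walls_at_def nontriv_upto_def\<close>)

lemma wall_sum_nonzero:
  assumes "scattering_diagram b D" "wall_sum D x n \<noteq> 0"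
  shows "n \<in> lat_pos" "x \<in> perp n"
proof -
  obtain w where w: "w \<in> walls D" "x \<in> supp D w" "elt D w n \<noteq> 0"
    using assms(2) unfolding wall_sum_def by (metis (mono_tags, lifting) mem_Collect_eq sum.not_neutral_contains_not_neutral)
  have "is_wall b (supp D w) (elt D w)" by (rule scattering_wall[OF assms(1) w(1)])
  from is_wall_support[OF this w(3)] is_wallD(3)[OF this] w(2)
  show "n \<in> lat_pos" "x \<in> perp n" by auto
qed

lemma elt_at_wall_sum:
  assumes "skew_matrix b" "scattering_diagram b D" "general_point x"
  shows "elt_at b D x = wall_sum D x"
proof
  fix n :: "int ^ 'a"
  show "elt_at b D x n = wall_sum D x n"
  proof (cases "n \<in> lat_pos")
    case True
    then show ?thesis
      using local_elt_wall_sum[OF assms, of n "nat (deg n)"] deg_pos[OF True] by (simp add: elt_at_def)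
  next
    case False
    then have "wall_sum D x n = 0" using wall_sum_nonzero(1)[OF assms(2)] by blast
    then show ?thesis
      using lie_carrier_zero[OF local_elt_carrier[OF assms] False] by (simp add: elt_at_def)
  qed
qed

section \<open>Generic quadratic paths\<close>

text \<open>With s = 2t - 1 this is x + s u + (1 - s^2) z. The end points x - u and x + u do not
  involve z, and t = 1/2 is sent to x + z.\<close>

definition quad_path :: "real ^ 'n \<Rightarrow> real ^ 'n \<Rightarrow> real ^ 'n \<Rightarrow> real \<Rightarrow> real ^ 'n::finite" where
  "quad_path x u z t = x + (2 * t - 1) *\<^sub>R u + (4 * t * (1 - t)) *\<^sub>R z"

definition quad_velocity :: "real ^ 'n \<Rightarrow> real ^ 'n \<Rightarrow> real \<Rightarrow> real ^ 'n::finite" where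
  "quad_velocity u z t = 2 *\<^sub>R u + (4 - 8 * t) *\<^sub>R z"

lemma pairing_0 [simp]: "pairing n 0 = 0"
  by (simp add: pairing_def)

lemma quad_path_derivative:
  "(quad_path x u z has_vector_derivative quad_velocity u z t) (at t within S)"
  unfolding quad_path_def[abs_def] quad_velocity_def
  by (auto intro!: derivative_eq_intros simp: algebra_simps)

lemma pairing_quad_path:
  "pairing n (quad_path x u z t) = pairing n x + (2 * t - 1) * pairing n u + (4 * t * (1 - t)) * pairing n z"
  by (simp add: quad_path_def pairing_add pairing_scaleR)

lemma pairing_quad_velocity: "pairing n (quad_velocity u z t) = 2 * pairing n u + (4 - 8 * t) * pairing n z"
  by (simp add: quad_velocity_def pairing_add pairing_scaleR)

lemma smooth_immersion_quad_path:
  assumes "\<And>t. t \<in> {0..1} \<Longrightarrow> quad_velocity u z t \<noteq> 0"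
  shows "smooth_immersion (quad_path x u z)"
proof -
  define c where "c k = (if k = 0 then quad_path x u z else if k = 1 then quad_velocity u z
    else if k = 2 then (\<lambda>t. - 8 *\<^sub>R z) else (\<lambda>t. 0))" for k :: nat
  show ?thesis
    unfolding smooth_immersion_def
  proof (intro exI[of _ c] conjI allI ballI)
    show "c 0 t = quad_path x u z t" for t by (simp add: c_def)
    show "c 1 t \<noteq> 0" if "t \<in> {0..1}" for t using assms[OF that] by (simp add: c_def)
    show "(c k has_vector_derivative c (Suc k) t) (at t within {0..1})" for k t
    proof -
      have "(quad_velocity u z has_vector_derivative - 8 *\<^sub>R z) (at t within {0..1})"
        unfolding quad_velocity_def[abs_def] by (auto intro!: derivative_eq_intros)
      moreover have "k = 0 \<or> k = 1 \<or> k \<ge> 2" by linarith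
      ultimately show ?thesis
        using quad_path_derivative[of x u z t] by (auto simp: c_def numeral_2_eq_2)
    qed
  qed
qed

text \<open>Genericity with respect to all rational hyperplanes at once, without reference to a
  diagram, so that one path can serve several diagrams whose walls are unknown.
  \<open>\<gamma>'\<close> stands for the velocity.\<close>

definition tame_path :: "(real \<Rightarrow> real ^ 'n::finite) \<Rightarrow> (real \<Rightarrow> real ^ 'n) \<Rightarrow> bool" where
  "tame_path \<gamma> \<gamma>' \<longleftrightarrow> smooth_immersion \<gamma> \<and>
     (\<forall>t\<in>{0..1}. (\<gamma> has_vector_derivative \<gamma>' t) (at t within {0..1})) \<and>
     (\<forall>t\<in>{0..1}. general_point (\<gamma> t)) \<and>
     (\<forall>n. n \<noteq> 0 \<longrightarrow> finite {t \<in> {0..1}. \<gamma> t \<in> perp n} \<and> \<gamma> 0 \<notin> perp n \<and> \<gamma> 1 \<notin> perp n \<and>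
        (\<forall>t\<in>{0..1}. \<gamma> t \<in> perp n \<longrightarrow> pairing n (\<gamma>' t) \<noteq> 0))"

lemma tame_pathD:
  assumes "tame_path \<gamma> \<gamma>'"
  shows "smooth_immersion \<gamma>"
    and "\<And>t. t \<in> {0..1} \<Longrightarrow> (\<gamma> has_vector_derivative \<gamma>' t) (at t within {0..1})"
    and "\<And>t. t \<in> {0..1} \<Longrightarrow> general_point (\<gamma> t)"
    and "\<And>n. n \<noteq> 0 \<Longrightarrow> finite {t \<in> {0..1}. \<gamma> t \<in> perp n}"
    and "\<And>n. n \<noteq> 0 \<Longrightarrow> \<gamma> 0 \<notin> perp n" "\<And>n. n \<noteq> 0 \<Longrightarrow> \<gamma> 1 \<notin> perp n"
    and "\<And>n t. n \<noteq> 0 \<Longrightarrow> t \<in> {0..1} \<Longrightarrow> \<gamma> t \<in> perp n \<Longrightarrow> pairing n (\<gamma>' t) \<noteq> 0"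
  using assms unfolding tame_path_def by simp_all

lemma tame_path_velocity: "tame_path \<gamma> \<gamma>' \<Longrightarrow> t \<in> {0..1} \<Longrightarrow> velocity \<gamma> t = \<gamma>' t"
  unfolding velocity_def by (rule vector_derivative_within_closed_interval) (auto dest: tame_pathD)

text \<open>Walls through a general point have the same normal, and each contains a neighbourhood of
  the point in the common hyperplane. A tame path thus never meets two walls whose intersection has
  codimension two.\<close>

lemma aff_dim_walls_inter:
  fixes C C' :: "(real ^ 'n::finite) set"
  assumes "general_point x" "is_wall b C g" "is_wall b C' g'" "x \<in> C" "x \<in> C'"
  shows "aff_dim (C \<inter> C') = int CARD('n) - 1"
proof -
  let ?P = "perp (wall_normal C)"
  have eq: "wall_normal C' = wall_normal C"
    using general_point_wall_normal[OF assms] by simp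
  obtain e e' where e: "e > 0" "ball x e \<inter> ?P \<subseteq> C" "e' > 0" "ball x e' \<inter> ?P \<subseteq> C'"
    using general_point_rel_interior[OF assms(1,2,4)] general_point_rel_interior[OF assms(1,3,5)]
      is_wallD(7)[OF assms(2)] is_wallD(7)[OF assms(3)]
    unfolding mem_rel_interior_ball eq by auto
  let ?B = "ball x (min e e')"
  have P: "affine ?P" unfolding perp_inner by (rule affine_hyperplane)
  have "x \<in> ?P" using assms(4) is_wallD(3)[OF assms(2)] by blast
  then have "?P \<inter> ?B \<noteq> {}" using e by auto
  then have "affine hull (?P \<inter> ?B) = ?P"
    using affine_hull_affine_Int_open[OF P open_ball] P by (simp add: affine_hull_eq)
  moreover have "?P \<inter> ?B \<subseteq> C \<inter> C'" using e by auto
  moreover have "aff_dim C = aff_dim ?P"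
    using is_wallD(7)[OF assms(2)] aff_dim_affine_hull by metis
  ultimately have "aff_dim C \<le> aff_dim (C \<inter> C')"
    using aff_dim_subset aff_dim_affine_hull by metis
  then show ?thesis
    using aff_dim_subset[of "C \<inter> C'" C] is_wallD(5)[OF assms(2)] by simp
qed

lemma tame_path_generic:
  fixes D :: "('w, 'n::finite) diagram"
  assumes D: "scattering_diagram b D" and \<gamma>: "tame_path \<gamma> \<gamma>'"
  shows "generic_path D \<gamma>"
  unfolding generic_path_def
proof (intro conjI ballI impI)
  have wall: "is_wall b (supp D w) (elt D w)" if "w \<in> nontriv_walls D" for w
    using that by (intro scattering_wall[OF D]) (simp add: nontriv_walls_def)
  have nz: "wall_normal (supp D w) \<noteq> 0" if "w \<in> nontriv_walls D" for w
    using is_wallD(1)[OF wall[OF that]] lat_pos_nonzero by blast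
  have sub: "supp D w \<subseteq> perp (wall_normal (supp D w))" if "w \<in> nontriv_walls D" for w
    using is_wallD(3)[OF wall[OF that]] .
  show "smooth_immersion \<gamma>" by (rule tame_pathD(1)[OF \<gamma>])
  show "\<gamma> 0 \<notin> supp D w" "\<gamma> 1 \<notin> supp D w" if "w \<in> nontriv_walls D" for w
    using tame_pathD(5,6)[OF \<gamma> nz[OF that]] sub[OF that] by auto
  show "\<gamma> t \<notin> rel_frontier (supp D w)" if w: "w \<in> nontriv_walls D" and t: "t \<in> {0..1}" for w t
  proof
    assume *: "\<gamma> t \<in> rel_frontier (supp D w)"
    then have "\<gamma> t \<in> supp D w"
      using closed_rational_polyhedral_cone[OF is_wallD(4)[OF wall[OF w]]] by (simp add: rel_frontier_def)
    then show False
      using general_point_rel_interior[OF tame_pathD(3)[OF \<gamma> t] wall[OF w]] * by (simp add: rel_frontier_def)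
  qed
  show "\<gamma> t \<notin> supp D v \<inter> supp D w" if "v \<in> nontriv_walls D" "w \<in> nontriv_walls D"
    "aff_dim (supp D v \<inter> supp D w) = int CARD('n) - 2" "t \<in> {0..1}" for v w t
    using aff_dim_walls_inter[OF tame_pathD(3)[OF \<gamma> that(4)] wall[OF that(1)] wall[OF that(2)]] that(3) by auto
  show "pairing (wall_normal (supp D w)) (velocity \<gamma> t) \<noteq> 0"
    if "w \<in> nontriv_walls D" "t \<in> {0..1}" "\<gamma> t \<in> supp D w" for w t
    using tame_pathD(7)[OF \<gamma> nz[OF that(1)] that(2)] sub[OF that(1)] that(3) tame_path_velocity[OF \<gamma> that(2)] by auto
qed

section \<open>Path-ordered products as products over single crossings\<close>

definition crossings :: "('w, 'n::finite) diagram \<Rightarrow> nat \<Rightarrow> (real \<Rightarrow> real ^ 'n) \<Rightarrow> ('w \<times> real) set" where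
  "crossings D k \<gamma> = {(w, t). w \<in> walls D \<and> nontriv_upto k (elt D w) \<and> t \<in> {0..1} \<and> \<gamma> t \<in> supp D w}"

definition crossing_elt :: "('w, 'n::finite) diagram \<Rightarrow> (real \<Rightarrow> real ^ 'n) \<Rightarrow> 'w \<times> real \<Rightarrow> 'n series" where
  "crossing_elt D \<gamma>' = (\<lambda>(w, t) n. (if pairing (wall_normal (supp D w)) (\<gamma>' t) < 0 then 1 else - 1) * elt D w n)"

lemma finite_crossings:
  assumes "scattering_diagram b D" "tame_path \<gamma> \<gamma>'"
  shows "finite (crossings D k \<gamma>)"
proof (rule finite_subset)
  let ?W = "{w \<in> walls D. nontriv_upto k (elt D w)}"
  show "crossings D k \<gamma> \<subseteq> Sigma ?W (\<lambda>w. {t \<in> {0..1}. \<gamma> t \<in> perp (wall_normal (supp D w))})"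
    using is_wallD(3)[OF scattering_wall[OF assms(1)]] by (fastforce simp: crossings_def)
  show "finite (Sigma ?W (\<lambda>w. {t \<in> {0..1}. \<gamma> t \<in> perp (wall_normal (supp D w))}))"
  proof (rule finite_SigmaI)
    show "finite ?W" using assms(1) unfolding scattering_diagram_def by blast
    fix w assume "w \<in> ?W"
    then have "wall_normal (supp D w) \<noteq> 0"
      using is_wallD(1)[OF scattering_wall[OF assms(1)]] lat_pos_nonzero by blast
    then show "finite {t \<in> {0..1}. \<gamma> t \<in> perp (wall_normal (supp D w))}"
      by (rule tame_pathD(4)[OF assms(2)])
  qed
qed

lemma crossing_times_crossings: "crossing_times D k \<gamma> = snd ` crossings D k \<gamma>"
  by (force simp: crossing_times_def crossings_def walls_at_def)

lemma path_product_upto_ordprod: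
  assumes b: "skew_matrix b" and D: "scattering_diagram b D" and \<gamma>: "tame_path \<gamma> \<gamma>'"
  shows "path_product_upto b D k \<gamma> = ordprod b (crossing_times D k \<gamma>)
    (\<lambda>t n. of_int (crossing_sign D k \<gamma> t) * local_elt b D k (\<gamma> t) n)"
  unfolding path_product_upto_def ordprod_def
proof (rule fold_cong)
  show "\<one>\<^bsub>scat_group b\<^esub> = (\<lambda>n. 0)" by (simp add: scat_group_def)
  have fin: "finite (crossing_times D k \<gamma>)"
    unfolding crossing_times_crossings using finite_crossings[OF D \<gamma>] by blast
  fix t assume "t \<in> set (sorted_list_of_set (crossing_times D k \<gamma>))"
  then have "t \<in> {0..1}" using fin by (auto simp: crossing_times_def)
  then have "local_elt b D k (\<gamma> t) \<in> lie_carrier"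
    using local_elt_carrier[OF b D] tame_pathD(3)[OF \<gamma>] by blast
  from scat_group_int_pow[OF b this]
  show "(\<otimes>\<^bsub>scat_group b\<^esub>) (local_elt b D k (\<gamma> t) [^]\<^bsub>scat_group b\<^esub> crossing_sign D k \<gamma> t) =
      bch b (\<lambda>n. of_int (crossing_sign D k \<gamma> t) * local_elt b D k (\<gamma> t) n)"
    by (auto simp: crossing_sign_def scat_group_def)
qed simp

lemma crossing_sign_eq:
  assumes "scattering_diagram b D" "tame_path \<gamma> \<gamma>'" "(w, t) \<in> crossings D k \<gamma>"
  shows "crossing_sign D k \<gamma> t = (if pairing (wall_normal (supp D w)) (\<gamma>' t) < 0 then 1 else - 1)"
proof -
  have t: "t \<in> {0..1}" and "w \<in> walls_at D k (\<gamma> t)"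
    using assms(3) by (auto simp: crossings_def walls_at_def)
  then show ?thesis
    unfolding crossing_sign_def tame_path_velocity[OF assms(2) t]
    by (simp add: normal_at_eq[OF assms(1) tame_pathD(3)[OF assms(2) t]])
qed

text \<open>The walls crossed at one time share their normal and hence their sign, so the local
  factor is a sum over walls. Making each wall its own event allows a perturbation to move them
  apart.\<close>

lemma path_product_upto_evprod:
  assumes b: "skew_matrix b" and D: "scattering_diagram b D" and \<gamma>: "tame_path \<gamma> \<gamma>'"
  shows "path_product_upto b D k \<gamma> = evprod b (crossings D k \<gamma>) snd (crossing_elt D \<gamma>')"
  unfolding path_product_upto_ordprod[OF assms] evprod_def crossing_times_crossings
proof (rule ordprod_cong)
  show "finite (snd ` crossings D k \<gamma>)" using finite_crossings[OF D \<gamma>] by blast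
  fix t assume "t \<in> snd ` crossings D k \<gamma>"
  then have t: "t \<in> {0..1}" by (auto simp: crossings_def)
  show "(\<lambda>n. of_int (crossing_sign D k \<gamma> t) * local_elt b D k (\<gamma> t) n) =
      (\<lambda>n. \<Sum>e | e \<in> crossings D k \<gamma> \<and> snd e = t. crossing_elt D \<gamma>' e n)"
  proof
    fix n
    have "(\<Sum>e | e \<in> crossings D k \<gamma> \<and> snd e = t. crossing_elt D \<gamma>' e n) =
        (\<Sum>w\<in>walls_at D k (\<gamma> t). crossing_elt D \<gamma>' (w, t) n)"
      by (rule sum.reindex_bij_witness[of _ "\<lambda>w. (w, t)" fst]) (use t in \<open>auto simp: crossings_def walls_at_def\<close>)
    also have "\<dots> = (\<Sum>w\<in>walls_at D k (\<gamma> t). of_int (crossing_sign D k \<gamma> t) * elt D w n)"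
    proof (rule sum.cong[OF refl])
      fix w assume "w \<in> walls_at D k (\<gamma> t)"
      then have "(w, t) \<in> crossings D k \<gamma>" by (simp add: crossings_def walls_at_def t[simplified])
      then show "crossing_elt D \<gamma>' (w, t) n = of_int (crossing_sign D k \<gamma> t) * elt D w n"
        using crossing_sign_eq[OF D \<gamma>] by (simp add: crossing_elt_def)
    qed
    also have "\<dots> = of_int (crossing_sign D k \<gamma> t) * local_elt b D k (\<gamma> t) n"
      unfolding local_elt_eq[OF b D tame_pathD(3)[OF \<gamma> t]] by (simp add: sum_distrib_left)
    finally show "of_int (crossing_sign D k \<gamma> t) * local_elt b D k (\<gamma> t) n =
      (\<Sum>e | e \<in> crossings D k \<gamma> \<and> snd e = t. crossing_elt D \<gamma>' e n)" ..
  qed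
qed

section \<open>Almost every direction gives a tame path\<close>

lemma negligible_pairing_eq: "n \<noteq> 0 \<Longrightarrow> negligible {u. pairing n u = c}"
  unfolding pairing_inner by (rule negligible_hyperplane) simp

lemma negligible_UN_countable:
  fixes S :: "'a::countable \<Rightarrow> (real ^ 'n::finite) set"
  assumes "\<And>a. a \<in> A \<Longrightarrow> negligible (S a)" shows "negligible (\<Union>a\<in>A. S a)"
  by (rule negligible_countable_Union) (use assms in auto)

text \<open>In coordinates adapted to \<open>n\<close> and \<open>n'\<close>, the directions that make a quadratic path meet the
  codimension two subspace \<open>perp n \<inter> perp n'\<close> are the image of a hyperplane under a rational map.\<close>

lemma negligible_meeting_directions:
  fixes x z :: "real ^ 'n::finite"
  assumes "n \<noteq> 0" "n' \<noteq> 0" "perp n \<noteq> perp n'"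
  shows "negligible {u. \<exists>s. s \<noteq> 0 \<and> pairing n (x + s *\<^sub>R u + (1 - s\<^sup>2) *\<^sub>R z) = 0 \<and>
    pairing n' (x + s *\<^sub>R u + (1 - s\<^sup>2) *\<^sub>R z) = 0}" (is "negligible ?B")
proof -
  have "\<not> perp n \<subseteq> perp n'"
  proof
    assume "perp n \<subseteq> perp n'"
    then obtain c where c: "real_vec n' = c *\<^sub>R real_vec n"
      by (rule perp_subset_imp_parallel[OF assms(1)])
    moreover have "c \<noteq> 0" using c assms(2) by (metis real_vec_eq_0_iff scale_zero_left)
    ultimately have "perp n = perp n'" by (auto simp: perp_inner)
    with assms(3) show False by simp
  qed
  then obtain v0 where "v0 \<in> perp n" "v0 \<notin> perp n'" by blast
  then have v0: "pairing n v0 = 0" "pairing n' v0 \<noteq> 0" by (simp_all add: perp_iff)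
  define v where "v = (1 / pairing n' v0) *\<^sub>R v0"
  have v: "pairing n v = 0" "pairing n' v = 1"
    using v0 by (simp_all add: v_def pairing_scaleR)
  define f where "f w = w - pairing n' w *\<^sub>R v -
    (1 / pairing n' w) *\<^sub>R (x + (1 - (pairing n' w)\<^sup>2) *\<^sub>R z)" for w
  let ?S = "{w. pairing n w = 0 \<and> pairing n' w \<noteq> 0}"
  have "negligible ?S"
    by (rule negligible_subset[OF negligible_pairing_eq[OF assms(1)]]) auto
  moreover have "f differentiable_on ?S"
    unfolding f_def[abs_def] pairing_inner differentiable_on_def by (auto intro!: derivative_intros)
  ultimately have "negligible (f ` ?S)"
    by (intro negligible_differentiable_image_negligible) auto
  moreover have "?B \<subseteq> f ` ?S"
  proof
    fix u assume "u \<in> ?B"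
    then obtain s where s: "s \<noteq> 0" "pairing n (x + s *\<^sub>R u + (1 - s\<^sup>2) *\<^sub>R z) = 0"
      "pairing n' (x + s *\<^sub>R u + (1 - s\<^sup>2) *\<^sub>R z) = 0" by blast
    \<comment> \<open>This w lies in \<open>perp n\<close> and pairs to s with n', so s, and with it
      u = f w, is recovered from w. The bad directions thus lie in the image of a null set under
      f.\<close>
    define w where "w = u + s *\<^sub>R v + (1 / s) *\<^sub>R (x + (1 - s\<^sup>2) *\<^sub>R z)"
    have "pairing m w = (1 / s) * pairing m (x + s *\<^sub>R u + (1 - s\<^sup>2) *\<^sub>R z) + s * pairing m v" for m
      unfolding w_def pairing_add pairing_scaleR using s(1) by (simp add: field_simps)
    then have w: "pairing n w = 0" "pairing n' w = s" using s v by simp_all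
    then have "f w = u" by (simp add: f_def w_def)
    with w s(1) show "u \<in> f ` ?S" by (intro image_eqI[of _ _ w]) auto
  qed
  ultimately show ?thesis by (rule negligible_subset)
qed

text \<open>Along the path the pairing with n is a quadratic polynomial in s = 2t - 1. Condition 1
  makes it nonzero, 2 keeps the end points off \<open>perp n\<close>, and 3 says that its
  discriminant is nonzero, so crossings are transversal. Condition 4, with generality of the point x
  + z at s = 0, makes all points general.\<close>

lemma tame_quad_path:
  fixes x u z :: "real ^ 'n::finite"
  assumes "n0 \<noteq> 0" "pairing n0 z = 0" "general_point (x + z)"
    and 1: "\<And>n. n \<noteq> 0 \<Longrightarrow> pairing n u \<noteq> 0"
    and 2: "\<And>n. n \<noteq> 0 \<Longrightarrow> pairing n u \<noteq> pairing n x \<and> pairing n u \<noteq> - pairing n x"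
    and 3: "\<And>n. n \<noteq> 0 \<Longrightarrow> (pairing n u)\<^sup>2 \<noteq> - 4 * pairing n z * (pairing n x + pairing n z)"
    and 4: "\<And>n n' s. n \<noteq> 0 \<Longrightarrow> n' \<noteq> 0 \<Longrightarrow> perp n \<noteq> perp n' \<Longrightarrow> s \<noteq> 0 \<Longrightarrow>
      pairing n (x + s *\<^sub>R u + (1 - s\<^sup>2) *\<^sub>R z) = 0 \<Longrightarrow> pairing n' (x + s *\<^sub>R u + (1 - s\<^sup>2) *\<^sub>R z) \<noteq> 0"
  shows "tame_path (quad_path x u z) (quad_velocity u z)"
proof -
  have qs: "quad_path x u z t = x + (2 * t - 1) *\<^sub>R u + (1 - (2 * t - 1)\<^sup>2) *\<^sub>R z" for t
    unfolding quad_path_def by (simp add: power2_eq_square algebra_simps)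
  have "general_point (quad_path x u z t)" for t
  proof (cases "2 * t - 1 = 0")
    case True
    then show ?thesis using assms(3) unfolding qs by simp
  next
    case False
    then show ?thesis unfolding general_point_def qs perp_iff using 4 by blast
  qed
  moreover have "smooth_immersion (quad_path x u z)"
  proof (rule smooth_immersion_quad_path)
    fix t
    \<comment> \<open>Since n0 kills z, the velocity pairs with n0 to the constant 2
      \<open>pairing n0 u\<close>.\<close>
    have "pairing n0 (quad_velocity u z t) \<noteq> 0"
      using 1[OF assms(1)] assms(2) by (simp add: pairing_quad_velocity)
    then show "quad_velocity u z t \<noteq> 0" by (auto simp: pairing_def)
  qed
  moreover have "finite {t \<in> {0..1}. quad_path x u z t \<in> perp n}" if n: "n \<noteq> 0" for n
  proof -
    define p where "p = [:pairing n x - pairing n u, 2 * pairing n u + 4 * pairing n z, - 4 * pairing n z:]"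
    have "p \<noteq> 0" using 1[OF n] by (auto simp: p_def)
    then have "finite {t. poly p t = 0}" by (rule poly_roots_finite)
    moreover have "pairing n (quad_path x u z t) = poly p t" for t
      by (simp add: pairing_quad_path p_def algebra_simps)
    ultimately show ?thesis by (simp add: perp_iff)
  qed
  moreover have "quad_path x u z 0 \<notin> perp n" "quad_path x u z 1 \<notin> perp n" if n: "n \<noteq> 0" for n
    using 2[OF n] by (auto simp: perp_iff pairing_quad_path)
  moreover have "pairing n (quad_velocity u z t) \<noteq> 0" if n: "n \<noteq> 0" and t: "quad_path x u z t \<in> perp n" for n t
  proof
    assume v: "pairing n (quad_velocity u z t) = 0"
    define s where "s = 2 * t - 1"
    have u: "pairing n u = 2 * s * pairing n z"
      using v by (simp add: pairing_quad_velocity s_def algebra_simps)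
    have "pairing n x + s * pairing n u + (1 - s\<^sup>2) * pairing n z = 0"
      using t unfolding perp_iff qs s_def[symmetric] by (simp add: pairing_add pairing_scaleR)
    then have "pairing n x + pairing n z = - s\<^sup>2 * pairing n z"
      by (simp add: u power2_eq_square algebra_simps)
    then have "- 4 * pairing n z * (pairing n x + pairing n z) = (pairing n u)\<^sup>2"
      by (simp add: u power2_eq_square algebra_simps)
    with 3[OF n] show False by simp
  qed
  ultimately show ?thesis
    unfolding tame_path_def by (simp add: quad_path_derivative)
qed

text \<open>The lattice is countable, and each condition of \<open>tame_quad_path\<close> excludes a
  null set of directions per lattice vector or pair of vectors, so a nonempty open U contains a
  direction good for both z = 0 and z = y - x. The freedom in U keeps the direction near a
  prescribed one later.\<close>

lemma exists_tame_direction: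
  fixes x y :: "real ^ 'n::finite"
  assumes "n0 \<noteq> 0" "x \<in> perp n0" "y \<in> perp n0" "general_point x" "general_point y"
    and "open U" "U \<noteq> {}"
  obtains u where "u \<in> U" "tame_path (quad_path x u 0) (quad_velocity u 0)"
    "tame_path (quad_path x u (y - x)) (quad_velocity u (y - x))"
proof -
  let ?N = "{n :: int ^ 'n. n \<noteq> 0}"
  let ?M = "{p :: (int ^ 'n) \<times> (int ^ 'n). fst p \<noteq> 0 \<and> snd p \<noteq> 0 \<and> perp (fst p) \<noteq> perp (snd p)}"
  define B1 where "B1 = (\<Union>n\<in>?N. {u. pairing n u = 0} \<union> {u. pairing n u = pairing n x} \<union> {u. pairing n u = - pairing n x})"
  define B3 where "B3 z = (\<Union>n\<in>?N. {u. (pairing n u)\<^sup>2 = - 4 * pairing n z * (pairing n x + pairing n z)})" for z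
  define B4 where "B4 z = (\<Union>p\<in>?M. {u. \<exists>s. s \<noteq> 0 \<and> pairing (fst p) (x + s *\<^sub>R u + (1 - s\<^sup>2) *\<^sub>R z) = 0 \<and>
    pairing (snd p) (x + s *\<^sub>R u + (1 - s\<^sup>2) *\<^sub>R z) = 0})" for z
  have "negligible B1"
    unfolding B1_def by (intro negligible_UN_countable negligible_Un negligible_pairing_eq) auto
  moreover have "negligible (B3 z)" for z
    unfolding B3_def
  proof (intro negligible_UN_countable)
    fix n :: "int ^ 'n" assume n: "n \<in> ?N"
    let ?c = "- 4 * pairing n z * (pairing n x + pairing n z)"
    have "{u. (pairing n u)\<^sup>2 = ?c} \<subseteq> {u. pairing n u = sqrt ?c} \<union> {u. pairing n u = - sqrt ?c}"
      by (auto simp: real_sqrt_abs) (metis abs_if real_sqrt_abs minus_minus)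
    moreover have "negligible ({u. pairing n u = sqrt ?c} \<union> {u. pairing n u = - sqrt ?c})"
      using n by (intro negligible_Un negligible_pairing_eq) auto
    ultimately show "negligible {u. (pairing n u)\<^sup>2 = ?c}" by (rule negligible_subset[rotated])
  qed
  moreover have "negligible (B4 z)" for z
    unfolding B4_def by (intro negligible_UN_countable negligible_meeting_directions) auto
  ultimately have "negligible (B1 \<union> (B3 0 \<union> B3 (y - x)) \<union> (B4 0 \<union> B4 (y - x)))"
    by (intro negligible_Un)
  then have "\<not> U \<subseteq> B1 \<union> (B3 0 \<union> B3 (y - x)) \<union> (B4 0 \<union> B4 (y - x))"
    using open_not_negligible[OF assms(6,7)] negligible_subset by blast
  then obtain u where u: "u \<in> U" "u \<notin> B1" "u \<notin> B3 0" "u \<notin> B3 (y - x)" "u \<notin> B4 0" "u \<notin> B4 (y - x)"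
    by blast
  have "tame_path (quad_path x u z) (quad_velocity u z)" if z: "z = 0 \<or> z = y - x" for z
  proof (rule tame_quad_path[OF assms(1)])
    have "u \<notin> B3 z" "u \<notin> B4 z" using z u by auto
    then show "(pairing n u)\<^sup>2 \<noteq> - 4 * pairing n z * (pairing n x + pairing n z)" if "n \<noteq> 0" for n
      using that by (auto simp: B3_def)
    show "pairing n' (x + s *\<^sub>R u + (1 - s\<^sup>2) *\<^sub>R z) \<noteq> 0"
      if "n \<noteq> 0" "n' \<noteq> 0" "perp n \<noteq> perp n'" "s \<noteq> 0" "pairing n (x + s *\<^sub>R u + (1 - s\<^sup>2) *\<^sub>R z) = 0" for n n' s
    proof
      assume "pairing n' (x + s *\<^sub>R u + (1 - s\<^sup>2) *\<^sub>R z) = 0"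
      with that have "u \<in> B4 z" unfolding B4_def by (intro UN_I[of "(n, n')"]) auto
      with \<open>u \<notin> B4 z\<close> show False by simp
    qed
    show "general_point (x + z)" "pairing n0 z = 0"
      using z assms by (auto simp: perp_iff pairing_diff)
    show "pairing n u \<noteq> 0" "pairing n u \<noteq> pairing n x \<and> pairing n u \<noteq> - pairing n x" if "n \<noteq> 0" for n
      using u(2) that by (auto simp: B1_def)
  qed
  with u(1) that show thesis by blast
qed

text \<open>Under the orthogonal projection \<open>\<pi>\<close> onto \<open>perp n0\<close>, every
  other rational hyperplane has a hyperplane as preimage, which is null. Almost every point near p
  thus projects to a general point, and \<open>\<pi>\<close> does not increase the distance to
  p.\<close>

lemma general_point_dense:
  fixes p :: "real ^ 'n::finite"
  assumes "n0 \<noteq> 0" "p \<in> perp n0" "e > 0"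
  obtains x where "x \<in> perp n0" "general_point x" "dist x p < e"
proof -
  let ?a = "real_vec n0"
  define \<pi> where "\<pi> y = y - ((?a \<bullet> y) / (?a \<bullet> ?a)) *\<^sub>R ?a" for y
  have a: "?a \<bullet> ?a \<noteq> 0" using assms(1) by simp
  let ?M = "{n. n \<noteq> 0 \<and> perp n \<noteq> perp n0}"
  have "negligible {y. pairing n (\<pi> y) = 0}" if "n \<in> ?M" for n
  proof -
    define c where "c = real_vec n - ((?a \<bullet> real_vec n) / (?a \<bullet> ?a)) *\<^sub>R ?a"
    have "c \<noteq> 0"
    proof
      assume "c = 0"
      then have c: "real_vec n = ((?a \<bullet> real_vec n) / (?a \<bullet> ?a)) *\<^sub>R ?a" by (simp add: c_def)
      moreover have "(?a \<bullet> real_vec n) / (?a \<bullet> ?a) \<noteq> 0" 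
        using c that by (metis (mono_tags) mem_Collect_eq real_vec_eq_0_iff scale_zero_left)
      ultimately have "perp n = perp n0"
        unfolding perp_inner by (metis (no_types, opaque_lifting) inner_scaleR_left mult_eq_0_iff)
      with that show False by simp
    qed
    moreover have "pairing n (\<pi> y) = c \<bullet> y" for y
      by (simp add: pairing_inner \<pi>_def c_def inner_diff_left inner_diff_right inner_commute algebra_simps)
    ultimately show ?thesis using negligible_hyperplane[of c 0] by simp
  qed
  then have "negligible (\<Union>n\<in>?M. {y. pairing n (\<pi> y) = 0})"
    by (intro negligible_UN_countable)
  moreover have "\<not> negligible (ball p e)"
    using assms(3) by (intro open_not_negligible) auto
  ultimately have "\<not> ball p e \<subseteq> (\<Union>n\<in>?M. {y. pairing n (\<pi> y) = 0})"
    using negligible_subset by blast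
  then obtain y where "y \<in> ball p e" "y \<notin> (\<Union>n\<in>?M. {y. pairing n (\<pi> y) = 0})"
    by blast
  then have y: "dist p y < e" "\<And>n. n \<in> ?M \<Longrightarrow> pairing n (\<pi> y) \<noteq> 0"
    by auto
  have perp: "\<pi> y \<in> perp n0"
    using a by (simp add: perp_inner \<pi>_def inner_diff_right)
  have "perp n = perp n0" if "n \<noteq> 0" "\<pi> y \<in> perp n" for n
    using y(2)[of n] that by (auto simp: perp_iff)
  then have "general_point (\<pi> y)"
    unfolding general_point_def by blast
  moreover have "dist (\<pi> y) p < e"
  proof -
    have "\<pi> y - p = \<pi> (y - p)"
      using assms(2) by (simp add: \<pi>_def inner_diff_right perp_inner algebra_simps)
    moreover have "norm (\<pi> v) \<le> norm v" for v
    proof -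
      have "v \<bullet> v - \<pi> v \<bullet> \<pi> v = (?a \<bullet> v)\<^sup>2 / (?a \<bullet> ?a)"
        unfolding \<pi>_def inner_diff_left inner_diff_right
        using a by (simp add: inner_commute power2_eq_square field_simps)
      moreover have "0 \<le> (?a \<bullet> v)\<^sup>2 / (?a \<bullet> ?a)" by simp
      ultimately show ?thesis unfolding norm_le by linarith
    qed
    ultimately have "dist (\<pi> y) p \<le> dist y p" by (simp add: dist_norm)
    then show ?thesis using y(1) by (simp add: dist_commute)
  qed
  ultimately show thesis using that perp by blast
qed

section \<open>Perturbed paths\<close>

text \<open>Packing x, u and z into one parameter turns perturbations of a path into neighbourhoods
  in a product space.\<close>

abbreviation tri_path :: "(real ^ 'n) \<times> (real ^ 'n) \<times> (real ^ 'n) \<Rightarrow> real \<Rightarrow> real ^ 'n::finite" where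
  "tri_path \<theta> \<equiv> quad_path (fst \<theta>) (fst (snd \<theta>)) (snd (snd \<theta>))"

abbreviation tri_velocity :: "(real ^ 'n) \<times> (real ^ 'n) \<times> (real ^ 'n) \<Rightarrow> real \<Rightarrow> real ^ 'n::finite" where
  "tri_velocity \<theta> \<equiv> quad_velocity (fst (snd \<theta>)) (snd (snd \<theta>))"

lemma continuous_on_tri_path: "continuous_on S (tri_path \<theta>)"
  unfolding quad_path_def[abs_def] by (intro continuous_intros)

text \<open>The coefficients 1, 2t - 1 and 4t(1 - t) are at most 1 in absolute value on the unit
  interval, hence the factor 3.\<close>

lemma tri_path_dist:
  assumes "t \<in> {0..1}"
  shows "dist (tri_path \<theta> t) (tri_path \<theta>' t) \<le> 3 * dist \<theta> \<theta>'"
proof -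
  let ?x = "fst \<theta> - fst \<theta>'" and ?u = "fst (snd \<theta>) - fst (snd \<theta>')" and ?z = "snd (snd \<theta>) - snd (snd \<theta>')"
  have eq: "tri_path \<theta> t - tri_path \<theta>' t = ?x + (2 * t - 1) *\<^sub>R ?u + (4 * t * (1 - t)) *\<^sub>R ?z"
    by (simp add: quad_path_def algebra_simps)
  have "4 * t * (1 - t) = 1 - (2 * t - 1)\<^sup>2" "0 \<le> 4 * t * (1 - t)"
    using assms by (auto simp: power2_eq_square algebra_simps intro: mult_nonneg_nonneg)
       (simp add: mult_left_le)
  then have c: "\<bar>2 * t - 1\<bar> \<le> 1" "\<bar>4 * t * (1 - t)\<bar> \<le> 1"
    using assms by auto
  have "norm ?x \<le> dist \<theta> \<theta>'" "norm ?u \<le> dist \<theta> \<theta>'" "norm ?z \<le> dist \<theta> \<theta>'"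
    unfolding dist_norm[symmetric]
    using dist_fst_le[of \<theta> \<theta>'] dist_snd_le[of \<theta> \<theta>'] dist_fst_le[of "snd \<theta>" "snd \<theta>'"] dist_snd_le[of "snd \<theta>" "snd \<theta>'"]
    by linarith+
  moreover have "norm ((2 * t - 1) *\<^sub>R ?u) \<le> norm ?u" "norm ((4 * t * (1 - t)) *\<^sub>R ?z) \<le> norm ?z"
    using mult_right_mono[OF c(1) norm_ge_zero[of ?u]] mult_right_mono[OF c(2) norm_ge_zero[of ?z]] by simp_all
  ultimately show ?thesis
    unfolding dist_norm eq
    using norm_triangle_ineq[of "?x + (2 * t - 1) *\<^sub>R ?u" "(4 * t * (1 - t)) *\<^sub>R ?z"]
      norm_triangle_ineq[of ?x "(2 * t - 1) *\<^sub>R ?u"]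
    unfolding dist_norm by linarith
qed

lemma isCont_pairing_tri_path: "isCont (\<lambda>\<theta>. pairing n (tri_path \<theta> t)) \<theta>"
  unfolding pairing_quad_path unfolding pairing_inner by (intro continuous_intros)

lemma isCont_pairing_tri_velocity: "isCont (\<lambda>p. pairing n (tri_velocity (fst p) (snd p))) p"
  unfolding pairing_quad_velocity unfolding pairing_inner by (intro continuous_intros)

lemma isCont_pos_eventually:
  fixes f :: "'a::t2_space \<Rightarrow> real"
  assumes "isCont f a" "0 < f a"
  shows "\<forall>\<^sub>F x in nhds a. 0 < f x"
  by (rule order_tendstoD(1)[OF assms(1)[unfolded isCont_def tendsto_at_iff_tendsto_nhds] assms(2)])

lemma pairing_tri_path_deriv:
  "((\<lambda>t. pairing n (tri_path \<theta> t)) has_real_derivative pairing n (tri_velocity \<theta> t)) (at t)"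
  unfolding pairing_quad_path[abs_def] pairing_quad_velocity
  by (auto intro!: derivative_eq_intros simp: algebra_simps)

lemma velocity_sign_near:
  assumes "pairing n (tri_velocity \<theta>0 t) \<noteq> 0"
  obtains d where "d > 0" "\<And>\<theta> t'. dist \<theta> \<theta>0 < d \<Longrightarrow> \<bar>t' - t\<bar> < d \<Longrightarrow>
    0 < pairing n (tri_velocity \<theta> t') * pairing n (tri_velocity \<theta>0 t)"
proof -
  let ?f = "\<lambda>p. pairing n (tri_velocity (fst p) (snd p)) * pairing n (tri_velocity \<theta>0 t)"
  have "isCont ?f (\<theta>0, t)"
    by (intro continuous_intros isCont_pairing_tri_velocity)
  moreover have "0 < ?f (\<theta>0, t)" using assms by (auto simp: zero_less_mult_iff neq_iff)
  ultimately have "\<forall>\<^sub>F p in nhds (\<theta>0, t). 0 < ?f p" by (rule isCont_pos_eventually)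
  then obtain e where e: "e > 0" "\<And>p. dist p (\<theta>0, t) < e \<Longrightarrow> 0 < ?f p"
    unfolding eventually_nhds_metric by blast
  show thesis
  proof (rule that[of "e / 2"])
    fix \<theta> t' assume "dist \<theta> \<theta>0 < e / 2" "\<bar>t' - t\<bar> < e / 2"
    then have "dist \<theta> \<theta>0 + dist t' t < e" by (simp add: dist_real_def)
    moreover have "dist (\<theta>, t') (\<theta>0, t) \<le> dist \<theta> \<theta>0 + dist t' t"
      unfolding dist_Pair_Pair by (rule sqrt_sum_squares_le_sum) auto
    ultimately show "0 < pairing n (tri_velocity \<theta> t') * pairing n (tri_velocity \<theta>0 t)"
      using e(2)[of "(\<theta>, t')"] by simp
  qed (use e in simp)
qed

text \<open>Two zeros would enclose a zero of the velocity component, by the mean value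
  theorem.\<close>

lemma crossing_unique_near:
  assumes sign: "\<And>t'. \<bar>t' - t\<bar> < d \<Longrightarrow> pairing n (tri_velocity \<theta> t') \<noteq> 0"
    and "\<bar>t1 - t\<bar> < d" "\<bar>t2 - t\<bar> < d" "pairing n (tri_path \<theta> t1) = 0" "pairing n (tri_path \<theta> t2) = 0"
  shows "t1 = t2"
proof -
  have *: False if ac: "a < c" "\<bar>a - t\<bar> < d" "\<bar>c - t\<bar> < d"
    "pairing n (tri_path \<theta> a) = 0" "pairing n (tri_path \<theta> c) = 0" for a c
  proof -
    obtain \<xi> where \<xi>: "a < \<xi>" "\<xi> < c"
      "pairing n (tri_path \<theta> c) - pairing n (tri_path \<theta> a) = (c - a) * pairing n (tri_velocity \<theta> \<xi>)"
      using MVT2[OF ac(1), of "\<lambda>t. pairing n (tri_path \<theta> t)" "\<lambda>t. pairing n (tri_velocity \<theta> t)"]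
        pairing_tri_path_deriv by blast
    then have "pairing n (tri_velocity \<theta> \<xi>) = 0" using ac by simp
    moreover have "\<bar>\<xi> - t\<bar> < d" using \<xi> ac by auto
    ultimately show False using sign by blast
  qed
  show ?thesis using *[of t1 t2] *[of t2 t1] assms(2-) by (meson linorder_neqE)
qed

text \<open>The sign change of the pairing with n around t survives a perturbation and produces a
  zero, the fixed sign of the velocity makes it unique, and the relative interior guarantees that it
  lies in C and not merely in its hyperplane. All small d are allowed so that finitely many
  crossings can share one d.\<close>

lemma perturbed_single_crossing:
  fixes \<theta>0 :: "(real ^ 'n::finite) \<times> (real ^ 'n) \<times> (real ^ 'n)"
  assumes "C \<subseteq> perp n" "affine hull C = perp n"
    and t: "0 < t" "t < 1" "tri_path \<theta>0 t \<in> rel_interior C" "pairing n (tri_velocity \<theta>0 t) \<noteq> 0"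
  obtains d0 where "d0 > 0" "\<And>d. 0 < d \<Longrightarrow> d \<le> d0 \<Longrightarrow> \<forall>\<^sub>F \<theta> in nhds \<theta>0.
    (\<exists>!t'. t' \<in> {0..1} \<and> \<bar>t' - t\<bar> < d \<and> tri_path \<theta> t' \<in> C) \<and>
    (\<forall>t'. \<bar>t' - t\<bar> < d \<longrightarrow> 0 < pairing n (tri_velocity \<theta> t') * pairing n (tri_velocity \<theta>0 t))"
proof -
  obtain e where e: "e > 0" "\<And>\<theta> t'. dist \<theta> \<theta>0 < e \<Longrightarrow> \<bar>t' - t\<bar> < e \<Longrightarrow>
      0 < pairing n (tri_velocity \<theta> t') * pairing n (tri_velocity \<theta>0 t)"
    using velocity_sign_near[OF t(4)] by blast
  obtain r where r: "r > 0" "ball (tri_path \<theta>0 t) r \<inter> perp n \<subseteq> C"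
    using t(3) unfolding mem_rel_interior_ball assms(2) by blast
  have "isCont (tri_path \<theta>0) t"
    unfolding quad_path_def[abs_def] by (intro continuous_intros)
  then obtain e' where e': "e' > 0" "\<And>t'. \<bar>t' - t\<bar> < e' \<Longrightarrow> dist (tri_path \<theta>0 t') (tri_path \<theta>0 t) < r / 2"
    using r(1) unfolding continuous_at_eps_delta dist_real_def by (metis half_gt_zero)
  \<comment> \<open>In this window the velocity keeps its sign, the unperturbed path stays within
    r/2 of the crossing point, and times stay in the unit interval.\<close>
  define d0 where "d0 = min (min e e') (min t (1 - t))"
  have d0: "d0 > 0" "d0 \<le> e" "d0 \<le> e'" "d0 \<le> t" "d0 \<le> 1 - t"
    using e(1) e'(1) t by (auto simp: d0_def)
  have "tri_path \<theta>0 t \<in> perp n"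
    using t(3) assms(1) rel_interior_subset by blast
  then have t0: "pairing n (tri_path \<theta>0 t) = 0"
    by (simp only: perp_iff)
  show thesis
  proof (rule that[OF d0(1)])
    fix d :: real assume d: "0 < d" "d \<le> d0"
    let ?a = "t - d / 2" and ?c = "t + d / 2"
    obtain \<xi>1 where 1: "?a < \<xi>1" "\<xi>1 < t"
      "pairing n (tri_path \<theta>0 t) - pairing n (tri_path \<theta>0 ?a) = (t - ?a) * pairing n (tri_velocity \<theta>0 \<xi>1)"
      using MVT2[of ?a t "\<lambda>t. pairing n (tri_path \<theta>0 t)" "\<lambda>t. pairing n (tri_velocity \<theta>0 t)"]
        pairing_tri_path_deriv d by force
    obtain \<xi>2 where 2: "t < \<xi>2" "\<xi>2 < ?c"
      "pairing n (tri_path \<theta>0 ?c) - pairing n (tri_path \<theta>0 t) = (?c - t) * pairing n (tri_velocity \<theta>0 \<xi>2)"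
      using MVT2[of t ?c "\<lambda>t. pairing n (tri_path \<theta>0 t)" "\<lambda>t. pairing n (tri_velocity \<theta>0 t)"]
        pairing_tri_path_deriv d by force
    have "0 < pairing n (tri_velocity \<theta>0 \<xi>1) * pairing n (tri_velocity \<theta>0 t)"
      "0 < pairing n (tri_velocity \<theta>0 \<xi>2) * pairing n (tri_velocity \<theta>0 t)"
      using e(2)[of \<theta>0] e(1) 1 2 d d0 by auto
    then have pos: "0 < pairing n (tri_velocity \<theta>0 \<xi>1) * pairing n (tri_velocity \<theta>0 \<xi>2)"
      by (auto simp: zero_less_mult_iff)
    have ends: "pairing n (tri_path \<theta>0 ?a) = - (d / 2) * pairing n (tri_velocity \<theta>0 \<xi>1)"
      "pairing n (tri_path \<theta>0 ?c) = d / 2 * pairing n (tri_velocity \<theta>0 \<xi>2)"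
      using 1(3) 2(3) t0 by simp_all
    have "- (pairing n (tri_path \<theta>0 ?a) * pairing n (tri_path \<theta>0 ?c)) =
        (d / 2)\<^sup>2 * (pairing n (tri_velocity \<theta>0 \<xi>1) * pairing n (tri_velocity \<theta>0 \<xi>2))"
      unfolding ends by (simp add: power2_eq_square)
    moreover have "0 < \<dots>" using pos d(1) by simp
    ultimately have "0 < - (pairing n (tri_path \<theta>0 ?a) * pairing n (tri_path \<theta>0 ?c))"
      by (simp only:)
    moreover have "isCont (\<lambda>\<theta>. - (pairing n (tri_path \<theta> ?a) * pairing n (tri_path \<theta> ?c))) \<theta>0"
      by (intro continuous_intros isCont_pairing_tri_path)
    ultimately have ev: "\<forall>\<^sub>F \<theta> in nhds \<theta>0. 0 < - (pairing n (tri_path \<theta> ?a) * pairing n (tri_path \<theta> ?c))"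
      using isCont_pos_eventually by blast
    have "\<forall>\<^sub>F \<theta> in nhds \<theta>0. dist \<theta> \<theta>0 < min e (r / 6)"
      using e(1) r(1) by (intro eventually_nhds_metric[THEN iffD2] exI[of _ "min e (r / 6)"]) auto
    with ev show "\<forall>\<^sub>F \<theta> in nhds \<theta>0.
      (\<exists>!t'. t' \<in> {0..1} \<and> \<bar>t' - t\<bar> < d \<and> tri_path \<theta> t' \<in> C) \<and>
      (\<forall>t'. \<bar>t' - t\<bar> < d \<longrightarrow> 0 < pairing n (tri_velocity \<theta> t') * pairing n (tri_velocity \<theta>0 t))"
    proof eventually_elim
      case (elim \<theta>)
      have sign: "0 < pairing n (tri_velocity \<theta> t') * pairing n (tri_velocity \<theta>0 t)" if "\<bar>t' - t\<bar> < d" for t'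
        using e(2)[of \<theta> t'] elim(2) that d d0 by simp
      have "\<exists>t'\<ge>?a. t' \<le> ?c \<and> pairing n (tri_path \<theta> t') = 0"
      proof -
        have cont: "\<forall>x. ?a \<le> x \<and> x \<le> ?c \<longrightarrow> isCont (\<lambda>t. pairing n (tri_path \<theta> t)) x"
          using DERIV_isCont[OF pairing_tri_path_deriv] by blast
        have "pairing n (tri_path \<theta> ?a) \<le> 0 \<and> 0 \<le> pairing n (tri_path \<theta> ?c) \<or>
            pairing n (tri_path \<theta> ?c) \<le> 0 \<and> 0 \<le> pairing n (tri_path \<theta> ?a)"
          using elim(1) by (auto simp: mult_less_0_iff)
        moreover have "?a \<le> ?c" using d by simp
        ultimately show ?thesis
          using IVT[of "\<lambda>t. pairing n (tri_path \<theta> t)" ?a 0 ?c] IVT2[of "\<lambda>t. pairing n (tri_path \<theta> t)" ?c 0 ?a] cont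
          by blast
      qed
      then obtain t' where t': "?a \<le> t'" "t' \<le> ?c" "pairing n (tri_path \<theta> t') = 0" by blast
      have near: "\<bar>t' - t\<bar> < d" using t' d by (auto simp: abs_less_iff)
      have "t' \<in> {0..1}" using t' d d0 by auto
      \<comment> \<open>The bound r/6 on the parameter gives r/2 here; the motion along the
        unperturbed path uses up the other half of r.\<close>
      have "dist (tri_path \<theta> t') (tri_path \<theta>0 t') \<le> 3 * dist \<theta> \<theta>0"
        by (rule tri_path_dist[OF \<open>t' \<in> {0..1}\<close>])
      moreover have "dist (tri_path \<theta>0 t') (tri_path \<theta>0 t) < r / 2"
        using e'(2) near d d0 by simp
      moreover have "3 * dist \<theta> \<theta>0 \<le> r / 2" using elim(2) by simp
      ultimately have "dist (tri_path \<theta>0 t) (tri_path \<theta> t') < r"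
        using dist_triangle[of "tri_path \<theta> t'" "tri_path \<theta>0 t" "tri_path \<theta>0 t'"]
        by (simp add: dist_commute)
      then have "tri_path \<theta> t' \<in> C"
        using r(2) t'(3) by (auto simp: perp_iff)
      moreover have "t'' = t'" if "\<bar>t'' - t\<bar> < d" "tri_path \<theta> t'' \<in> C" for t''
        using crossing_unique_near[of t d n \<theta> t'' t'] sign near that t'(3) assms(1)
        by (auto simp: perp_iff) (metis mult_zero_left order_less_irrefl perp_iff subsetD)
      ultimately have "\<exists>!t'. t' \<in> {0..1} \<and> \<bar>t' - t\<bar> < d \<and> tri_path \<theta> t' \<in> C"
        using \<open>t' \<in> {0..1}\<close> near by blast
      with sign show ?case by blast
    qed
  qed
qed

text \<open>Times at distance at least d from all old crossings form a compact set, whose image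
  keeps a positive distance from the closed set C. Hence no new crossings appear there.\<close>

lemma perturbed_crossings_near:
  fixes \<theta>0 :: "(real ^ 'n::finite) \<times> (real ^ 'n) \<times> (real ^ 'n)"
  assumes "closed C" "d > 0"
  shows "\<forall>\<^sub>F \<theta> in nhds \<theta>0. \<forall>t'\<in>{0..1}. tri_path \<theta> t' \<in> C \<longrightarrow>
    (\<exists>t\<in>{0..1}. tri_path \<theta>0 t \<in> C \<and> \<bar>t' - t\<bar> < d)"
proof -
  define T where "T = {0..1} - (\<Union>t\<in>{t\<in>{0..1}. tri_path \<theta>0 t \<in> C}. ball t d)"
  have "compact T" unfolding T_def by (intro compact_diff) auto
  then have "compact (tri_path \<theta>0 ` T)"
    by (intro compact_continuous_image continuous_on_tri_path)
  moreover have "tri_path \<theta>0 ` T \<inter> C = {}"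
    using assms(2) by (force simp: T_def)
  ultimately obtain e where e: "e > 0" "\<And>x y. x \<in> tri_path \<theta>0 ` T \<Longrightarrow> y \<in> C \<Longrightarrow> e \<le> dist x y"
    using separate_compact_closed[of "tri_path \<theta>0 ` T" C] assms(1) by blast
  have "\<forall>\<^sub>F \<theta> in nhds \<theta>0. dist \<theta> \<theta>0 < e / 3"
    using e(1) by (intro eventually_nhds_metric[THEN iffD2] exI[of _ "e / 3"]) auto
  then show ?thesis
  proof eventually_elim
    case (elim \<theta>)
    show ?case
    proof (intro ballI impI)
      fix t' :: real assume t': "t' \<in> {0..1}" "tri_path \<theta> t' \<in> C"
      have "t' \<notin> T"
      proof
        assume "t' \<in> T"
        then have "e \<le> dist (tri_path \<theta>0 t') (tri_path \<theta> t')" using e(2) t' by blast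
        then show False
          using tri_path_dist[OF t'(1), of \<theta> \<theta>0] elim by (simp add: dist_commute)
      qed
      then obtain t where "t \<in> {0..1}" "tri_path \<theta>0 t \<in> C" "dist t t' < d"
        using t'(1) by (auto simp: T_def)
      then show "\<exists>t\<in>{0..1}. tri_path \<theta>0 t \<in> C \<and> \<bar>t' - t\<bar> < d"
        by (auto simp: dist_real_def abs_minus_commute)
    qed
  qed
qed

lemma evprod_cong:
  assumes "finite S" "\<And>e. e \<in> S \<Longrightarrow> h e = h' e"
  shows "evprod b S \<tau> h = evprod b S \<tau> h'"
  unfolding evprod_def using assms by (intro ordprod_cong ext sum.cong) auto

section \<open>Images of perturbed path products under folding\<close>

context folding
begin

lemma fold_group_evprod:
  assumes "finite S"
  shows "fold_group orb (evprod b S \<tau> h) = evprod b' S \<tau> (\<lambda>e. fold_group orb (h e))"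
  unfolding evprod_def using assms by (simp add: fold_group_ordprod fold_group_sum)

lemma fold_dual_quad_path:
  "fold_dual orb (quad_path x u z t) = quad_path (fold_dual orb x) (fold_dual orb u) (fold_dual orb z) t"
  by (simp add: vec_eq_iff fold_dual_nth quad_path_def)

lemma fold_dual_quad_velocity:
  "fold_dual orb (quad_velocity u z t) = quad_velocity (fold_dual orb u) (fold_dual orb z) t"
  by (simp add: vec_eq_iff fold_dual_nth quad_velocity_def)

lemma fold_map_wall_normal:
  assumes "is_wall b C g"
  shows "fold_map orb (wall_normal C) \<in> lat_pos"
  using fold_map_lat_pos[OF is_wallD(1)[OF assms]] .

lemma fold_dual_perp_iff: "fold_dual orb x \<in> perp n \<longleftrightarrow> x \<in> perp (fold_map orb n)"
  by (simp add: perp_iff pairing_fold_dual)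

text \<open>The image of a primitive normal need not be primitive; n0 is its primitive part, and
  multiples of the normal go to multiples of n0.\<close>

lemma fold_group_par:
  assumes "is_wall b C g"
  obtains n0 and j :: nat where "n0 \<in> lat_pos" "primitive_vec n0" "1 \<le> j"
    "fold_map orb (wall_normal C) = of_nat j *s n0" "fold_group orb g \<in> carrier (par_group b' n0)"
proof -
  obtain n0 and j :: nat where n0: "n0 \<in> lat_pos" "primitive_vec n0" "1 \<le> j"
    "fold_map orb (wall_normal C) = of_nat j *s n0"
    by (rule primitive_multiple[OF fold_map_wall_normal[OF assms]])
  have "\<exists>k::nat. 1 \<le> k \<and> m = of_nat k *s n0" if m: "fold_group orb g m \<noteq> 0" for m
  proof -
    obtain n where n: "fold_map orb n = m" "g n \<noteq> 0"
      using m unfolding fold_group_def by (metis (mono_tags, lifting) mem_Collect_eq sum.neutral)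
    then obtain k :: nat where k: "1 \<le> k" "n = of_nat k *s wall_normal C"
      using is_wall_support(1)[OF assms] by blast
    have "m = of_nat (k * j) *s n0"
      using n k n0(4) by (simp add: fold_map_scale vector_smult_assoc)
    moreover have "1 \<le> k * j" using k n0 by simp
    ultimately show ?thesis by blast
  qed
  then have "fold_group orb g \<in> carrier (par_group b' n0)"
    by (simp add: par_group_carrier fold_group_carrier)
  with n0 that show thesis by blast
qed

text \<open>Events are indexed by walls of D, because the image of \<open>\<gamma>\<close> may meet
  several walls of D with different normals at one time.\<close>

definition quot_crossings :: "('w, 'i) diagram \<Rightarrow> nat \<Rightarrow> (real \<Rightarrow> real ^ 'j) \<Rightarrow> ('w \<times> real) set" where
  "quot_crossings D k \<gamma> = {(w, t). w \<in> walls D \<and> nontriv_upto k (elt D w) \<and> t \<in> {0..1} \<and>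
     fold_dual orb (\<gamma> t) \<in> supp D w}"

definition quot_elt :: "('w, 'i) diagram \<Rightarrow> (real \<Rightarrow> real ^ 'j) \<Rightarrow> 'w \<times> real \<Rightarrow> 'j series" where
  "quot_elt D \<gamma>' = (\<lambda>(w, t) n. (if pairing (fold_map orb (wall_normal (supp D w))) (\<gamma>' t) < 0 then 1 else - 1) *
     fold_group orb (elt D w) n)"

lemma quot_elt_carrier: "quot_elt D \<gamma>' e \<in> lie_carrier"
  using fold_group_carrier[of "elt D (fst e)"] by (auto simp: quot_elt_def lie_carrier_def case_prod_beta)

text \<open>At a general point of the quotient the images of all normals involved are parallel, so
  the folded factors commute even if those in D do not.\<close>

lemma quot_elt_commute:
  assumes D: "scattering_diagram b D" and x: "general_point (\<gamma> t)"
    and "(v, t) \<in> quot_crossings D k \<gamma>" "(w, t) \<in> quot_crossings D k \<gamma>"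
  shows "lie_bracket b' (quot_elt D \<gamma>' (v, t)) (quot_elt D \<gamma>' (w, t)) = (\<lambda>n. 0)"
proof -
  have v: "is_wall b (supp D v) (elt D v)" "fold_dual orb (\<gamma> t) \<in> supp D v"
    and w: "is_wall b (supp D w) (elt D w)" "fold_dual orb (\<gamma> t) \<in> supp D w"
    using assms(3,4) scattering_wall[OF D] by (auto simp: quot_crossings_def)
  obtain n and j :: nat where n: "n \<in> lat_pos" "primitive_vec n" "1 \<le> j"
    "fold_map orb (wall_normal (supp D v)) = of_nat j *s n" "fold_group orb (elt D v) \<in> carrier (par_group b' n)"
    by (rule fold_group_par[OF v(1)])
  obtain m and l :: nat where m: "m \<in> lat_pos" "primitive_vec m" "1 \<le> l"
    "fold_map orb (wall_normal (supp D w)) = of_nat l *s m" "fold_group orb (elt D w) \<in> carrier (par_group b' m)"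
    by (rule fold_group_par[OF w(1)])
  have "\<gamma> t \<in> perp (fold_map orb (wall_normal (supp D v)))" "\<gamma> t \<in> perp (fold_map orb (wall_normal (supp D w)))"
    using is_wallD(3)[OF v(1)] v(2) is_wallD(3)[OF w(1)] w(2) fold_dual_perp_iff by blast+
  then have "\<gamma> t \<in> perp n" "\<gamma> t \<in> perp m"
    unfolding n(4) m(4) using n(3) m(3) perp_scale[of "of_nat j" n] perp_scale[of "of_nat l" m] by auto
  then have "perp n = perp m"
    by (intro general_point_perp[OF x] lat_pos_nonzero n(1) m(1))
  then have "m = n" by (intro primitive_vec_unique n m) simp
  then show ?thesis
    using n(5) m(5) by (intro lie_bracket_parallel[OF skew_b', where ?n0.0 = n])
       (auto simp: quot_elt_def par_group_carrier split: if_splits)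
qed

lemma finite_quot_crossings:
  assumes "scattering_diagram b D" "tame_path \<gamma> \<gamma>'"
  shows "finite (quot_crossings D k \<gamma>)"
proof (rule finite_subset)
  let ?W = "{w \<in> walls D. nontriv_upto k (elt D w)}"
  let ?T = "\<lambda>w. {t \<in> {0..1}. \<gamma> t \<in> perp (fold_map orb (wall_normal (supp D w)))}"
  show "quot_crossings D k \<gamma> \<subseteq> Sigma ?W ?T"
    using is_wallD(3)[OF scattering_wall[OF assms(1)]] fold_dual_perp_iff
    by (fastforce simp: quot_crossings_def)
  show "finite (Sigma ?W ?T)"
  proof (rule finite_SigmaI)
    show "finite ?W" using assms(1) unfolding scattering_diagram_def by blast
    fix w assume "w \<in> ?W"
    then have "fold_map orb (wall_normal (supp D w)) \<noteq> 0"
      using fold_map_wall_normal[OF scattering_wall[OF assms(1)]] lat_pos_nonzero by blast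
    then show "finite (?T w)" by (rule tame_pathD(4)[OF assms(2)])
  qed
qed

text \<open>For a small perturbation the crossings of D correspond to the events of the given path,
  with the same signs and with distinct times in the same order. Simultaneous events may split in D,
  where their elements need not commute; they are merged by \<open>evprod_refine\<close> only after
  folding.\<close>

lemma quot_perturbation:
  fixes D :: "('w, 'i) diagram"
  assumes D: "scattering_diagram b D" and ad: "fold_adapted orb D"
    and tame: "tame_path (quad_path x u z) (quad_velocity u z)"
  shows "\<forall>\<^sub>F \<theta> in nhds (fold_dual orb x, fold_dual orb u, fold_dual orb z).
    tame_path (tri_path \<theta>) (tri_velocity \<theta>) \<longrightarrow>
    fold_group orb (path_product_upto b D k (tri_path \<theta>)) =
      evprod b' (quot_crossings D k (quad_path x u z)) snd (quot_elt D (quad_velocity u z))"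
proof -
  define \<gamma> where "\<gamma> = quad_path x u z"
  define \<gamma>' where "\<gamma>' = quad_velocity u z"
  define \<theta>0 where "\<theta>0 = (fold_dual orb x, fold_dual orb u, fold_dual orb z)"
  define S where "S = quot_crossings D k \<gamma>"
  define W where "W = {w \<in> walls D. nontriv_upto k (elt D w)}"
  let ?n = "\<lambda>w. wall_normal (supp D w)"
  note tm = tame[folded \<gamma>_def \<gamma>'_def]
  have path0: "tri_path \<theta>0 t = fold_dual orb (\<gamma> t)" for t
    by (simp add: \<theta>0_def \<gamma>_def fold_dual_quad_path)
  have vel0: "pairing n (tri_velocity \<theta>0 t) = pairing (fold_map orb n) (\<gamma>' t)" for n t
    by (simp add: \<theta>0_def \<gamma>'_def pairing_fold_dual flip: fold_dual_quad_velocity)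
  have finS: "finite S" unfolding S_def by (rule finite_quot_crossings[OF D tm])
  have finW: "finite W" using D unfolding scattering_diagram_def W_def by blast
  have wall: "is_wall b (supp D w) (elt D w)" if "w \<in> W" for w
    using scattering_wall[OF D] that by (simp add: W_def)
  have S_iff: "(w, t) \<in> S \<longleftrightarrow> w \<in> W \<and> t \<in> {0..1} \<and> tri_path \<theta>0 t \<in> supp D w" for w t
    by (auto simp: S_def quot_crossings_def W_def path0)
  let ?P = "\<lambda>w t d \<theta>. (\<exists>!t'. t' \<in> {0..1} \<and> \<bar>t' - t\<bar> < d \<and> tri_path \<theta> t' \<in> supp D w) \<and>
      (\<forall>t'. \<bar>t' - t\<bar> < d \<longrightarrow> 0 < pairing (?n w) (tri_velocity \<theta> t') * pairing (?n w) (tri_velocity \<theta>0 t))"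
  have "\<exists>d0>0. \<forall>d. 0 < d \<longrightarrow> d \<le> d0 \<longrightarrow> (\<forall>\<^sub>F \<theta> in nhds \<theta>0. ?P w t d \<theta>)" if e: "(w, t) \<in> S" for w t
  proof -
    have w: "w \<in> W" and t: "t \<in> {0..1}" and tw: "fold_dual orb (\<gamma> t) \<in> supp D w"
      using e by (auto simp: S_iff path0)
    have nz: "fold_map orb (?n w) \<noteq> 0"
      using fold_map_wall_normal[OF wall[OF w]] lat_pos_nonzero by blast
    have "fold_dual orb (\<gamma> t) \<in> perp (?n w)"
      using is_wallD(3)[OF wall[OF w]] tw by blast
    then have perp: "\<gamma> t \<in> perp (fold_map orb (?n w))" by (simp only: fold_dual_perp_iff)
    \<comment> \<open>Adaptedness replaces generality: the image point may lie on several
      hyperplanes and is still interior to each wall through it.\<close>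
    have rel: "tri_path \<theta>0 t \<in> rel_interior (supp D w)"
      using ad tame_pathD(3)[OF tm t] tw w unfolding fold_adapted_def path0 W_def by blast
    have vel: "pairing (?n w) (tri_velocity \<theta>0 t) \<noteq> 0"
      using tame_pathD(7)[OF tm nz t perp] by (simp add: vel0)
    have "t \<noteq> 0" "t \<noteq> 1"
      using tame_pathD(5,6)[OF tm nz] perp by auto
    then have t01: "0 < t" "t < 1" using t by auto
    obtain d0 where "d0 > 0" "\<And>d. 0 < d \<Longrightarrow> d \<le> d0 \<Longrightarrow> \<forall>\<^sub>F \<theta> in nhds \<theta>0. ?P w t d \<theta>"
      by (rule perturbed_single_crossing[OF is_wallD(3,7)[OF wall[OF w]] t01 rel vel]) (rule that)
    then show ?thesis by (intro exI[of _ d0] conjI allI impI)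
  qed
  then have *: "(w, t) \<in> S \<Longrightarrow> \<exists>d0>0. \<forall>d. 0 < d \<longrightarrow> d \<le> d0 \<longrightarrow> (\<forall>\<^sub>F \<theta> in nhds \<theta>0. ?P w t d \<theta>)" for w t
    by blast
  define Q where "Q e d = (\<forall>\<^sub>F \<theta> in nhds \<theta>0. ?P (fst e) (snd e) d \<theta>)" for e d
  have "\<forall>e\<in>S. \<exists>d0>0. \<forall>d. 0 < d \<longrightarrow> d \<le> d0 \<longrightarrow> Q e d"
  proof
    fix e assume "e \<in> S"
    then show "\<exists>d0>0. \<forall>d. 0 < d \<longrightarrow> d \<le> d0 \<longrightarrow> Q e d"
      using *[of "fst e" "snd e"] unfolding Q_def by simp
  qed
  then obtain d0 where d0: "\<And>e. e \<in> S \<Longrightarrow> d0 e > 0" "\<And>e d. e \<in> S \<Longrightarrow> 0 < d \<Longrightarrow> d \<le> d0 e \<Longrightarrow> Q e d"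
    by metis
  \<comment> \<open>A collects the windows allowed at the events and the gaps between distinct
    times; 1 keeps it nonempty if there are no events. Each time moves by less than d, a third of
    the minimum, so distinct times keep their order.\<close>
  define A where "A = insert 1 (d0 ` S \<union> (\<lambda>(e, e'). \<bar>snd e - snd e'\<bar>) ` {(e, e'). e \<in> S \<and> e' \<in> S \<and> snd e \<noteq> snd e'})"
  define d where "d = Min A / 3"
  have finA: "finite A"
    unfolding A_def using finS by (auto intro: finite_subset[of _ "S \<times> S"])
  have "\<And>a. a \<in> A \<Longrightarrow> 0 < a" using d0(1) by (auto simp: A_def)
  moreover have "Min A \<in> A" using finA by (intro Min_in) (auto simp: A_def)
  ultimately have d: "d > 0" by (simp add: d_def)
  have dle: "3 * d \<le> a" if "a \<in> A" for a using finA that by (simp add: d_def)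
  have d_d0: "d \<le> d0 e" if "e \<in> S" for e
    using dle[of "d0 e"] that d by (auto simp: A_def)
  have sep: "3 * d \<le> \<bar>snd e - snd e'\<bar>" if "e \<in> S" "e' \<in> S" "snd e \<noteq> snd e'" for e e'
    using that by (intro dle) (force simp: A_def)
  have "\<forall>\<^sub>F \<theta> in nhds \<theta>0. \<forall>e\<in>S. ?P (fst e) (snd e) d \<theta>"
    by (intro eventually_ball_finite finS ballI, rule d0(2)[unfolded Q_def, OF _ d d_d0])
  moreover have "\<forall>\<^sub>F \<theta> in nhds \<theta>0. \<forall>w\<in>W. \<forall>t'\<in>{0..1}. tri_path \<theta> t' \<in> supp D w \<longrightarrow>
      (\<exists>t\<in>{0..1}. tri_path \<theta>0 t \<in> supp D w \<and> \<bar>t' - t\<bar> < d)"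
    by (rule eventually_ball_finite[OF finW], rule ballI,
        rule perturbed_crossings_near[OF closed_rational_polyhedral_cone[OF is_wallD(4)[OF wall]] d])
  ultimately have "\<forall>\<^sub>F \<theta> in nhds \<theta>0. tame_path (tri_path \<theta>) (tri_velocity \<theta>) \<longrightarrow>
      fold_group orb (path_product_upto b D k (tri_path \<theta>)) = evprod b' S snd (quot_elt D \<gamma>')"
  proof eventually_elim
    case (elim \<theta>)
    show ?case
    proof
      assume tame': "tame_path (tri_path \<theta>) (tri_velocity \<theta>)"
      let ?C = "crossings D k (tri_path \<theta>)"
      have C_iff: "(w, t) \<in> ?C \<longleftrightarrow> w \<in> W \<and> t \<in> {0..1} \<and> tri_path \<theta> t \<in> supp D w" for w t
        by (auto simp: crossings_def W_def)
      define \<tau> where "\<tau> e = (THE t'. t' \<in> {0..1} \<and> \<bar>t' - snd e\<bar> < d \<and> tri_path \<theta> t' \<in> supp D (fst e))" for e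
      have \<tau>: "\<tau> e \<in> {0..1}" "\<bar>\<tau> e - snd e\<bar> < d" "tri_path \<theta> (\<tau> e) \<in> supp D (fst e)"
        and \<tau>_unique: "\<And>t'. t' \<in> {0..1} \<Longrightarrow> \<bar>t' - snd e\<bar> < d \<Longrightarrow> tri_path \<theta> t' \<in> supp D (fst e) \<Longrightarrow> t' = \<tau> e"
        if e: "e \<in> S" for e
      proof -
        have ex1: "\<exists>!t'. t' \<in> {0..1} \<and> \<bar>t' - snd e\<bar> < d \<and> tri_path \<theta> t' \<in> supp D (fst e)"
          using elim(1) e by blast
        show "\<tau> e \<in> {0..1}" "\<bar>\<tau> e - snd e\<bar> < d" "tri_path \<theta> (\<tau> e) \<in> supp D (fst e)"
          using theI'[OF ex1] unfolding \<tau>_def by blast+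
        show "\<And>t'. t' \<in> {0..1} \<Longrightarrow> \<bar>t' - snd e\<bar> < d \<Longrightarrow> tri_path \<theta> t' \<in> supp D (fst e) \<Longrightarrow> t' = \<tau> e"
          using the1_equality[OF ex1] unfolding \<tau>_def by blast
      qed
      define \<beta> where "\<beta> e = (fst e, \<tau> e)" for e
      have bij: "bij_betw \<beta> S ?C"
        unfolding bij_betw_def
      proof (intro conjI equalityI subsetI inj_onI)
        fix e e' assume e: "e \<in> S" "e' \<in> S" "\<beta> e = \<beta> e'"
        then have "\<tau> e = \<tau> e'" "fst e = fst e'" by (auto simp: \<beta>_def)
        then have "\<bar>snd e - snd e'\<bar> < 2 * d" using \<tau>(2)[OF e(1)] \<tau>(2)[OF e(2)] by linarith
        then have "snd e = snd e'" using sep[OF e(1,2)] d by fastforce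
        then show "e = e'" using \<open>fst e = fst e'\<close> by (simp add: prod_eq_iff)
      next
        fix c assume "c \<in> \<beta> ` S"
        then obtain w t where "(w, t) \<in> S" "c = (w, \<tau> (w, t))" by (auto simp: \<beta>_def)
        then show "c \<in> ?C" using \<tau>[of "(w, t)"] by (auto simp: C_iff S_iff)
      next
        fix c assume "c \<in> ?C"
        then obtain w t' where c: "c = (w, t')" "w \<in> W" "t' \<in> {0..1}" "tri_path \<theta> t' \<in> supp D w"
          by (cases c) (auto simp: C_iff)
        then obtain t where t: "t \<in> {0..1}" "tri_path \<theta>0 t \<in> supp D w" "\<bar>t' - t\<bar> < d"
          using elim(2) by blast
        then have e: "(w, t) \<in> S" using c by (simp add: S_iff)
        then have "t' = \<tau> (w, t)" using \<tau>_unique[OF e] c t by simp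
        then show "c \<in> \<beta> ` S" using e c by (intro image_eqI[of _ _ "(w, t)"]) (auto simp: \<beta>_def)
      qed
      have elt: "fold_group orb (crossing_elt D (tri_velocity \<theta>) (\<beta> e)) = quot_elt D \<gamma>' e" if e: "e \<in> S" for e
      proof -
        obtain w t where wt: "e = (w, t)" by (cases e)
        have "0 < pairing (?n w) (tri_velocity \<theta> (\<tau> e)) * pairing (?n w) (tri_velocity \<theta>0 t)"
          using elim(1) e \<tau>(2)[OF e] by (auto simp: wt)
        then have "pairing (?n w) (tri_velocity \<theta> (\<tau> e)) < 0 \<longleftrightarrow> pairing (fold_map orb (?n w)) (\<gamma>' t) < 0"
          unfolding vel0 by (auto simp: zero_less_mult_iff)
        then show ?thesis
          by (auto simp: wt \<beta>_def crossing_elt_def quot_elt_def fold_group_uminus fun_eq_iff)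
      qed
      have "path_product_upto b D k (tri_path \<theta>) =
          evprod b S (\<lambda>e. snd (\<beta> e)) (\<lambda>e. crossing_elt D (tri_velocity \<theta>) (\<beta> e))"
        unfolding path_product_upto_evprod[OF skew_b D tame'] by (rule evprod_reindex[OF bij])
      then have "fold_group orb (path_product_upto b D k (tri_path \<theta>)) =
          evprod b' S (\<lambda>e. snd (\<beta> e)) (\<lambda>e. fold_group orb (crossing_elt D (tri_velocity \<theta>) (\<beta> e)))"
        by (simp only: fold_group_evprod[OF finS])
      also have "\<dots> = evprod b' S (\<lambda>e. snd (\<beta> e)) (quot_elt D \<gamma>')"
        by (rule evprod_cong[OF finS elt])
      also have "\<dots> = evprod b' S snd (quot_elt D \<gamma>')"
      proof (rule evprod_refine[OF skew_b' finS quot_elt_carrier, symmetric])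
        fix e e' assume e: "e \<in> S" "e' \<in> S" "snd e = snd e'"
        obtain v w t where vw: "e = (v, t)" "e' = (w, t)" using e(3) by (cases e; cases e') auto
        have "general_point (\<gamma> t)"
          using e(1) tame_pathD(3)[OF tm] by (auto simp: vw S_iff)
        then show "lie_bracket b' (quot_elt D \<gamma>' e) (quot_elt D \<gamma>' e') = (\<lambda>n. 0)"
          using e(1,2) unfolding vw S_def by (rule quot_elt_commute[OF D])
      next
        fix e e' assume e: "e \<in> S" "e' \<in> S" "snd e < snd e'"
        then show "snd (\<beta> e) < snd (\<beta> e')"
          using sep[OF e(1,2)] \<tau>(2)[OF e(1)] \<tau>(2)[OF e(2)] d by (auto simp: \<beta>_def)
      qed
      finally show "fold_group orb (path_product_upto b D k (tri_path \<theta>)) = evprod b' S snd (quot_elt D \<gamma>')" .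
    qed
  qed
  then show ?thesis by (simp only: S_def \<theta>0_def \<gamma>_def \<gamma>'_def)
qed

end

section \<open>The quotient diagram\<close>

lemma finite_walls_degree:
  assumes "scattering_diagram b D"
  shows "finite {w \<in> walls D. elt D w n \<noteq> 0}"
proof (rule finite_subset)
  show "{w \<in> walls D. elt D w n \<noteq> 0} \<subseteq> {w \<in> walls D. nontriv_upto (nat (deg n)) (elt D w)}"
    unfolding nontriv_upto_def by (auto intro!: exI[of _ n])
  show "finite {w \<in> walls D. nontriv_upto (nat (deg n)) (elt D w)}"
    using assms unfolding scattering_diagram_def by blast
qed

lemma wall_sum_cong:
  assumes "\<And>w. w \<in> walls D \<Longrightarrow> elt D w n \<noteq> 0 \<Longrightarrow> x \<in> supp D w \<longleftrightarrow> y \<in> supp D w"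
  shows "wall_sum D x n = wall_sum D y n"
  unfolding wall_sum_def using assms by (intro sum.cong) auto

text \<open>Only finitely many walls have a z^n component, and they all lie in
  \<open>perp n\<close>. Those through p contain a neighbourhood of p in \<open>perp n\<close>; the
  others are closed and stay away.\<close>

lemma wall_sum_locally_constant:
  assumes D: "scattering_diagram b D"
    and p: "\<And>w. w \<in> walls D \<Longrightarrow> p \<in> supp D w \<Longrightarrow> p \<in> rel_interior (supp D w)"
  shows "\<forall>\<^sub>F y in nhds p. y \<in> perp n \<longrightarrow> wall_sum D y n = wall_sum D p n"
proof -
  let ?W = "{w \<in> walls D. elt D w n \<noteq> 0}"
  have "\<forall>\<^sub>F y in nhds p. y \<in> perp n \<longrightarrow> (y \<in> supp D w \<longleftrightarrow> p \<in> supp D w)" if w: "w \<in> ?W" for w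
  proof -
    have wall: "is_wall b (supp D w) (elt D w)" using scattering_wall[OF D] w by blast
    have n: "perp n = perp (wall_normal (supp D w))"
      using is_wall_support(2)[OF wall] w by simp
    show ?thesis
    proof (cases "p \<in> supp D w")
      case True
      then obtain r where "r > 0" "ball p r \<inter> perp n \<subseteq> supp D w"
        using p[of w] w is_wallD(7)[OF wall] unfolding mem_rel_interior_ball n by auto
      moreover have "\<forall>\<^sub>F y in nhds p. y \<in> ball p r"
        using \<open>r > 0\<close> by (intro eventually_nhds_in_open) auto
      ultimately show ?thesis using True by (auto elim!: eventually_mono)
    next
      case False
      have "\<forall>\<^sub>F y in nhds p. y \<in> - supp D w"
        using False closed_rational_polyhedral_cone[OF is_wallD(4)[OF wall]]
        by (intro eventually_nhds_in_open) auto
      then show ?thesis using False by (auto elim!: eventually_mono)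
    qed
  qed
  then have "\<forall>\<^sub>F y in nhds p. \<forall>w\<in>?W. y \<in> perp n \<longrightarrow> (y \<in> supp D w \<longleftrightarrow> p \<in> supp D w)"
    by (intro eventually_ball_finite finite_walls_degree[OF D]) blast
  then show ?thesis
    by (rule eventually_mono) (auto intro!: wall_sum_cong)
qed

section \<open>Values near the incoming direction\<close>

lemma rational_polyhedral_cone_scaleR:
  assumes "rational_polyhedral_cone C" "c > 0" "c *\<^sub>R x \<in> C" shows "x \<in> C"
proof -
  obtain F where F: "C = {x. \<forall>n\<in>F. 0 \<le> pairing n x}"
    using assms(1) unfolding rational_polyhedral_cone_def by blast
  show ?thesis using assms(2,3) unfolding F by (auto simp: pairing_scaleR zero_le_mult_iff)
qed

lemma form_dual_scale: "form_dual b (k *s n) = of_int k *\<^sub>R form_dual b n"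
  by (simp add: form_dual_def vec_eq_iff form_scale_left)

lemma form_dual_perp:
  assumes "skew_matrix b" shows "form_dual b n \<in> perp n"
proof -
  have axis: "form b n (axis j 1) = (\<Sum>i\<in>UNIV. n $ i * b i j)" for j
    by (simp add: form_def axis_def if_distrib if_distribR sum.delta cong: if_cong)
  have "pairing n (form_dual b n) = of_int (\<Sum>j\<in>UNIV. \<Sum>i\<in>UNIV. n $ i * n $ j * b i j)"
    by (simp add: pairing_def form_dual_def axis sum_distrib_left algebra_simps)
  also have "(\<Sum>j\<in>UNIV. \<Sum>i\<in>UNIV. n $ i * n $ j * b i j) = form b n n"
    unfolding form_def by (rule sum.swap)
  also have "\<dots> = 0" by (rule form_self[OF assms])
  finally show ?thesis by (simp add: perp_iff)
qed

lemma dilog_nonzero: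
  assumes "dilog i n \<noteq> 0" shows "perp n = perp (axis i 1)"
proof -
  obtain k :: nat where "1 \<le> k" "n = of_nat k *s axis i 1"
    using assms unfolding dilog_def by (metis (mono_tags, lifting) mem_Collect_eq sum.neutral)
  then show ?thesis using perp_scale[of "of_nat k" "axis i 1"] by simp
qed

text \<open>A wall with z^n component containing {n, .} also contains {n0, .} for its normal n0, as
  it is a cone, and so is incoming. All other such walls are closed and miss a neighbourhood. An
  incoming wall with z^n component is the whole of \<open>perp n\<close>, hence contains y.\<close>

lemma seed_wall_sum_near:
  assumes S: "seed_diagram b c S"
  shows "\<forall>\<^sub>F y in nhds (form_dual b n). y \<in> perp n \<longrightarrow> wall_sum S y n = - (\<Sum>i\<in>UNIV. of_nat (c i) * dilog i n)"
proof -
  have D: "scattering_diagram b S" using S by (simp add: seed_diagram_def)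
  obtain \<sigma> where \<sigma>: "bij_betw \<sigma> UNIV (incoming_walls b S)"
    "\<And>i. supp S (\<sigma> i) = perp (axis i 1)" "\<And>i. elt S (\<sigma> i) = (\<lambda>n. - (of_nat (c i) * dilog i n))"
    using S unfolding seed_diagram_def by blast
  let ?W = "{w \<in> walls S. elt S w n \<noteq> 0}"
  have "\<forall>\<^sub>F y in nhds (form_dual b n). y \<in> supp S w \<longrightarrow> w \<in> range \<sigma>" if w: "w \<in> ?W" for w
  proof -
    have wall: "is_wall b (supp S w) (elt S w)" using scattering_wall[OF D] w by blast
    show ?thesis
    proof (cases "form_dual b n \<in> supp S w")
      case True
      obtain k :: nat where k: "1 \<le> k" "n = of_nat k *s wall_normal (supp S w)"
        using is_wall_support(1)[OF wall] w by blast
      have pos: "0 < real_of_int (int k)" using k(1) by simp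
      have "of_int (int k) *\<^sub>R form_dual b (wall_normal (supp S w)) \<in> supp S w"
        using True unfolding k(2) form_dual_scale by simp
      then have "form_dual b (wall_normal (supp S w)) \<in> supp S w"
        by (rule rational_polyhedral_cone_scaleR[OF is_wallD(4)[OF wall] pos])
      then have "w \<in> incoming_walls b S" using w by (simp add: incoming_walls_def)
      then have "w \<in> range \<sigma>" using \<sigma>(1) by (simp add: bij_betw_def)
      then show ?thesis by simp
    next
      case False
      have "\<forall>\<^sub>F y in nhds (form_dual b n). y \<in> - supp S w"
        using False closed_rational_polyhedral_cone[OF is_wallD(4)[OF wall]]
        by (intro eventually_nhds_in_open) auto
      then show ?thesis by (rule eventually_mono) simp
    qed
  qed
  then have "\<forall>\<^sub>F y in nhds (form_dual b n). \<forall>w\<in>?W. y \<in> supp S w \<longrightarrow> w \<in> range \<sigma>"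
    by (intro eventually_ball_finite finite_walls_degree[OF D]) blast
  then show ?thesis
  proof eventually_elim
    case (elim y)
    show ?case
    proof
      assume y: "y \<in> perp n"
      have inj: "inj \<sigma>" using \<sigma>(1) by (simp add: bij_betw_def)
      have walls: "\<sigma> i \<in> walls S" for i
        using \<sigma>(1) by (auto simp: bij_betw_def incoming_walls_def)
      have eq: "{w. w \<in> walls S \<and> y \<in> supp S w \<and> elt S w n \<noteq> 0} = \<sigma> ` {i. elt S (\<sigma> i) n \<noteq> 0}"
      proof (intro equalityI subsetI)
        fix w assume "w \<in> {w. w \<in> walls S \<and> y \<in> supp S w \<and> elt S w n \<noteq> 0}"
        then show "w \<in> \<sigma> ` {i. elt S (\<sigma> i) n \<noteq> 0}" using elim by blast
      next
        fix w assume "w \<in> \<sigma> ` {i. elt S (\<sigma> i) n \<noteq> 0}"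
        then obtain i where i: "w = \<sigma> i" "elt S (\<sigma> i) n \<noteq> 0" by blast
        then have "dilog i n \<noteq> 0" by (simp add: \<sigma>(3))
        then have "y \<in> supp S (\<sigma> i)" using y dilog_nonzero[of i n] by (simp add: \<sigma>(2))
        then show "w \<in> {w. w \<in> walls S \<and> y \<in> supp S w \<and> elt S w n \<noteq> 0}" using i walls by simp
      qed
      have "wall_sum S y n = (\<Sum>i | elt S (\<sigma> i) n \<noteq> 0. elt S (\<sigma> i) n)"
        unfolding wall_sum_def eq using inj by (subst sum.reindex) (auto intro: inj_on_subset)
      also have "\<dots> = (\<Sum>i\<in>UNIV. elt S (\<sigma> i) n)"
        by (rule sum.mono_neutral_left) auto
      finally show "wall_sum S y n = - (\<Sum>i\<in>UNIV. of_nat (c i) * dilog i n)"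
        by (simp add: \<sigma>(3) sum_negf)
    qed
  qed
qed

context folding
begin

lemma linear_fold_dual: "linear (fold_dual orb)"
  by (rule linearI) (simp_all add: vec_eq_iff fold_dual_nth)

lemma inj_fold_dual: "inj (fold_dual orb)"
proof (rule injI)
  fix x y :: "real ^ 'j" assume eq: "fold_dual orb x = fold_dual orb y"
  have "x $ k = y $ k" for k
  proof -
    obtain i where "i \<in> orb k" using orb_nonempty by blast
    then show ?thesis using arg_cong[OF eq, of "\<lambda>v. v $ i"] by (simp add: fold_dual_nth in_orb_iff)
  qed
  then show "x = y" by (simp add: vec_eq_iff)
qed

lemma continuous_fold_dual: "continuous_on S (fold_dual orb)"
  using linear_fold_dual by (simp add: linear_continuous_on linear_linear)

text \<open>Matches the base points of the two comparisons: a neighbourhood of {m, .} is sent near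
  {n, .} for every n over m.\<close>

lemma fold_dual_form_dual: "fold_dual orb (form_dual b' (fold_map orb n)) = form_dual b n"
  by (simp add: vec_eq_iff fold_dual_nth form_dual_def form_fold_map flip: fold_map_axis)

text \<open>All dilogarithms of one orbit become equal after folding, which is the origin of the
  multiplicity \<open>card (orb j)\<close>.\<close>

lemma fold_group_dilog: "fold_group orb (dilog i) = dilog (orbit_of i)"
proof
  fix m
  let ?K = "\<lambda>n :: int ^ 'i. {k::nat. 1 \<le> k \<and> n = of_nat k *s axis i 1}"
  let ?c = "\<lambda>k::nat. (- 1) ^ k / of_nat k ^ 2 :: complex"
  have inj: "k = l" if "of_nat k *s axis i 1 = (of_nat l *s axis i 1 :: int ^ 'i)" for k l :: nat
    using arg_cong[OF that, of "\<lambda>v. v $ i"] by simp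
  have finK: "finite (?K n)" for n
  proof (cases "?K n = {}")
    case False
    then obtain k where "k \<in> ?K n" by blast
    then have "?K n \<subseteq> {k}" using inj by auto
    then show ?thesis by (rule finite_subset) simp
  qed (simp only: finite.emptyI)
  have "fold_group orb (dilog i) m = (\<Sum>(n, k)\<in>Sigma {n. n \<in> lat_pos \<and> fold_map orb n = m} ?K. ?c k)"
    unfolding fold_group_def dilog_def by (rule sum.Sigma[OF finite_fold_fibre]) (use finK in blast)
  also have "\<dots> = (\<Sum>k | 1 \<le> k \<and> m = of_nat k *s axis (orbit_of i) 1. ?c k)"
  proof (rule sum.reindex_bij_witness[of _ "\<lambda>k. (of_nat k *s axis i 1, k)" snd])
    fix k :: nat assume k: "k \<in> {k. 1 \<le> k \<and> m = of_nat k *s axis (orbit_of i) 1}"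
    have "(of_nat k *s axis i 1 :: int ^ 'i) $ i \<noteq> 0" using k by simp
    then have "of_nat k *s axis i 1 \<noteq> (0 :: int ^ 'i)" by force
    then have "of_nat k *s axis i 1 \<in> (lat_pos :: (int ^ 'i) set)"
      by (simp add: lat_pos_def axis_def)
    with k show "(of_nat k *s axis i 1, k) \<in> Sigma {n. n \<in> lat_pos \<and> fold_map orb n = m} ?K"
      by (simp add: fold_map_scale fold_map_axis)
  qed (auto simp: fold_map_scale fold_map_axis)
  finally show "fold_group orb (dilog i) m = dilog (orbit_of i) m" by (simp add: dilog_def)
qed

lemma fold_group_nonzeroE:
  assumes "fold_group orb g m \<noteq> 0"
  obtains n where "n \<in> lat_pos" "fold_map orb n = m" "g n \<noteq> 0"
  using assms unfolding fold_group_def by (metis (mono_tags, lifting) mem_Collect_eq sum.neutral)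

lemma nontriv_upto_fold_group: "nontriv_upto k (fold_group orb g) \<Longrightarrow> nontriv_upto k g"
  unfolding nontriv_upto_def by (metis deg_fold_map fold_group_nonzeroE)

lemma quotient_supp: "supp (quotient_diagram orb D) w = fold_dual orb -` supp D w"
  by (auto simp: quotient_diagram_def)

lemma aff_dim_range_fold_dual: "aff_dim (range (fold_dual orb)) = int CARD('j)"
  using aff_dim_injective_linear_image[OF linear_fold_dual inj_fold_dual, of UNIV] by simp

lemma aff_dim_quotient_supp: "aff_dim (C \<inter> range (fold_dual orb)) = aff_dim (fold_dual orb -` C)"
  using aff_dim_injective_linear_image[OF linear_fold_dual inj_fold_dual, of "fold_dual orb -` C"]
  by (simp add: image_vimage_eq)

lemma quotient_wall_subset:
  assumes "is_wall b C g" shows "fold_dual orb -` C \<subseteq> perp (fold_map orb (wall_normal C))"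
  using is_wallD(3)[OF assms] fold_dual_perp_iff by blast

text \<open>The normal of a quotient wall is the primitive part of the image of the old normal;
  finiteness in each order is inherited because folding preserves degrees.\<close>

lemma scattering_quotient:
  assumes D: "scattering_diagram b D"
  shows "scattering_diagram b' (quotient_diagram orb D)"
  unfolding scattering_diagram_def
proof (intro conjI ballI allI)
  fix w assume w: "w \<in> walls (quotient_diagram orb D)"
  let ?C = "supp D w"
  have elt: "elt (quotient_diagram orb D) w = fold_group orb (elt D w)"
    by (simp add: quotient_diagram_def)
  have wall: "is_wall b ?C (elt D w)"
    using w scattering_wall[OF D] by (simp add: quotient_diagram_def nontriv_walls_def)
  obtain n0 and j :: nat where n0: "n0 \<in> lat_pos" "primitive_vec n0" "1 \<le> j"
    "fold_map orb (wall_normal ?C) = of_nat j *s n0" "fold_group orb (elt D w) \<in> carrier (par_group b' n0)"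
    by (rule fold_group_par[OF wall])
  have "fold_dual orb -` ?C \<subseteq> perp n0"
    using quotient_wall_subset[OF wall] perp_scale[of "of_nat j" n0] n0(3,4) by simp
  moreover have "rational_polyhedral_cone (fold_dual orb -` ?C)"
  proof -
    obtain F where F: "finite F" "?C = {x. \<forall>n\<in>F. 0 \<le> pairing n x}"
      using is_wallD(4)[OF wall] unfolding rational_polyhedral_cone_def by blast
    then have "fold_dual orb -` ?C = {x. \<forall>n\<in>fold_map orb ` F. 0 \<le> pairing n x}"
      by (auto simp: pairing_fold_dual)
    then show ?thesis unfolding rational_polyhedral_cone_def using F(1) by blast
  qed
  moreover have "aff_dim (fold_dual orb -` ?C) = int CARD('j) - 1"
    using w by (simp add: quotient_diagram_def aff_dim_range_fold_dual aff_dim_quotient_supp)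
  ultimately show "is_wall b' (supp (quotient_diagram orb D) w) (elt (quotient_diagram orb D) w)"
    unfolding is_wall_def quotient_supp elt using n0 by blast
next
  fix k
  have "{w \<in> walls (quotient_diagram orb D). nontriv_upto k (elt (quotient_diagram orb D) w)}
      \<subseteq> {w \<in> walls D. nontriv_upto k (elt D w)}"
    using nontriv_upto_fold_group by (auto simp: quotient_diagram_def nontriv_walls_def)
  then show "finite {w \<in> walls (quotient_diagram orb D). nontriv_upto k (elt (quotient_diagram orb D) w)}"
    using D finite_subset unfolding scattering_diagram_def by blast
qed

text \<open>The image of x is interior to the wall, so the preimage of the wall contains a
  neighbourhood of x in the hyperplane of the folded normal. The codimension condition in the
  quotient therefore discards no nontrivial wall that is visible from a general point.\<close>

lemma quotient_walls_general:
  assumes D: "scattering_diagram b D" and ad: "fold_adapted orb D" and x: "general_point x"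
    and w: "w \<in> walls D" "fold_dual orb x \<in> supp D w" "nontriv (elt D w)"
  shows "w \<in> walls (quotient_diagram orb D)"
proof -
  let ?C = "supp D w" and ?n = "wall_normal (supp D w)"
  have wall: "is_wall b ?C (elt D w)" by (rule scattering_wall[OF D w(1)])
  have "fold_dual orb x \<in> rel_interior ?C" using ad x w unfolding fold_adapted_def by blast
  then obtain r where r: "r > 0" "ball (fold_dual orb x) r \<inter> perp ?n \<subseteq> ?C"
    unfolding mem_rel_interior_ball is_wallD(7)[OF wall] by blast
  let ?P = "perp (fold_map orb ?n)" and ?B = "fold_dual orb -` ball (fold_dual orb x) r"
  have P: "affine ?P" unfolding perp_inner by (rule affine_hyperplane)
  have "open ?B" using continuous_fold_dual by (intro open_vimage) auto
  moreover have "x \<in> ?P" using quotient_wall_subset[OF wall] w(2) by blast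
  then have "?P \<inter> ?B \<noteq> {}" using r(1) by auto
  ultimately have "affine hull (?P \<inter> ?B) = affine hull ?P"
    by (rule affine_hull_affine_Int_open[OF P])
  then have hull: "affine hull (?P \<inter> ?B) = ?P"
    using P by (simp only: affine_hull_eq)
  have "?P \<inter> ?B \<subseteq> fold_dual orb -` ?C"
    using r(2) by (auto simp: fold_dual_perp_iff[symmetric])
  then have "aff_dim ?P \<le> aff_dim (fold_dual orb -` ?C)"
    using aff_dim_subset[of "?P \<inter> ?B" "fold_dual orb -` ?C"] aff_dim_affine_hull[of "?P \<inter> ?B"] hull by simp
  moreover have "aff_dim (fold_dual orb -` ?C) \<le> aff_dim ?P"
    using quotient_wall_subset[OF wall] by (rule aff_dim_subset)
  moreover have "aff_dim ?P = int CARD('j) - 1"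
    unfolding perp_inner using lat_pos_nonzero[OF fold_map_wall_normal[OF wall]]
    by (subst aff_dim_hyperplane) auto
  ultimately show ?thesis
    using w by (simp add: quotient_diagram_def nontriv_walls_def aff_dim_range_fold_dual aff_dim_quotient_supp)
qed

text \<open>The first form is indexed by walls of D, as the events along a path are. The second
  reduces the sum to values of D, where equivalence with the seed diagram becomes available.\<close>

lemma wall_sum_quotient:
  assumes D: "scattering_diagram b D" and ad: "fold_adapted orb D" and x: "general_point x"
  shows "wall_sum (quotient_diagram orb D) x m =
      (\<Sum>w | w \<in> walls D \<and> fold_dual orb x \<in> supp D w \<and> fold_group orb (elt D w) m \<noteq> 0. fold_group orb (elt D w) m)"
    and "wall_sum (quotient_diagram orb D) x m = fold_group orb (wall_sum D (fold_dual orb x)) m"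
proof -
  let ?Q = "quotient_diagram orb D" and ?y = "fold_dual orb x"
  have elt: "elt ?Q w = fold_group orb (elt D w)" for w
    by (simp add: quotient_diagram_def)
  have "nontriv (elt D w)" if "fold_group orb (elt D w) m \<noteq> 0" for w
    using that by (auto simp: nontriv_def fold_group_0)
  then have "{w. w \<in> walls ?Q \<and> x \<in> supp ?Q w \<and> elt ?Q w m \<noteq> 0} =
      {w. w \<in> walls D \<and> ?y \<in> supp D w \<and> fold_group orb (elt D w) m \<noteq> 0}"
    using quotient_walls_general[OF D ad x]
    by (auto simp: quotient_supp elt) (auto simp: quotient_diagram_def nontriv_walls_def)
  then show 1: "wall_sum ?Q x m =
      (\<Sum>w | w \<in> walls D \<and> ?y \<in> supp D w \<and> fold_group orb (elt D w) m \<noteq> 0. fold_group orb (elt D w) m)"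
    unfolding wall_sum_def elt by simp
  define W where "W = {w. w \<in> walls D \<and> ?y \<in> supp D w \<and> nontriv_upto (nat (deg m)) (elt D w)}"
  have finW: "finite W"
    using D unfolding scattering_diagram_def W_def
    by (elim conjE allE[of _ "nat (deg m)"]) (auto elim!: finite_subset[rotated])
  have "(\<Sum>w | w \<in> walls D \<and> ?y \<in> supp D w \<and> fold_group orb (elt D w) m \<noteq> 0. fold_group orb (elt D w) m)
      = (\<Sum>w\<in>W. fold_group orb (elt D w) m)"
  proof (rule sum.mono_neutral_left[OF finW])
    show "{w. w \<in> walls D \<and> ?y \<in> supp D w \<and> fold_group orb (elt D w) m \<noteq> 0} \<subseteq> W"
      unfolding W_def by (auto intro!: nontriv_upto_fold_group) (auto simp: nontriv_upto_def intro!: exI[of _ m])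
  qed (auto simp: W_def)
  also have "\<dots> = (\<Sum>n | n \<in> lat_pos \<and> fold_map orb n = m. \<Sum>w\<in>W. elt D w n)"
    unfolding fold_group_def by (rule sum.swap)
  also have "\<dots> = fold_group orb (wall_sum D ?y) m"
    unfolding fold_group_def
  proof (rule sum.cong[OF refl])
    fix n assume n: "n \<in> {n. n \<in> lat_pos \<and> fold_map orb n = m}"
    then have "nontriv_upto (nat (deg m)) (elt D w)" if "elt D w n \<noteq> 0" for w
      using that deg_fold_map[of n] by (auto simp: nontriv_upto_def intro!: exI[of _ n])
    then show "(\<Sum>w\<in>W. elt D w n) = wall_sum D ?y n"
      unfolding wall_sum_def by (intro sum.mono_neutral_right finW) (auto simp: W_def)
  qed
  finally show "wall_sum ?Q x m = fold_group orb (wall_sum D ?y) m" using 1 by simp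
qed

text \<open>Equivalence of D and S compares only general points, and \<open>fold_dual orb x\<close>
  need not be one. Since the sum of D is locally constant on \<open>perp n\<close> there, it can be
  read off at a nearby general point y, where the value of S is known.\<close>

lemma quotient_wall_sum_near:
  assumes D: "scattering_diagram b D" and ad: "fold_adapted orb D"
    and S: "seed_diagram b (\<lambda>i. 1) S" and eq: "equivalent_diagrams b D S"
  shows "\<forall>\<^sub>F x in nhds (form_dual b' m). x \<in> perp m \<longrightarrow> general_point x \<longrightarrow>
    wall_sum (quotient_diagram orb D) x m = - (\<Sum>j\<in>UNIV. of_nat (card (orb j)) * dilog j m)"
proof -
  let ?N = "{n. n \<in> lat_pos \<and> fold_map orb n = m}"
  have S': "scattering_diagram b S" using S by (simp add: seed_diagram_def)
  have "\<forall>\<^sub>F x in nhds (form_dual b' m). x \<in> perp m \<longrightarrow> general_point x \<longrightarrow>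
      wall_sum D (fold_dual orb x) n = - (\<Sum>i\<in>UNIV. dilog i n)" if n: "n \<in> ?N" for n
  proof -
    have "\<forall>\<^sub>F y in nhds (form_dual b n). y \<in> perp n \<longrightarrow> wall_sum S y n = - (\<Sum>i\<in>UNIV. dilog i n)"
      using seed_wall_sum_near[OF S, of n] by simp
    then obtain U where U: "open U" "form_dual b n \<in> U"
      "\<And>y. y \<in> U \<Longrightarrow> y \<in> perp n \<Longrightarrow> wall_sum S y n = - (\<Sum>i\<in>UNIV. dilog i n)"
      unfolding eventually_nhds by blast
    have "form_dual b' m \<in> fold_dual orb -` U"
      using U(2) n fold_dual_form_dual[of n] by auto
    moreover have "open (fold_dual orb -` U)"
      using continuous_fold_dual U(1) by (intro open_vimage) auto
    ultimately have "\<forall>\<^sub>F x in nhds (form_dual b' m). x \<in> fold_dual orb -` U"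
      by (rule eventually_nhds_in_open[rotated])
    then show ?thesis
    proof eventually_elim
      case (elim x)
      show ?case
      proof (intro impI)
        assume x: "x \<in> perp m" "general_point x"
        let ?p = "fold_dual orb x"
        have p: "?p \<in> perp n" using x(1) n by (simp add: fold_dual_perp_iff)
        have "\<forall>\<^sub>F y in nhds ?p. y \<in> perp n \<longrightarrow> wall_sum D y n = wall_sum D ?p n"
          using ad x(2) unfolding fold_adapted_def by (intro wall_sum_locally_constant[OF D]) blast
        moreover have "\<forall>\<^sub>F y in nhds ?p. y \<in> U"
          using elim U(1) by (intro eventually_nhds_in_open) auto
        ultimately have "\<forall>\<^sub>F y in nhds ?p. y \<in> U \<and> (y \<in> perp n \<longrightarrow> wall_sum D y n = wall_sum D ?p n)"
          by eventually_elim blast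
        then obtain e where e: "e > 0" "\<And>y. dist y ?p < e \<Longrightarrow> y \<in> U \<and> (y \<in> perp n \<longrightarrow> wall_sum D y n = wall_sum D ?p n)"
          unfolding eventually_nhds_metric by blast
        obtain y where y: "y \<in> perp n" "general_point y" "dist y ?p < e"
          using general_point_dense[OF lat_pos_nonzero p e(1)] n by blast
        have "wall_sum D ?p n = wall_sum D y n" using e(2)[OF y(3)] y(1) by simp
        also have "\<dots> = wall_sum S y n"
          using eq y(2) elt_at_wall_sum[OF skew_b D y(2)] elt_at_wall_sum[OF skew_b S' y(2)]
          unfolding equivalent_diagrams_def by simp
        also have "\<dots> = - (\<Sum>i\<in>UNIV. dilog i n)"
          using U(3) e(2)[OF y(3)] y(1) by blast
        finally show "wall_sum D ?p n = - (\<Sum>i\<in>UNIV. dilog i n)" .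
      qed
    qed
  qed
  then have "\<forall>\<^sub>F x in nhds (form_dual b' m). \<forall>n\<in>?N. x \<in> perp m \<longrightarrow> general_point x \<longrightarrow>
      wall_sum D (fold_dual orb x) n = - (\<Sum>i\<in>UNIV. dilog i n)"
    by (intro eventually_ball_finite finite_fold_fibre) blast
  then show ?thesis
  proof eventually_elim
    case (elim x)
    show ?case
    proof (intro impI)
      assume x: "x \<in> perp m" "general_point x"
      have "wall_sum (quotient_diagram orb D) x m = (\<Sum>n\<in>?N. - (\<Sum>i\<in>UNIV. dilog i n))"
        unfolding wall_sum_quotient(2)[OF D ad x(2)] fold_group_def
        using elim x by (intro sum.cong) auto
      also have "\<dots> = - (\<Sum>i\<in>UNIV. fold_group orb (dilog i) m)"
        unfolding fold_group_def by (simp add: sum_negf sum.swap[of _ UNIV])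
      also have "(\<Sum>i\<in>UNIV. fold_group orb (dilog i) m) = (\<Sum>j\<in>UNIV. \<Sum>i\<in>orb j. dilog j m)"
        unfolding fold_group_dilog by (rule sum_orb[symmetric])
      finally show "wall_sum (quotient_diagram orb D) x m = - (\<Sum>j\<in>UNIV. of_nat (card (orb j)) * dilog j m)"
        by simp
    qed
  qed
qed

end

section \<open>Comparison of path-ordered products degree by degree\<close>

definition degree_sign :: "int ^ 'n::finite \<Rightarrow> real ^ 'n \<Rightarrow> complex" where
  "degree_sign n v = (if pairing n v < 0 then 1 else - 1)"

lemma degree_sign_scale: "k > 0 \<Longrightarrow> degree_sign (k *s n) v = degree_sign n v"
  by (simp add: degree_sign_def pairing_scale_left mult_less_0_iff)

lemma degree_sign_wall:
  assumes "is_wall b C g" "g n \<noteq> 0" shows "degree_sign n v = degree_sign (wall_normal C) v"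
proof -
  obtain k :: nat where "1 \<le> k" "n = of_nat k *s wall_normal C"
    using is_wall_support(1)[OF assms] by blast
  then show ?thesis using degree_sign_scale[of "of_nat k" "wall_normal C" v] by simp
qed

text \<open>A wall with z^n component has a normal of which n is a positive multiple, so the
  crossing sign can be read off from n. In degree n all diagrams then carry the same sign.\<close>

lemma signed_local_elt:
  assumes b: "skew_matrix b" and D: "scattering_diagram b D" and \<gamma>: "tame_path \<gamma> \<gamma>'"
    and t: "t \<in> {0..1}" and n: "deg n \<le> int k"
  shows "of_int (crossing_sign D k \<gamma> t) * local_elt b D k (\<gamma> t) n = degree_sign n (\<gamma>' t) * wall_sum D (\<gamma> t) n"
proof -
  have "of_int (crossing_sign D k \<gamma> t) * elt D w n = degree_sign n (\<gamma>' t) * elt D w n"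
    if w: "w \<in> walls_at D k (\<gamma> t)" for w
  proof (cases "elt D w n = 0")
    case False
    have "(w, t) \<in> crossings D k \<gamma>" and "w \<in> walls D"
      using w t by (auto simp: crossings_def walls_at_def)
    then have "of_int (crossing_sign D k \<gamma> t) = degree_sign (wall_normal (supp D w)) (\<gamma>' t)"
      using crossing_sign_eq[OF D \<gamma>] by (auto simp: degree_sign_def)
    then show ?thesis
      using degree_sign_wall[OF scattering_wall[OF D \<open>w \<in> walls D\<close>] False] by simp
  qed simp
  then have "of_int (crossing_sign D k \<gamma> t) * local_elt b D k (\<gamma> t) n = degree_sign n (\<gamma>' t) * local_elt b D k (\<gamma> t) n"
    unfolding local_elt_eq[OF b D tame_pathD(3)[OF \<gamma> t]] sum_distrib_left by (intro sum.cong) auto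
  then show ?thesis
    using local_elt_wall_sum[OF b D tame_pathD(3)[OF \<gamma> t] n] by simp
qed

context folding
begin

text \<open>The counterpart of \<open>signed_local_elt\<close> for events of the quotient, where
  again n determines the sign.\<close>

lemma quot_elt_sum:
  assumes D: "scattering_diagram b D" and ad: "fold_adapted orb D" and \<gamma>: "tame_path \<gamma> \<gamma>'"
    and t: "t \<in> {0..1}" and n: "deg n \<le> int k"
  shows "(\<Sum>e | e \<in> quot_crossings D k \<gamma> \<and> snd e = t. quot_elt D \<gamma>' e n) =
    degree_sign n (\<gamma>' t) * wall_sum (quotient_diagram orb D) (\<gamma> t) n"
proof -
  let ?W = "{w. w \<in> walls D \<and> nontriv_upto k (elt D w) \<and> fold_dual orb (\<gamma> t) \<in> supp D w}"
  let ?V = "{w. w \<in> walls D \<and> fold_dual orb (\<gamma> t) \<in> supp D w \<and> fold_group orb (elt D w) n \<noteq> 0}"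
  have fin: "finite ?W"
    using D unfolding scattering_diagram_def by (elim conjE allE[of _ k]) (auto elim!: finite_subset[rotated])
  have "(\<Sum>e | e \<in> quot_crossings D k \<gamma> \<and> snd e = t. quot_elt D \<gamma>' e n) = (\<Sum>w\<in>?W. quot_elt D \<gamma>' (w, t) n)"
    by (rule sum.reindex_bij_witness[of _ "\<lambda>w. (w, t)" fst]) (use t in \<open>auto simp: quot_crossings_def\<close>)
  also have "\<dots> = (\<Sum>w\<in>?W. degree_sign n (\<gamma>' t) * fold_group orb (elt D w) n)"
  proof (rule sum.cong[OF refl])
    fix w assume w: "w \<in> ?W"
    show "quot_elt D \<gamma>' (w, t) n = degree_sign n (\<gamma>' t) * fold_group orb (elt D w) n"
    proof (cases "fold_group orb (elt D w) n = 0")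
      case False
      then obtain m where m: "fold_map orb m = n" "elt D w m \<noteq> 0" by (rule fold_group_nonzeroE)
      have wall: "is_wall b (supp D w) (elt D w)" using scattering_wall[OF D] w by blast
      obtain j :: nat where "1 \<le> j" "m = of_nat j *s wall_normal (supp D w)"
        using is_wall_support(1)[OF wall m(2)] by blast
      then have "degree_sign n (\<gamma>' t) = degree_sign (fold_map orb (wall_normal (supp D w))) (\<gamma>' t)"
        using degree_sign_scale[of "of_nat j"] m(1) by (auto simp: fold_map_scale)
      then show ?thesis by (simp add: quot_elt_def degree_sign_def)
    qed (simp add: quot_elt_def)
  qed
  also have "\<dots> = (\<Sum>w\<in>?V. degree_sign n (\<gamma>' t) * fold_group orb (elt D w) n)"
  proof (rule sum.mono_neutral_right[OF fin])
    have "nontriv_upto k (elt D w)" if "fold_group orb (elt D w) n \<noteq> 0" for w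
      by (rule nontriv_upto_fold_group) (use that n in \<open>auto simp: nontriv_upto_def\<close>)
    then show "?V \<subseteq> ?W" by auto
  qed auto
  also have "\<dots> = degree_sign n (\<gamma>' t) * wall_sum (quotient_diagram orb D) (\<gamma> t) n"
    unfolding wall_sum_quotient(1)[OF D ad tame_pathD(3)[OF \<gamma> t]] sum_distrib_left ..
  finally show ?thesis .
qed

text \<open>The factors agree below deg m by the induction hypothesis, so in degree m the products
  differ by a sum over times. Only t0 contributes, since z^m components occur only on
  \<open>perp m\<close>.\<close>

lemma path_product_difference:
  assumes D: "scattering_diagram b D" and ad: "fold_adapted orb D" and E: "scattering_diagram b' E"
    and \<gamma>: "tame_path \<gamma> \<gamma>'" and t0: "t0 \<in> {0..1}" "\<And>t. t \<in> {0..1} \<Longrightarrow> \<gamma> t \<in> perp m \<Longrightarrow> t = t0"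
    and k: "deg m = int k"
    and IH: "\<And>n x. deg n < deg m \<Longrightarrow> general_point x \<Longrightarrow> wall_sum (quotient_diagram orb D) x n = wall_sum E x n"
  shows "evprod b' (quot_crossings D k \<gamma>) snd (quot_elt D \<gamma>') m - path_product_upto b' E k \<gamma> m =
    degree_sign m (\<gamma>' t0) * (wall_sum (quotient_diagram orb D) (\<gamma> t0) m - wall_sum E (\<gamma> t0) m)"
proof -
  let ?Q = "quotient_diagram orb D"
  have Q: "scattering_diagram b' ?Q" by (rule scattering_quotient[OF D])
  define A where "A = snd ` quot_crossings D k \<gamma>"
  define B where "B = crossing_times E k \<gamma>"
  \<comment> \<open>A common set of times for both products; t0 is included even if neither diagram
    has a crossing there, and its factors are then trivial.\<close>
  define T where "T = insert t0 (A \<union> B)"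
  define hQ where "hQ t n = (\<Sum>e | e \<in> quot_crossings D k \<gamma> \<and> snd e = t. quot_elt D \<gamma>' e n)" for t n
  define hE where "hE t n = of_int (crossing_sign E k \<gamma> t) * local_elt b' E k (\<gamma> t) n" for t n
  have finA: "finite A" unfolding A_def using finite_quot_crossings[OF D \<gamma>] by blast
  have finB: "finite B"
    unfolding B_def crossing_times_crossings using finite_crossings[OF E \<gamma>] by blast
  have finT: "finite T" using finA finB by (simp add: T_def)
  have T01: "t \<in> {0..1}" if "t \<in> T" for t
    using that t0(1) by (auto simp: T_def A_def B_def quot_crossings_def crossing_times_def)
  have carQ: "hQ t \<in> lie_carrier" for t
    unfolding hQ_def by (intro lie_carrier_sum quot_elt_carrier)
  have carE: "hE t \<in> lie_carrier" if "t \<in> T" for t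
    using local_elt_carrier[OF skew_b' E tame_pathD(3)[OF \<gamma> T01[OF that]]]
    by (simp add: lie_carrier_def hE_def)
  have "evprod b' (quot_crossings D k \<gamma>) snd (quot_elt D \<gamma>') = ordprod b' A hQ"
    unfolding evprod_def A_def hQ_def[abs_def] ..
  also have "\<dots> = ordprod b' T hQ"
  proof (rule ordprod_superset[OF skew_b' finT, symmetric])
    fix t assume "t \<in> T - A"
    then have "{e. e \<in> quot_crossings D k \<gamma> \<and> snd e = t} = {}"
      unfolding A_def by (force simp: image_iff)
    then show "hQ t = (\<lambda>n. 0)" unfolding hQ_def by (simp only: sum.empty)
  qed (use carQ in \<open>auto simp: T_def\<close>)
  finally have 1: "evprod b' (quot_crossings D k \<gamma>) snd (quot_elt D \<gamma>') = ordprod b' T hQ" .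
  have "path_product_upto b' E k \<gamma> = ordprod b' B hE"
    unfolding B_def hE_def[abs_def] by (rule path_product_upto_ordprod[OF skew_b' E \<gamma>])
  also have "\<dots> = ordprod b' T hE"
  proof (rule ordprod_superset[OF skew_b' finT, symmetric])
    fix t assume t: "t \<in> T - B"
    then have "walls_at E k (\<gamma> t) = {}" using T01 by (auto simp: B_def crossing_times_def)
    then have "local_elt b' E k (\<gamma> t) = (\<lambda>n. 0)"
      using local_elt_eq[OF skew_b' E tame_pathD(3)[OF \<gamma> T01]] t by simp
    then show "hE t = (\<lambda>n. 0)" unfolding hE_def by simp
  qed (use carE in \<open>auto simp: T_def\<close>)
  finally have 2: "path_product_upto b' E k \<gamma> = ordprod b' T hE" .
  have hQ: "hQ t n = degree_sign n (\<gamma>' t) * wall_sum ?Q (\<gamma> t) n" if "t \<in> T" "deg n \<le> int k" for t n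
    unfolding hQ_def using that by (intro quot_elt_sum[OF D ad \<gamma> T01]) auto
  have hE: "hE t n = degree_sign n (\<gamma>' t) * wall_sum E (\<gamma> t) n" if "t \<in> T" "deg n \<le> int k" for t n
    unfolding hE_def using that by (intro signed_local_elt[OF skew_b' E \<gamma> T01]) auto
  have agree: "agree_below (int k) (hQ t) (hE t)" if "t \<in> T" for t
    unfolding agree_below_def
    using hQ[OF that] hE[OF that] IH tame_pathD(3)[OF \<gamma> T01[OF that]] k by simp
  have "ordprod b' T hQ m - ordprod b' T hE m = (\<Sum>t\<in>T. hQ t m - hE t m)"
    by (rule ordprod_top_degree(2)[OF finT carQ carE agree]) (simp_all add: k)
  also have "\<dots> = (\<Sum>t\<in>T. degree_sign m (\<gamma>' t) * (wall_sum ?Q (\<gamma> t) m - wall_sum E (\<gamma> t) m))"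
    by (intro sum.cong refl) (simp add: hQ hE k right_diff_distrib)
  also have "\<dots> = (\<Sum>t\<in>{t0}. degree_sign m (\<gamma>' t) * (wall_sum ?Q (\<gamma> t) m - wall_sum E (\<gamma> t) m))"
  proof (rule sum.mono_neutral_right[OF finT])
    show "\<forall>t\<in>T - {t0}. degree_sign m (\<gamma>' t) * (wall_sum ?Q (\<gamma> t) m - wall_sum E (\<gamma> t) m) = 0"
    proof
      fix t assume t: "t \<in> T - {t0}"
      then have "\<gamma> t \<notin> perp m" using t0(2)[of t] T01[of t] by blast
      then have "wall_sum ?Q (\<gamma> t) m = 0" "wall_sum E (\<gamma> t) m = 0"
        using wall_sum_nonzero(2)[OF Q] wall_sum_nonzero(2)[OF E] by blast+
      then show "degree_sign m (\<gamma>' t) * (wall_sum ?Q (\<gamma> t) m - wall_sum E (\<gamma> t) m) = 0" by simp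
    qed
  qed (auto simp: T_def)
  finally show ?thesis unfolding 1 2 by simp
qed

text \<open>Consistency of D needs perturbed paths with common end points. X and Y are therefore
  chosen in one hyperplane \<open>perp n\<close> with n over m, and a single direction U is used, so
  that both paths run from X - U to X + U.\<close>

lemma quot_path_product_eq:
  fixes D :: "('w, 'i) diagram"
  assumes D: "scattering_diagram b D" and con: "consistent b D" and ad: "fold_adapted orb D"
    and m: "m \<in> lat_pos" "deg m = int k" and xy: "x \<in> perp m" "y \<in> perp m"
    and tame: "tame_path (quad_path x u 0) (quad_velocity u 0)"
      "tame_path (quad_path x u (y - x)) (quad_velocity u (y - x))"
  shows "evprod b' (quot_crossings D k (quad_path x u 0)) snd (quot_elt D (quad_velocity u 0)) m =
    evprod b' (quot_crossings D k (quad_path x u (y - x))) snd (quot_elt D (quad_velocity u (y - x))) m"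
proof -
  let ?q = "fold_dual orb"
  obtain n where n: "n \<in> lat_pos" "fold_map orb n = m" by (rule fold_map_surj[OF m(1)])
  let ?P = "\<lambda>z \<theta>. tame_path (tri_path \<theta>) (tri_velocity \<theta>) \<longrightarrow>
      fold_group orb (path_product_upto b D k (tri_path \<theta>)) =
        evprod b' (quot_crossings D k (quad_path x u z)) snd (quot_elt D (quad_velocity u z))"
  have 0: "?q 0 = 0" and diff: "?q (y - x) = ?q y - ?q x"
    by (simp_all add: vec_eq_iff fold_dual_nth)
  obtain e1 where e1: "e1 > 0" "\<And>\<theta>. dist \<theta> (?q x, ?q u, ?q 0) < e1 \<Longrightarrow> ?P 0 \<theta>"
    using quot_perturbation[OF D ad tame(1), of k] unfolding eventually_nhds_metric by blast
  obtain e2 where e2: "e2 > 0" "\<And>\<theta>. dist \<theta> (?q x, ?q u, ?q (y - x)) < e2 \<Longrightarrow> ?P (y - x) \<theta>"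
    using quot_perturbation[OF D ad tame(2), of k] unfolding eventually_nhds_metric by blast
  \<comment> \<open>The third parameter Y - X has error below 2e, so the triple moves by less than e
    + e + 2e.\<close>
  define e where "e = min e1 e2 / 4"
  have e: "e > 0" "4 * e \<le> e1" "4 * e \<le> e2" using e1(1) e2(1) by (auto simp: e_def)
  have "?q x \<in> perp n" "?q y \<in> perp n" using xy n(2) by (simp_all add: fold_dual_perp_iff)
  then obtain X Y where X: "X \<in> perp n" "general_point X" "dist X (?q x) < e"
    and Y: "Y \<in> perp n" "general_point Y" "dist Y (?q y) < e"
    using general_point_dense[OF lat_pos_nonzero[OF n(1)] _ e(1)] by metis
  have "ball (?q u) e \<noteq> {}" using e(1) by simp
  then obtain U where U: "U \<in> ball (?q u) e" "tame_path (quad_path X U 0) (quad_velocity U 0)"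
    "tame_path (quad_path X U (Y - X)) (quad_velocity U (Y - X))"
    using exists_tame_direction[OF lat_pos_nonzero[OF n(1)] X(1) Y(1) X(2) Y(2) open_ball] by blast
  have tri: "dist (a, c, d) (a', c', d') \<le> dist a a' + (dist c c' + dist d d')"
    for a c d a' c' d' :: "real ^ 'i"
  proof -
    have "dist (a, c, d) (a', c', d') \<le> dist a a' + dist (c, d) (c', d')"
      unfolding dist_Pair_Pair[of a] by (rule sqrt_sum_squares_le_sum) auto
    also have "dist (c, d) (c', d') \<le> dist c c' + dist d d'"
      unfolding dist_Pair_Pair by (rule sqrt_sum_squares_le_sum) auto
    finally show ?thesis by simp
  qed
  have Ue: "dist U (?q u) < e" using U(1) by (simp add: dist_commute)
  have "dist (Y - X) (?q y - ?q x) = norm ((Y - ?q y) - (X - ?q x))"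
    by (simp add: dist_norm algebra_simps)
  also have "\<dots> \<le> dist Y (?q y) + dist X (?q x)"
    unfolding dist_norm by (rule norm_triangle_ineq4)
  finally have YX: "dist (Y - X) (?q y - ?q x) \<le> dist Y (?q y) + dist X (?q x)" .
  have d2: "dist (X, U, Y - X) (?q x, ?q u, ?q (y - x)) < e2"
    unfolding diff using tri[of X U "Y - X" "?q x" "?q u" "?q y - ?q x"] YX X(3) Y(3) Ue e by linarith
  have d1: "dist (X, U, 0) (?q x, ?q u, ?q 0) < e1"
    unfolding 0 using tri[of X U 0 "?q x" "?q u" 0] X(3) Ue e by simp
  have PP: "fold_group orb (path_product_upto b D k (quad_path X U 0)) =
        evprod b' (quot_crossings D k (quad_path x u 0)) snd (quot_elt D (quad_velocity u 0))"
    "fold_group orb (path_product_upto b D k (quad_path X U (Y - X))) =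
        evprod b' (quot_crossings D k (quad_path x u (y - x))) snd (quot_elt D (quad_velocity u (y - x)))"
    using e1(2)[OF d1] e2(2)[OF d2] U(2,3) by simp_all
  have pp: "path_product b D (quad_path X U 0) = path_product b D (quad_path X U (Y - X))"
    using con tame_path_generic[OF D U(2)] tame_path_generic[OF D U(3)] unfolding consistent_def
    by (simp add: quad_path_def)
  have "path_product_upto b D k (quad_path X U 0) n = path_product_upto b D k (quad_path X U (Y - X)) n"
    if "fold_map orb n = m" for n
  proof -
    \<comment> \<open>All n over m have degree k, so all their coefficients are read off modulo the
      same order.\<close>
    have "nat (deg n) = k" using that deg_fold_map[of n] m(2) by simp
    then show ?thesis using fun_cong[OF pp, of n] by (simp add: path_product_def)
  qed
  then have "fold_group orb (path_product_upto b D k (quad_path X U 0)) m =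
      fold_group orb (path_product_upto b D k (quad_path X U (Y - X))) m"
    unfolding fold_group_def by (intro sum.cong) auto
  then show ?thesis unfolding PP .
qed

lemma wall_sum_difference_constant:
  assumes D: "scattering_diagram b D" and con: "consistent b D" and ad: "fold_adapted orb D"
    and E: "scattering_diagram b' E" and conE: "consistent b' E"
    and m: "m \<in> lat_pos"
    and IH: "\<And>n x. deg n < deg m \<Longrightarrow> general_point x \<Longrightarrow> wall_sum (quotient_diagram orb D) x n = wall_sum E x n"
    and x: "general_point x" "x \<in> perp m" and y: "general_point y" "y \<in> perp m"
  shows "wall_sum (quotient_diagram orb D) x m - wall_sum E x m =
    wall_sum (quotient_diagram orb D) y m - wall_sum E y m"
proof -
  define k where "k = nat (deg m)"
  have k: "deg m = int k" using deg_pos[OF m] by (simp add: k_def)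
  have m0: "m \<noteq> 0" by (rule lat_pos_nonzero[OF m])
  obtain u where u: "tame_path (quad_path x u 0) (quad_velocity u 0)"
    "tame_path (quad_path x u (y - x)) (quad_velocity u (y - x))"
    using exists_tame_direction[OF m0 x(2) y(2) x(1) y(1) open_UNIV] by blast
  have mz: "pairing m x = 0" "pairing m (y - x) = 0"
    using x(2) y(2) by (simp_all add: perp_iff pairing_diff)
  have "quad_path x u 0 (1 / 2) = x" by (simp add: quad_path_def)
  then have "pairing m u \<noteq> 0"
    using tame_pathD(7)[OF u(1) m0, of "1 / 2"] x(2) by (simp add: pairing_quad_velocity)
  \<comment> \<open>Here m kills x and z, so its pairing with the path is (2t - 1)
    \<open>pairing m u\<close>.\<close>
  then have half: "t = 1 / 2" if "z = 0 \<or> z = y - x" "quad_path x u z t \<in> perp m" for z t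
    using that mz by (auto simp: perp_iff pairing_quad_path)
  have step: "evprod b' (quot_crossings D k (quad_path x u z)) snd (quot_elt D (quad_velocity u z)) m
      - path_product_upto b' E k (quad_path x u z) m = degree_sign m (quad_velocity u z (1 / 2)) *
      (wall_sum (quotient_diagram orb D) (quad_path x u z (1 / 2)) m - wall_sum E (quad_path x u z (1 / 2)) m)"
    if z: "z = 0 \<or> z = y - x" for z
    using u z half[OF z] by (intro path_product_difference[OF D ad E _ _ _ k IH]) auto
  have pp: "path_product b' E (quad_path x u 0) = path_product b' E (quad_path x u (y - x))"
    using conE tame_path_generic[OF E u(1)] tame_path_generic[OF E u(2)] unfolding consistent_def
    by (simp add: quad_path_def)
  have "path_product_upto b' E k (quad_path x u 0) m = path_product_upto b' E k (quad_path x u (y - x)) m"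
    using fun_cong[OF pp, of m] by (simp add: path_product_def k_def)
  moreover note quot_path_product_eq[OF D con ad m k x(2) y(2) u]
  \<comment> \<open>At t = 1/2 both velocities are 2u, so the two differences carry the same nonzero
    sign, which cancels.\<close>
  moreover have "degree_sign m (quad_velocity u 0 (1 / 2)) = degree_sign m (quad_velocity u (y - x) (1 / 2))"
    by (simp add: degree_sign_def pairing_quad_velocity)
  moreover have "degree_sign m v \<noteq> 0" for v by (simp add: degree_sign_def)
  moreover have "quad_path x u 0 (1 / 2) = x" "quad_path x u (y - x) (1 / 2) = y"
    by (simp_all add: quad_path_def)
  ultimately show ?thesis using step[of 0] step[of "y - x"] by simp
qed

theorem quotient_equivalent:
  assumes D: "scattering_diagram b D" and con: "consistent b D" and ad: "fold_adapted orb D"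
    and S: "seed_diagram b (\<lambda>i. 1) S" and eq: "equivalent_diagrams b D S"
    and E: "seed_diagram b' (\<lambda>j. card (orb j)) E"
  shows "equivalent_diagrams b' (quotient_diagram orb D) E"
proof -
  let ?Q = "quotient_diagram orb D"
  have E': "scattering_diagram b' E" "consistent b' E" using E by (simp_all add: seed_diagram_def)
  have Q: "scattering_diagram b' ?Q" by (rule scattering_quotient[OF D])
  have "general_point x \<Longrightarrow> wall_sum ?Q x m = wall_sum E x m" for x m
  proof (induction "nat (deg m)" arbitrary: x m rule: less_induct)
    case less
    show ?case
    proof (cases "m \<in> lat_pos \<and> x \<in> perp m")
      case False
      then show ?thesis
        using wall_sum_nonzero[OF Q, of x m] wall_sum_nonzero[OF E'(1), of x m] by metis
    next
      case True
      have IH: "wall_sum ?Q y n = wall_sum E y n" if "deg n < deg m" "general_point y" for n y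
        using less(1)[of n y] that deg_pos[of m] True by simp
      have "\<forall>\<^sub>F y in nhds (form_dual b' m). y \<in> perp m \<longrightarrow> general_point y \<longrightarrow> wall_sum ?Q y m = wall_sum E y m"
        using quotient_wall_sum_near[OF D ad S eq, of m] seed_wall_sum_near[OF E, of m]
        by eventually_elim simp
      then obtain e where e: "e > 0" "\<And>y. dist y (form_dual b' m) < e \<Longrightarrow> y \<in> perp m \<Longrightarrow> general_point y \<Longrightarrow>
          wall_sum ?Q y m = wall_sum E y m"
        unfolding eventually_nhds_metric by blast
      \<comment> \<open>The point {m, .} itself need not be general; a nearby general point of
        \<open>perp m\<close> serves as base point at which the difference is zero.\<close>
      obtain y where y: "y \<in> perp m" "general_point y" "dist y (form_dual b' m) < e"
        using general_point_dense[OF lat_pos_nonzero form_dual_perp[OF skew_b'] e(1)] True by blast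
      then have "wall_sum ?Q y m - wall_sum E y m = 0" using e(2) by simp
      then show ?thesis
        using wall_sum_difference_constant[OF D con ad E' _ IH less(2) _ y(2,1)] True by simp
    qed
  qed
  then show ?thesis
    unfolding equivalent_diagrams_def
    by (auto simp: elt_at_wall_sum[OF skew_b' Q] elt_at_wall_sum[OF skew_b' E'(1)])
qed

end

theorem theorem1p5:
  fixes b :: "'i::finite \<Rightarrow> 'i \<Rightarrow> int"
    and b' :: "'j::finite \<Rightarrow> 'j \<Rightarrow> int"
    and P :: "('p, 'q) monoid_scheme"
    and act :: "'p \<Rightarrow> 'i \<Rightarrow> 'i"
    and orb :: "'j \<Rightarrow> 'i set"
    and D\<^sub>0 :: "('u, 'i) diagram"
    and D :: "('v, 'i) diagram"
    and E :: "('w, 'j) diagram"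
  assumes "skew_matrix b"
    and "group_action P UNIV act"
    and "finite (carrier P)"
    and "\<And>\<pi>\<^sub>1 \<pi>\<^sub>2 i j. \<pi>\<^sub>1 \<in> carrier P \<Longrightarrow> \<pi>\<^sub>2 \<in> carrier P \<Longrightarrow> b (act \<pi>\<^sub>1 i) (act \<pi>\<^sub>2 j) = b i j"
    and "bij_betw orb UNIV (orbits P UNIV act)"
    and "\<And>k l i j. i \<in> orb k \<Longrightarrow> j \<in> orb l \<Longrightarrow> b' k l = b i j"
    and "seed_diagram b (\<lambda>i. 1) D\<^sub>0"
    and "scattering_diagram b D"
    and "consistent b D"
    and "equivalent_diagrams b D D\<^sub>0"
    and "fold_adapted orb D"
    and "seed_diagram b' (\<lambda>j. card (orb j)) E"
  shows "scattering_diagram b' (quotient_diagram orb D) \<and>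
         equivalent_diagrams b' (quotient_diagram orb D) E"
proof -
  interpret group_action P UNIV act by (rule assms(2))
  have orbit: "orb k \<in> orbits P UNIV act" for k
    using assms(5) by (auto simp: bij_betw_def)
  \<comment> \<open>The orbits cover the index set and are pairwise disjoint, and injectivity of
    \<open>orb\<close> makes the label of each index unique.\<close>
  interpret folding b b' orb
  proof
    show "skew_matrix b" by (rule assms(1))
    fix i
    have "i \<in> \<Union> (orbits P UNIV act)" using orbits_coverture by auto
    then obtain k where k: "i \<in> orb k" using assms(5) by (auto simp: bij_betw_def)
    show "\<exists>!k. i \<in> orb k"
    proof (rule ex1I[of _ k])
      show "i \<in> orb k" by (rule k)
      fix l assume "i \<in> orb l"
      then have "orb l = orb k" using disjoint_union[OF orbit orbit] k by blast
      then show "l = k" using assms(5) by (auto simp: bij_betw_def inj_def)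
    qed
  next
    fix k
    obtain x where "orb k = orbit P act x" using orbit[of k] by (auto simp: orbits_def)
    then show "orb k \<noteq> {}" using orbit_refl[of x] by blast
  next
    show "\<And>k l i j. i \<in> orb k \<Longrightarrow> j \<in> orb l \<Longrightarrow> b' k l = b i j" by (rule assms(6))
  qed
  show ?thesis
    using scattering_quotient[OF assms(8)] quotient_equivalent[OF assms(8,9,11,7,10,12)] ..
qed

end
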